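(* Let $f(\zeta,t)=\sum_{j=1}^\infty a_j(t)\zeta^j$, $0\le t<\infty$, be a global in time locally univalent solution of the Polubarinova-Galin equation with $q(t)>0$ and $Q(t)=\int_0^tq(s)\,ds\to\infty$ as $t\to\infty$, of the form $$f(\zeta,t)=\sum_{j=1}^\ell e_j\log\left(1-\frac{\zeta}{\zeta_j(t)}\right)+\frac{\sum_{j=1}^{m-\ell+1}b_j(t)\zeta^j}{\sum_{j=0}^{n-\ell}c_j(t)\zeta^j},$$ so that $g=f'$ is rational with $m$ zeros and $n\le m$ finite poles counted with multiplicity, $\ell$ being the number of distinct finite poles of $g$. Let $f_N(\zeta,t)=\sum_{j=1}^Na_j(t)\zeta^j$, let $f^{(j)}$ denote the $j$-th derivative in $\zeta$, and let $M_k$ ($k\ge1$) denote the (time independent) harmonic moments. Then: (i) There exist numbers $s_N$ with $s_N\to\infty$ as $N\to\infty$ such that, for $j=0,1$, $$\sup_{\zeta\in\overline{\mathbb{D}}}\left|f_N^{(j)}(\zeta,t)-f^{(j)}(\zeta,t)\right|=O\left(a_1(t)^{-s_N}\right)\quad\text{as }t\to\infty.$$ The same is true for any $j\ge0$, with $s_N$ then depending on $j$. (ii) For each $k\ge2$, $\displaystyle\lim_{t\to\infty}a_k(t)a_1(t)^k=\overline{M}_{k-1}$. (iii) Assume that, for some number $r\ge2$, $M_1=\dots=M_{r-1}=0$ and $M_r\ne0$. Then $$\lim_{t\to\infty}a_s(t)a_1(t)^{r+1}=0\qquad(2\le s\le r),$$ and $r\le m$. In case there are no logarithmic singularities (i.e.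 $e_j=0$ for $1\le j\le\ell$), we even have $r\le m-\ell$.
   Context: $\mathbb{D}$ is the open unit disk; dot denotes $\partial/\partial t$ and prime denotes $\partial/\partial\zeta$. Locally univalent solution: for each $t$, $f(\cdot,t)$ is analytic in a neighborhood of $\overline{\mathbb{D}}$, $f(0,t)=0$, $f'(0,t)=a_1(t)>0$, $f'(\zeta,t)\ne0$ for $\zeta\in\overline{\mathbb{D}}$, $f$ depends smoothly on $t$, and the Polubarinova-Galin equation $\operatorname{Re}[\dot f(\zeta,t)\overline{\zeta f'(\zeta,t)}]=q(t)$ holds for $\zeta\in\partial\mathbb{D}$, where $q$ is a given continuous function. Form of $g=f'$: $g(\zeta,t)=b(t)\prod_{k=1}^m(\zeta-\omega_k(t))\big/\prod_{j=1}^\ell(\zeta-\zeta_j(t))^{n_j}$ with $b(t)\neq 0$, $|\omega_k|>1$, $\zeta_1,\dots,\zeta_\ell$ distinct with $|\zeta_j|>1$, no zero coinciding with a pole, $n_j\ge1$, $n=\sum_{j=1}^\ell n_j\le m$. This form is preserved in time, with the sole exception that when $m=n$ the degree of the numerator may drop below $n$ at one moment of time. The constants $e_j$ are the residues of $g(\zeta)d\zeta$ at $\zeta_j$; they do not depend on $t$ and some or all of them may be zero. The rational part of $f$ has denominator $\sum_{j=0}^{n-\ell}c_j\zeta^j=\prod_{j=1}^\ell(1-\zeta/\zeta_j)^{n_j-1}$, so $c_0=1$. The logarithms are the branches in $\overline{\mathbb{D}}$ vanishing at $\zeta=0$. Harmonic moments: $M_k=\frac{1}{2\pi i}\int_{\partial\mathbb{D}}f(\zeta,t)^kf^*(\zeta,t)f'(\zeta,t)\,d\zeta$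 with $f^*(\zeta,t)=\overline{f(1/\bar\zeta,t)}$; for $k\ge1$ these are independent of $t$. *)

theory Defs
  imports "HOL-Complex_Analysis.Complex_Analysis" "HOL-Library.Landau_Symbols"
begin

text \<open>
  A time dependent map is a function \<open>f :: real \<Rightarrow> complex \<Rightarrow> complex\<close>, time being the first
  argument; only times \<open>t \<ge> 0\<close> matter, so time derivatives are taken within \<open>{0..}\<close>
  (one-sided at \<open>0\<close>).
\<close>

definition time_deriv :: "(real \<Rightarrow> complex \<Rightarrow> complex) \<Rightarrow> real \<Rightarrow> complex \<Rightarrow> complex" where
  "time_deriv f t \<zeta> = vector_derivative (\<lambda>s. f s \<zeta>) (at t within {0..})"

text \<open>
  Smooth dependence on time is read as \<open>C\<^sup>1\<close> dependence in the space of functions analytic near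
  the closed disk: since \<open>q\<close> is merely continuous, no more regularity can be expected.  Locally
  in time there is a common disk of radius \<open>\<rho> > 1\<close> on which all maps are analytic and the time
  derivative is jointly continuous.
\<close>

definition smooth_in_time :: "(real \<Rightarrow> complex \<Rightarrow> complex) \<Rightarrow> bool" where
  "smooth_in_time f \<longleftrightarrow>
    (\<forall>t0\<ge>0. \<exists>\<rho>>1. \<exists>\<epsilon>>0.
      (\<forall>t \<in> {0..} \<inter> ball t0 \<epsilon>. f t holomorphic_on ball 0 \<rho> \<and>
         (\<forall>\<zeta> \<in> ball 0 \<rho>. (\<lambda>s. f s \<zeta>) differentiable (at t within {0..}))) \<and>
      continuous_on (({0..} \<inter> ball t0 \<epsilon>) \<times> ball 0 \<rho>) (\<lambda>(t, \<zeta>). time_deriv f t \<zeta>))"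

definition polubarinova_galin :: "(real \<Rightarrow> real) \<Rightarrow> (real \<Rightarrow> complex \<Rightarrow> complex) \<Rightarrow> bool" where
  "polubarinova_galin q f \<longleftrightarrow>
    (\<forall>t\<ge>0. \<forall>\<zeta> \<in> sphere 0 1. Re (time_deriv f t \<zeta> * cnj (\<zeta> * deriv (f t) \<zeta>)) = q t)"

definition locally_univalent_solution ::
    "(real \<Rightarrow> real) \<Rightarrow> (real \<Rightarrow> complex \<Rightarrow> complex) \<Rightarrow> bool" where
  "locally_univalent_solution q f \<longleftrightarrow>
    (\<forall>t\<ge>0. f t analytic_on cball 0 1 \<and> f t 0 = 0 \<and>
       (\<exists>a>0. deriv (f t) 0 = complex_of_real a) \<and>
       (\<forall>\<zeta> \<in> cball 0 1. deriv (f t) \<zeta> \<noteq> 0)) \<and>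
    smooth_in_time f \<and> polubarinova_galin q f"

text \<open>
  \<open>g\<close> has exactly \<open>d\<close> zeros (with multiplicity), and poles of exact order \<open>\<nu> j\<close> at the distinct
  points \<open>z 1, \<dots>, z l\<close>, all outside the closed disk.
\<close>

definition zero_pole_form ::
    "nat \<Rightarrow> nat \<Rightarrow> (nat \<Rightarrow> nat) \<Rightarrow> (nat \<Rightarrow> complex) \<Rightarrow> (complex \<Rightarrow> complex) \<Rightarrow> bool" where
  "zero_pole_form d l \<nu> z g \<longleftrightarrow>
    inj_on z {1..l} \<and> (\<forall>j\<in>{1..l}. 1 < norm (z j)) \<and>
    (\<exists>b \<omega>. b \<noteq> 0 \<and> (\<forall>k\<in>{1..d}. 1 < norm (\<omega> k) \<and> \<omega> k \<notin> z ` {1..l}) \<and>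
       (\<forall>\<zeta> \<in> cball 0 1.
          g \<zeta> = b * (\<Prod>k=1..d. \<zeta> - \<omega> k) / (\<Prod>j=1..l. (\<zeta> - z j) ^ \<nu> j)))"

text \<open>
  The form of \<open>f' = g\<close> is preserved in time, except that for \<open>m = n\<close> the degree \<open>d\<close> of the
  numerator may drop below \<open>n\<close> at one moment of time.
\<close>

definition deriv_form_preserved ::
    "nat \<Rightarrow> nat \<Rightarrow> nat \<Rightarrow> (nat \<Rightarrow> nat) \<Rightarrow> (nat \<Rightarrow> real \<Rightarrow> complex) \<Rightarrow>
     (real \<Rightarrow> complex \<Rightarrow> complex) \<Rightarrow> bool" where
  "deriv_form_preserved m n l \<nu> z f \<longleftrightarrow>
    (\<exists>d :: real \<Rightarrow> nat.
      (\<forall>t\<ge>0. zero_pole_form (d t) l \<nu> (\<lambda>j. z j t) (deriv (f t))) \<and>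
      ((\<forall>t\<ge>0. d t = m) \<or>
       (m = n \<and> (\<exists>t0\<ge>0. d t0 < n \<and> (\<forall>t\<ge>0. t \<noteq> t0 \<longrightarrow> d t = m)))))"

text \<open>
  Logarithms plus rational part.  As \<open>|z j t| > 1\<close>, the numbers \<open>1 - \<zeta> / z j t\<close> lie in the right
  half-plane for \<open>|\<zeta>| \<le> 1\<close>, so the principal branch \<open>Ln\<close> is the branch vanishing at \<open>\<zeta> = 0\<close>.
\<close>

definition log_rational_form ::
    "nat \<Rightarrow> nat \<Rightarrow> nat \<Rightarrow> (nat \<Rightarrow> nat) \<Rightarrow> (nat \<Rightarrow> complex) \<Rightarrow> (nat \<Rightarrow> real \<Rightarrow> complex) \<Rightarrow>
     (nat \<Rightarrow> real \<Rightarrow> complex) \<Rightarrow> (nat \<Rightarrow> real \<Rightarrow> complex) \<Rightarrow> (real \<Rightarrow> complex \<Rightarrow> complex) \<Rightarrow> bool" where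
  "log_rational_form m n l \<nu> e z b c f \<longleftrightarrow>
    (\<forall>t\<ge>0.
      (\<forall>\<zeta>. (\<Sum>j=0..n-l. c j t * \<zeta> ^ j) = (\<Prod>j=1..l. (1 - \<zeta> / z j t) ^ (\<nu> j - 1))) \<and>
      (\<forall>\<zeta> \<in> cball 0 1.
         f t \<zeta> = (\<Sum>j=1..l. e j * Ln (1 - \<zeta> / z j t)) +
                 (\<Sum>j=1..m-l+1. b j t * \<zeta> ^ j) / (\<Sum>j=0..n-l. c j t * \<zeta> ^ j)))"

definition taylor_coeff :: "(complex \<Rightarrow> complex) \<Rightarrow> nat \<Rightarrow> complex" where
  "taylor_coeff F k = (deriv ^^ k) F 0 / fact k"

definition taylor_section :: "(complex \<Rightarrow> complex) \<Rightarrow> nat \<Rightarrow> complex \<Rightarrow> complex" where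
  "taylor_section F N \<zeta> = (\<Sum>j=1..N. taylor_coeff F j * \<zeta> ^ j)"

definition section_error :: "(complex \<Rightarrow> complex) \<Rightarrow> nat \<Rightarrow> nat \<Rightarrow> real" where
  "section_error F N j =
    (SUP \<zeta> \<in> cball 0 1. norm ((deriv ^^ j) (taylor_section F N) \<zeta> - (deriv ^^ j) F \<zeta>))"

text \<open>
  The moments of order \<open>k \<ge> 1\<close> of a Polubarinova-Galin solution do not depend on time, so they
  may be evaluated on \<open>f \<tau>\<close> for an arbitrary time \<open>\<tau> \<ge> 0\<close>.
\<close>

definition harmonic_moment :: "(complex \<Rightarrow> complex) \<Rightarrow> nat \<Rightarrow> complex" where
  "harmonic_moment F k =
    1 / (2 * of_real pi * \<i>) *
    contour_integral (circlepath 0 1) (\<lambda>\<zeta>. F \<zeta> ^ k * cnj (F (1 / cnj \<zeta>)) * deriv F \<zeta>)"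

end

theory Submission
  imports Defs "HOL-Computational_Algebra.Polynomial_Factorial" "HOL-Computational_Algebra.Field_as_Ring"
begin

text \<open>
  Write \<open>f' = a \<Prod>(1 - \<theta>\<^sub>k \<zeta>) / \<Prod>(1 - \<eta>\<^sub>j \<zeta>)\<^bsup>\<nu>\<^sub>j\<^esup>\<close> with \<open>a = a\<^sub>1\<close>.  Reflecting the Polubarinova-Galin equation in the unit
  circle shows that a pole \<open>\<zeta>\<^sub>j = 1 / \<eta>\<^sub>j\<close> moves with velocity \<open>\<zeta>\<^sub>j cnj (P (cnj \<eta>\<^sub>j))\<close>, where \<open>P = fdot / (\<zeta> f')\<close> has
  positive real part and \<open>Re (P 0) = (log a)'\<close>; by Harnack's inequality \<open>|\<zeta>\<^sub>j| \<ge> const * a\<^bsup>\<kappa>\<^esup>\<close> for some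
  \<open>\<kappa> > 0\<close>.  Hence \<open>f'\<close> is bounded by a multiple of \<open>a\<close> on the disk, and growth of the area forces \<open>a \<rightarrow> \<infinity>\<close>.
  Cauchy's inequality on a disk of radius comparable to \<open>a\<^bsup>\<kappa>\<^esup>\<close> makes the tails \<open>\<Sum>\<^bsub>k>N\<^esub> k\<^sup>j |a\<^sub>k|\<close> smaller than any
  given negative power of \<open>a\<close> once \<open>N\<close> is large.  Finally \<open>M\<^sub>k = a\<^bsup>k+1\<^esup> cnj a\<^bsub>k+1\<^esub>\<close> up to an error that is controlled
  by \<open>\<Sum>\<^bsub>j>k+1\<^esub> j |a\<^sub>j|\<close>, and descending induction on the index gives the limits.  The bounds on \<open>r\<close> come
  from the linear recurrence satisfied by the Taylor coefficients of a rational function.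
\<close>

subsection \<open>Limits of polynomials and of poles\<close>

text \<open>Zeros and poles are given at each time separately. Nothing says that a pole depends
  continuously on time, and the labels may be permuted from one time to the next, so the poles
  cannot be differentiated. What is smooth in time is \<open>f'\<close> on the disk. The proof
  therefore works with sequences of times t_n -> T: along a subsequence all zeros and poles
  converge, uniqueness of reduced fractions identifies the limits with the configuration at time T
  up to a permutation \<open>\<sigma>\<close>, and the difference quotients of the matched poles
  have a computable limit. The growth of the poles then follows from a first-exit argument instead
  of an integration. Reciprocals of zeros and poles are used because they stay in the unit disk,
  which gives compactness, and because a zero at infinity then simply becomes 0. Convergence of
  difference quotients is known inside the disk only, while the poles lie outside; bounded degree of
  the numerators carries it across.\<close>

lemma harnack_lower_bound:
  fixes h :: "complex \<Rightarrow> complex"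
  assumes hol: "h holomorphic_on ball 0 1"
    and pos: "\<And>z. norm z < 1 \<Longrightarrow> 0 < Re (h z)"
    and w: "norm w < 1"
  shows "Re (h 0) * ((1 - norm w) / (1 + norm w)) \<le> Re (h w)"
proof -
  let ?p = "h 0"
  \<comment> \<open>This Cayley transform takes the right half-plane to the disk and
    \<open>h 0\<close> to 0, so the Schwarz lemma applies.\<close>
  define u where "u = (\<lambda>z. (h z - ?p) / (h z + cnj ?p))"
  have p: "0 < Re ?p" using pos[of 0] by simp
  have nz: "h z + cnj ?p \<noteq> 0" if "norm z < 1" for z
  proof -
    have "0 < Re (h z + cnj ?p)" using pos[OF that] p by simp
    then show ?thesis by (metis less_irrefl zero_complex.simps(1))
  qed
  have less: "norm (u z) < 1" if "norm z < 1" for z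
  proof -
    have "(norm (h z - ?p))\<^sup>2 < (norm (h z + cnj ?p))\<^sup>2"
    proof -
      have "(norm (h z + cnj ?p))\<^sup>2 - (norm (h z - ?p))\<^sup>2 = 4 * Re (h z) * Re ?p"
        unfolding cmod_power2 by (simp add: power2_eq_square algebra_simps)
      also have "\<dots> > 0" using pos[OF that] p by simp
      finally show ?thesis by simp
    qed
    then have "norm (h z - ?p) < norm (h z + cnj ?p)" by (rule power2_less_imp_less) simp
    then show ?thesis using nz[OF that] by (simp add: u_def norm_divide divide_less_eq)
  qed
  have "norm (u w) \<le> norm w"
  proof (rule Schwarz_Lemma)
    show "u holomorphic_on ball 0 1"
      unfolding u_def using nz by (intro holomorphic_intros hol) auto
  qed (use less w in \<open>auto simp: u_def\<close>)
  then have "norm (h w - ?p) \<le> norm w * norm (h w + cnj ?p)"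
    using nz[OF w] by (simp add: u_def norm_divide divide_le_eq)
  then have "(norm (h w - ?p))\<^sup>2 \<le> (norm w * norm (h w + cnj ?p))\<^sup>2"
    by (intro power_mono) auto
  then have "(Re (h w) - Re ?p)\<^sup>2 + (Im (h w) - Im ?p)\<^sup>2 \<le>
      (norm w)\<^sup>2 * ((Re (h w) + Re ?p)\<^sup>2 + (Im (h w) - Im ?p)\<^sup>2)"
    unfolding power_mult_distrib cmod_power2[of "h w - h 0"] cmod_power2[of "h w + cnj (h 0)"]
    by simp
  \<comment> \<open>Since |w| \<le> 1, the imaginary part on the right is dominated by the one on
    the left; dropping both leaves an inequality between real parts.\<close>
  moreover have "(norm w)\<^sup>2 * (Im (h w) - Im ?p)\<^sup>2 \<le> (Im (h w) - Im ?p)\<^sup>2"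
    using w by (intro mult_left_le_one_le) (auto simp: power_le_one)
  ultimately have "(Re (h w) - Re ?p)\<^sup>2 \<le> (norm w * (Re (h w) + Re ?p))\<^sup>2"
    unfolding power_mult_distrib distrib_left[of "(norm w)\<^sup>2"] by linarith
  then have "\<bar>Re (h w) - Re ?p\<bar> \<le> norm w * (Re (h w) + Re ?p)"
    using pos[OF w] p by (metis abs_le_square_iff abs_of_nonneg add_nonneg_nonneg less_imp_le mult_nonneg_nonneg norm_ge_zero)
  then have "Re ?p * (1 - norm w) \<le> Re (h w) * (1 + norm w)"
    by (simp add: algebra_simps)
  then show ?thesis by (simp add: field_simps add_pos_nonneg)
qed

text \<open>Dividing out the value at one point \<open>a\<close> of \<open>S\<close> lowers the
  degree bound, and the quotients converge on \<open>S - {a}\<close>; this drives the induction. The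
  lemma moves limits known inside the unit disk to neighbourhoods of the poles outside it.\<close>

lemma poly_uniform_limit_bounded:
  fixes p :: "nat \<Rightarrow> complex poly"
  assumes "\<And>n. degree (p n) \<le> D" "infinite S" "\<And>x. x \<in> S \<Longrightarrow> convergent (\<lambda>n. poly (p n) x)"
  shows "\<exists>P. \<forall>K. bounded K \<longrightarrow> uniform_limit K (\<lambda>n. poly (p n)) (poly P) sequentially"
  using assms
proof (induction D arbitrary: p S)
  case 0
  obtain a where a: "a \<in> S" using \<open>infinite S\<close> by fastforce
  from 0(3)[OF a] obtain c where c: "(\<lambda>n. poly (p n) a) \<longlonglongrightarrow> c" by (auto simp: convergent_def)
  have eq: "poly (p n) x = poly (p n) a" for n x
    using 0(1)[of n] by (metis degree_eq_zeroE le_zero_eq mult_zero_right poly_0 poly_pCons)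
  have "uniform_limit K (\<lambda>n. poly (p n)) (poly [:c:]) sequentially" for K
    unfolding uniform_limit_iff
  proof (intro allI impI)
    fix e :: real assume "e > 0"
    then have "\<forall>\<^sub>F n in sequentially. dist (poly (p n) a) c < e" using c tendstoD by blast
    then show "\<forall>\<^sub>F n in sequentially. \<forall>x\<in>K. dist (poly (p n) x) (poly [:c:] x) < e"
      by eventually_elim (metis eq poly_pCons poly_0 mult_zero_right add.right_neutral)
  qed
  then show ?case by blast
next
  case (Suc D)
  obtain a where a: "a \<in> S" using \<open>infinite S\<close> by fastforce
  from Suc(4)[OF a] obtain c where c: "(\<lambda>n. poly (p n) a) \<longlonglongrightarrow> c" by (auto simp: convergent_def)
  define s where "s = (\<lambda>n. synthetic_div (p n) a)"
  have ps: "poly (p n) x = poly (p n) a + (x - a) * poly (s n) x" for n x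
  proof -
    have "poly ([:-a, 1:] * s n + [:poly (p n) a:]) x = poly (p n) x"
      unfolding s_def by (simp only: synthetic_div_correct')
    then show ?thesis by (simp add: algebra_simps)
  qed
  have "\<exists>P. \<forall>K. bounded K \<longrightarrow> uniform_limit K (\<lambda>n. poly (s n)) (poly P) sequentially"
  proof (rule Suc.IH)
    show "degree (s n) \<le> D" for n
      using Suc(2)[of n] by (simp add: s_def degree_synthetic_div)
    show "infinite (S - {a})" using \<open>infinite S\<close> by simp
    fix x assume x: "x \<in> S - {a}"
    then obtain d where d: "(\<lambda>n. poly (p n) x) \<longlonglongrightarrow> d" using Suc(4)[of x] by (auto simp: convergent_def)
    have "(\<lambda>n. (poly (p n) x - poly (p n) a) / (x - a)) \<longlonglongrightarrow> (d - c) / (x - a)"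
      by (intro tendsto_intros c d) (use x in auto)
    moreover have "(\<lambda>n. (poly (p n) x - poly (p n) a) / (x - a)) = (\<lambda>n. poly (s n) x)"
      using x ps[of _ x] by (auto simp: field_simps fun_eq_iff)
    ultimately show "convergent (\<lambda>n. poly (s n) x)" by (auto simp: convergent_def)
  qed
  then obtain P where P: "\<And>K. bounded K \<Longrightarrow> uniform_limit K (\<lambda>n. poly (s n)) (poly P) sequentially" by blast
  have "uniform_limit K (\<lambda>n. poly (p n)) (poly ([:c:] + [:-a, 1:] * P)) sequentially" if K: "bounded K" for K
  proof -
    have bP: "bounded (poly P ` K)"
    proof (rule bounded_subset)
      show "bounded (poly P ` closure K)"
        using K by (intro compact_imp_bounded compact_continuous_image continuous_intros) (simp add: compact_closure)
    qed (use closure_subset in blast)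
    have ba: "bounded ((\<lambda>x. x - a) ` K)" using K by (simp add: bounded_translation_minus)
    have c': "uniform_limit K (\<lambda>n x. poly (p n) a) (\<lambda>x. c) sequentially"
      unfolding uniform_limit_iff using tendstoD[OF c] by (auto elim!: eventually_mono)
    have "uniform_limit K (\<lambda>n x. poly (p n) a + (x - a) * poly (s n) x) (\<lambda>x. c + (x - a) * poly P x) sequentially"
      by (intro uniform_limit_intros uniform_lim_mult uniform_limit_const c' P K bP ba)
    moreover have "(\<lambda>n x. poly (p n) a + (x - a) * poly (s n) x) = (\<lambda>n. poly (p n))"
      by (intro ext) (rule ps[symmetric])
    moreover have "(\<lambda>x. c + (x - a) * poly P x) = poly ([:c:] + [:-a, 1:] * P)"
      by (rule ext) (simp add: algebra_simps)
    ultimately show ?thesis by simp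
  qed
  then show ?case by blast
qed

lemma bounded_family_convergent_subseq:
  fixes x :: "nat \<Rightarrow> 'i \<Rightarrow> complex"
  assumes "finite I" "\<And>n i. i \<in> I \<Longrightarrow> norm (x n i) \<le> B"
  shows "\<exists>r y. strict_mono (r :: nat \<Rightarrow> nat) \<and> (\<forall>i\<in>I. (\<lambda>n. x (r n) i) \<longlonglongrightarrow> y i)"
  using assms
proof (induction I rule: finite_induct)
  case empty
  show ?case by (intro exI[of _ id]) (auto simp: strict_mono_def)
next
  case (insert j I)
  then obtain r y where r: "strict_mono (r :: nat \<Rightarrow> nat)" and y: "\<forall>i\<in>I. (\<lambda>n. x (r n) i) \<longlonglongrightarrow> y i"
    by auto
  have "bounded (range (\<lambda>n. x (r n) j))" using insert.prems by (auto simp: bounded_iff)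
  then obtain l r' where r': "strict_mono (r' :: nat \<Rightarrow> nat)" and l: "((\<lambda>n. x (r n) j) \<circ> r') \<longlonglongrightarrow> l"
    using bounded_imp_convergent_subsequence by blast
  have "strict_mono (r \<circ> r')" using r r' by (rule strict_mono_o)
  moreover have "(\<lambda>n. x ((r \<circ> r') n) i) \<longlonglongrightarrow> (y(j := l)) i" if "i \<in> insert j I" for i
  proof (cases "i = j")
    case True then show ?thesis using l by (simp add: o_def)
  next
    case False
    then have "((\<lambda>n. x (r n) i) \<circ> r') \<longlonglongrightarrow> y i"
      using that y r' by (intro LIMSEQ_subseq_LIMSEQ) auto
    then show ?thesis using False by (simp add: o_def)
  qed
  ultimately show ?case by blast
qed

text \<open>\<open>1 + \<tau> * q\<close> is the ratio of two nearby functions, one with a pole of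
  order \<open>\<mu>0\<close> at \<open>\<zeta>0\<close>, the other with a pole of order
  \<open>\<mu>\<close> at \<open>x n\<close>. Its logarithm divided by \<tau> tends to
  \<open>q0\<close>, while the contour integral of the logarithm is 2 pi i \<mu> (x_n - \<zeta>0);
  comparing the two gives the speed. The orders are kept apart because poles will be matched by
  position only.\<close>

lemma pole_speed_contour:
  fixes q :: "nat \<Rightarrow> complex \<Rightarrow> complex" and \<tau> :: "nat \<Rightarrow> real" and x :: "nat \<Rightarrow> complex"
  assumes \<delta>: "0 < \<delta>" "\<delta> < \<delta>'"
    and \<tau>0: "\<tau> \<longlonglongrightarrow> 0" and \<tau>nz: "\<And>n. \<tau> n \<noteq> 0" and x: "x \<longlonglongrightarrow> \<zeta>0"
    and qlim: "uniform_limit (sphere \<zeta>0 \<delta>) q q0 sequentially"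
    and q0: "continuous_on (sphere \<zeta>0 \<delta>) q0"
    and \<kappa>: "\<forall>\<^sub>F n in sequentially. \<kappa> n holomorphic_on ball \<zeta>0 \<delta>' \<and> (\<forall>\<zeta>\<in>ball \<zeta>0 \<delta>'. \<kappa> n \<zeta> \<noteq> 0) \<and>
      (\<forall>\<zeta>\<in>ball \<zeta>0 \<delta>' - {\<zeta>0, x n}.
        1 + of_real (\<tau> n) * q n \<zeta> = (\<zeta> - \<zeta>0) ^ \<mu>0 / (\<zeta> - x n) ^ \<mu> * \<kappa> n \<zeta>)"
  shows "(\<lambda>n. of_nat \<mu> * (x n - \<zeta>0) / of_real (\<tau> n)) \<longlonglongrightarrow>
    contour_integral (circlepath \<zeta>0 \<delta>) q0 / (2 * of_real pi * \<i>)"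
proof -
  let ?\<gamma> = "circlepath \<zeta>0 \<delta>" and ?S = "sphere \<zeta>0 \<delta>"
  define u where "u = (\<lambda>n \<zeta>. (\<zeta> - \<zeta>0) ^ \<mu>0 / (\<zeta> - x n) ^ \<mu> * \<kappa> n \<zeta>)"
  define h where "h = (\<lambda>n \<zeta>. Ln (u n \<zeta>))"
  have compS: "compact ?S" by simp
  have "bounded (q0 ` ?S)" using q0 compS by (simp add: compact_continuous_image compact_imp_bounded)
  then obtain B0 where B0: "\<And>\<zeta>. \<zeta> \<in> ?S \<Longrightarrow> norm (q0 \<zeta>) \<le> B0" unfolding bounded_iff by blast
  define B where "B = \<bar>B0\<bar> + 1"
  have B: "B \<ge> 1" by (simp add: B_def)
  have evB: "\<forall>\<^sub>F n in sequentially. \<forall>\<zeta>\<in>?S. norm (q n \<zeta>) \<le> B"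
    using uniform_limitD[OF qlim zero_less_one]
  proof eventually_elim
    case (elim n)
    show ?case
    proof
      fix \<zeta> assume \<zeta>: "\<zeta> \<in> ?S"
      have "norm (q n \<zeta>) \<le> norm (q0 \<zeta>) + dist (q n \<zeta>) (q0 \<zeta>)"
        by (metis dist_norm norm_triangle_sub)
      then show "norm (q n \<zeta>) \<le> B" using elim \<zeta> B0[OF \<zeta>] unfolding B_def by fastforce
    qed
  qed
  \<comment> \<open>Then the ratio stays within 1/2 of 1 on the circle, where the principal
    logarithm is holomorphic.\<close>
  have ev\<tau>: "\<forall>\<^sub>F n in sequentially. \<bar>\<tau> n\<bar> * B < 1/2"
  proof -
    have "(\<lambda>n. \<bar>\<tau> n\<bar> * B) \<longlonglongrightarrow> \<bar>0\<bar> * B" by (intro tendsto_intros \<tau>0)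
    then show ?thesis by (rule order_tendstoD(2)) simp
  qed
  have evx: "\<forall>\<^sub>F n in sequentially. dist (x n) \<zeta>0 < \<delta>" using tendstoD[OF x \<delta>(1)] .
  define ok where "ok = (\<lambda>n. \<kappa> n holomorphic_on ball \<zeta>0 \<delta>' \<and> (\<forall>\<zeta>\<in>ball \<zeta>0 \<delta>'. \<kappa> n \<zeta> \<noteq> 0) \<and>
      (\<forall>\<zeta>\<in>ball \<zeta>0 \<delta>' - {\<zeta>0, x n}.
        1 + of_real (\<tau> n) * q n \<zeta> = (\<zeta> - \<zeta>0) ^ \<mu>0 / (\<zeta> - x n) ^ \<mu> * \<kappa> n \<zeta>))"
  have eqS: "u n \<zeta> = 1 + of_real (\<tau> n) * q n \<zeta>" if "\<zeta> \<in> ?S" "dist (x n) \<zeta>0 < \<delta>" "ok n" for n \<zeta>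
  proof -
    have "\<zeta> \<noteq> \<zeta>0" "\<zeta> \<noteq> x n" "\<zeta> \<in> ball \<zeta>0 \<delta>'"
      using that \<delta> by (auto simp: dist_commute)
    then show ?thesis using that(3) by (simp add: u_def ok_def)
  qed
  have ev: "\<forall>\<^sub>F n in sequentially. dist (x n) \<zeta>0 < \<delta> \<and> \<bar>\<tau> n\<bar> * B < 1/2 \<and> (\<forall>\<zeta>\<in>?S. norm (q n \<zeta>) \<le> B) \<and> ok n"
    using evx ev\<tau> evB \<kappa>[folded ok_def] by eventually_elim auto
  have small: "norm (of_real (\<tau> n) * q n \<zeta>) < 1/2"
    if "\<bar>\<tau> n\<bar> * B < 1/2" "\<forall>\<zeta>\<in>?S. norm (q n \<zeta>) \<le> B" "\<zeta> \<in> ?S" for n \<zeta>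
  proof -
    have "norm (of_real (\<tau> n) * q n \<zeta>) \<le> \<bar>\<tau> n\<bar> * B"
      using that by (auto simp: norm_mult intro!: mult_left_mono)
    then show ?thesis using that by simp
  qed
  have Ren: "u n \<zeta> \<notin> \<real>\<^sub>\<le>\<^sub>0"
    if "dist (x n) \<zeta>0 < \<delta>" "\<bar>\<tau> n\<bar> * B < 1/2" "\<forall>\<zeta>\<in>?S. norm (q n \<zeta>) \<le> B" "\<zeta> \<in> ?S" "ok n" for n \<zeta>
  proof -
    have "\<bar>Re (of_real (\<tau> n) * q n \<zeta>)\<bar> < 1/2"
      using small[OF that(2-4)] abs_Re_le_cmod order_le_less_trans by blast
    then have "Re (u n \<zeta>) > 0" using eqS[OF that(4,1,5)] by simp
    then show ?thesis by (auto simp: complex_nonpos_Reals_iff)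
  qed
  \<comment> \<open>Integration by parts: \<open>(\<zeta> - \<zeta>0) * h n \<zeta>\<close> is
    single-valued along the circle, so the integral of \<open>h n\<close> is minus that of
    \<open>R\<close>, and in \<open>R\<close> only the term with the pole at \<open>x n\<close>
    contributes.\<close>
  have main: "(h n has_contour_integral 2 * of_real pi * \<i> * (of_nat \<mu> * (x n - \<zeta>0))) ?\<gamma>"
    if xn: "dist (x n) \<zeta>0 < \<delta>" and tn: "\<bar>\<tau> n\<bar> * B < 1/2" "\<forall>\<zeta>\<in>?S. norm (q n \<zeta>) \<le> B"
      and okn: "ok n" for n
  proof -
    have kn: "\<forall>\<zeta>\<in>ball \<zeta>0 \<delta>'. \<kappa> n \<zeta> \<noteq> 0" and kh: "\<kappa> n holomorphic_on ball \<zeta>0 \<delta>'"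
      using okn by (auto simp: ok_def)
    define R where "R = (\<lambda>\<zeta>. of_nat \<mu>0 - of_nat \<mu> * ((\<zeta> - \<zeta>0) / (\<zeta> - x n))
        + (\<zeta> - \<zeta>0) * (deriv (\<kappa> n) \<zeta> / \<kappa> n \<zeta>))"
    have d: "((\<lambda>\<zeta>. (\<zeta> - \<zeta>0) * h n \<zeta>) has_field_derivative (h n \<zeta> + R \<zeta>)) (at \<zeta> within ?S)"
      if \<zeta>: "\<zeta> \<in> ?S" for \<zeta>
    proof -
      have ne: "\<zeta> - \<zeta>0 \<noteq> 0" "\<zeta> - x n \<noteq> 0" and in': "\<zeta> \<in> ball \<zeta>0 \<delta>'"
        using \<zeta> xn \<delta> by (auto simp: dist_commute)
      have k: "(\<kappa> n has_field_derivative deriv (\<kappa> n) \<zeta>) (at \<zeta>)"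
        using kh in' by (simp add: holomorphic_derivI)
      have kz: "\<kappa> n \<zeta> \<noteq> 0" using kn in' by blast
      have p0: "of_nat \<mu>0 * y ^ (\<mu>0 - Suc 0) * y = of_nat \<mu>0 * y ^ \<mu>0" for y :: complex
        by (cases \<mu>0) auto
      have p1: "of_nat \<mu> * y ^ (\<mu> - Suc 0) * y = of_nat \<mu> * y ^ \<mu>" for y :: complex
        by (cases \<mu>) auto
      define X where "X = \<zeta> - \<zeta>0" define Y where "Y = \<zeta> - x n"
      have XY: "X \<noteq> 0" "Y \<noteq> 0" using ne by (auto simp: X_def Y_def)
      have D1: "((\<lambda>\<zeta>. (\<zeta> - \<zeta>0) ^ \<mu>0) has_field_derivative of_nat \<mu>0 * X ^ (\<mu>0 - Suc 0)) (at \<zeta>)"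
        unfolding X_def by (auto intro!: derivative_eq_intros)
      have D2: "((\<lambda>\<zeta>. (\<zeta> - x n) ^ \<mu>) has_field_derivative of_nat \<mu> * Y ^ (\<mu> - Suc 0)) (at \<zeta>)"
        unfolding Y_def by (auto intro!: derivative_eq_intros)
      have Yp: "(\<zeta> - x n) ^ \<mu> \<noteq> 0" using ne by simp
      have "(u n has_field_derivative
          ((of_nat \<mu>0 * X ^ (\<mu>0 - Suc 0)) * Y ^ \<mu> - X ^ \<mu>0 * (of_nat \<mu> * Y ^ (\<mu> - Suc 0))) / (Y ^ \<mu> * Y ^ \<mu>) * \<kappa> n \<zeta>
           + X ^ \<mu>0 / Y ^ \<mu> * deriv (\<kappa> n) \<zeta>) (at \<zeta>)"
        using DERIV_mult[OF DERIV_divide[OF D1 D2 Yp] k]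
        unfolding u_def X_def[symmetric] Y_def[symmetric] by (simp add: mult.commute)
      moreover have "((of_nat \<mu>0 * X ^ (\<mu>0 - Suc 0)) * Y ^ \<mu> - X ^ \<mu>0 * (of_nat \<mu> * Y ^ (\<mu> - Suc 0))) / (Y ^ \<mu> * Y ^ \<mu>) * \<kappa> n \<zeta>
           + X ^ \<mu>0 / Y ^ \<mu> * deriv (\<kappa> n) \<zeta>
           = u n \<zeta> * (of_nat \<mu>0 / X - of_nat \<mu> / Y + deriv (\<kappa> n) \<zeta> / \<kappa> n \<zeta>)"
      proof -
        have q0: "of_nat \<mu>0 * X ^ (\<mu>0 - Suc 0) = of_nat \<mu>0 * X ^ \<mu>0 / X"
          using p0[of X] XY by (simp add: field_simps)
        have q1: "of_nat \<mu> * Y ^ (\<mu> - Suc 0) = of_nat \<mu> * Y ^ \<mu> / Y"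
          using p1[of Y] XY by (simp add: field_simps)
        show ?thesis unfolding q0 q1 unfolding u_def X_def[symmetric] Y_def[symmetric]
          using XY kz by (simp add: field_simps)
      qed
      ultimately have du: "(u n has_field_derivative
         u n \<zeta> * (of_nat \<mu>0 / X - of_nat \<mu> / Y + deriv (\<kappa> n) \<zeta> / \<kappa> n \<zeta>)) (at \<zeta>)" by simp
      have nr: "u n \<zeta> \<notin> \<real>\<^sub>\<le>\<^sub>0" by (rule Ren[OF xn tn \<zeta> okn])
      then have un: "u n \<zeta> \<noteq> 0" by auto
      have "(h n has_field_derivative
         (of_nat \<mu>0 / X - of_nat \<mu> / Y + deriv (\<kappa> n) \<zeta> / \<kappa> n \<zeta>)) (at \<zeta>)"
        unfolding h_def by (rule derivative_eq_intros du nr refl)+ (use un in \<open>simp add: field_simps\<close>)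
      then have "((\<lambda>\<zeta>. (\<zeta> - \<zeta>0) * h n \<zeta>) has_field_derivative
         (h n \<zeta> + (\<zeta> - \<zeta>0) * (of_nat \<mu>0 / X - of_nat \<mu> / Y + deriv (\<kappa> n) \<zeta> / \<kappa> n \<zeta>))) (at \<zeta>)"
        by (auto intro!: derivative_eq_intros)
      moreover have "(\<zeta> - \<zeta>0) * (of_nat \<mu>0 / X - of_nat \<mu> / Y + deriv (\<kappa> n) \<zeta> / \<kappa> n \<zeta>) = R \<zeta>"
        unfolding R_def X_def[symmetric] Y_def[symmetric] using XY(1) by (simp add: distrib_left right_diff_distrib)
      ultimately show ?thesis by (simp add: has_field_derivative_at_within)
    qed
    have i0: "((\<lambda>\<zeta>. h n \<zeta> + R \<zeta>) has_contour_integral 0) ?\<gamma>"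
      using contour_integral_primitive[OF d, of ?\<gamma>] \<delta> by simp
    have "((\<lambda>\<zeta>. (\<zeta> - \<zeta>0) / (\<zeta> - x n)) has_contour_integral 2 * of_real pi * \<i> * (x n - \<zeta>0)) ?\<gamma>"
      by (rule Cauchy_integral_circlepath) (use xn in \<open>auto intro!: continuous_intros holomorphic_intros simp: dist_norm\<close>)
    then have i1: "((\<lambda>\<zeta>. of_nat \<mu> * ((\<zeta> - \<zeta>0) / (\<zeta> - x n))) has_contour_integral of_nat \<mu> * (2 * of_real pi * \<i> * (x n - \<zeta>0))) ?\<gamma>"
      by (rule has_contour_integral_lmul)
    have i2: "((\<lambda>\<zeta>. of_nat \<mu>0 + (\<zeta> - \<zeta>0) * (deriv (\<kappa> n) \<zeta> / \<kappa> n \<zeta>)) has_contour_integral 0) ?\<gamma>"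
    proof (rule Cauchy_theorem_convex_simple[where S = "ball \<zeta>0 \<delta>'"])
      show "(\<lambda>\<zeta>. of_nat \<mu>0 + (\<zeta> - \<zeta>0) * (deriv (\<kappa> n) \<zeta> / \<kappa> n \<zeta>)) holomorphic_on ball \<zeta>0 \<delta>'"
        using kn by (intro holomorphic_intros kh holomorphic_deriv) auto
    qed (use \<delta> in auto)
    have "(R has_contour_integral (0 - of_nat \<mu> * (2 * of_real pi * \<i> * (x n - \<zeta>0)))) ?\<gamma>"
      using has_contour_integral_diff[OF i2 i1] by (simp add: R_def algebra_simps)
    from has_contour_integral_diff[OF i0 this] show ?thesis by (simp add: algebra_simps)
  qed
  \<comment> \<open>\<open>Ln (1 + v) - v\<close> is quadratic in v = \<tau> q, hence division by
    \<tau> leaves an error of order \<tau>.\<close>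
  have lim_h: "uniform_limit ?S (\<lambda>n \<zeta>. h n \<zeta> / of_real (\<tau> n)) q0 sequentially"
    unfolding uniform_limit_iff
  proof (intro allI impI)
    fix e :: real assume e: "e > 0"
    have "(\<lambda>n. \<bar>\<tau> n\<bar> * (2 * B\<^sup>2)) \<longlonglongrightarrow> \<bar>0\<bar> * (2 * B\<^sup>2)" by (intro tendsto_intros \<tau>0)
    then have "\<forall>\<^sub>F n in sequentially. \<bar>\<tau> n\<bar> * (2 * B\<^sup>2) < e/2" by (rule order_tendstoD(2)) (use e in simp)
    moreover have "\<forall>\<^sub>F n in sequentially. \<forall>\<zeta>\<in>?S. dist (q n \<zeta>) (q0 \<zeta>) < e/2"
      using uniform_limitD[OF qlim, of "e/2"] e by (simp only: half_gt_zero)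
    ultimately show "\<forall>\<^sub>F n in sequentially. \<forall>\<zeta>\<in>?S. dist (h n \<zeta> / of_real (\<tau> n)) (q0 \<zeta>) < e"
      using ev
    proof eventually_elim
      case (elim n)
      show ?case
      proof
        fix \<zeta> assume \<zeta>: "\<zeta> \<in> ?S"
        let ?v = "of_real (\<tau> n) * q n \<zeta>"
        have v: "norm ?v < 1/2" using small elim \<zeta> by blast
        have "norm (Ln (1 + ?v) - ?v) \<le> (norm ?v)\<^sup>2 / (1 - norm ?v)"
          using Ln_approx_linear[of ?v] v by simp
        also have "\<dots> \<le> 2 * (norm ?v)\<^sup>2"
        proof -
          have "(norm ?v)\<^sup>2 * 1 \<le> (norm ?v)\<^sup>2 * (2 * (1 - norm ?v))"
            by (rule mult_left_mono) (use v in auto)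
          then show ?thesis using v by (simp add: divide_le_eq algebra_simps)
        qed
        finally have "norm (h n \<zeta> - ?v) \<le> 2 * (norm ?v)\<^sup>2"
          using eqS[OF \<zeta>] elim by (simp add: h_def)
        also have "(norm ?v)\<^sup>2 \<le> (\<bar>\<tau> n\<bar> * B)\<^sup>2"
          using elim \<zeta> by (intro power_mono) (auto simp: norm_mult intro!: mult_left_mono)
        finally have "norm (h n \<zeta> - ?v) \<le> 2 * (\<bar>\<tau> n\<bar> * B)\<^sup>2" by simp
        then have "norm ((h n \<zeta> - ?v) / of_real (\<tau> n)) \<le> 2 * (\<bar>\<tau> n\<bar> * B)\<^sup>2 / \<bar>\<tau> n\<bar>"
          using \<tau>nz[of n] by (simp add: norm_divide divide_right_mono)
        also have "\<dots> = \<bar>\<tau> n\<bar> * (2 * B\<^sup>2)"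
          using \<tau>nz[of n] by (simp add: power2_eq_square)
        also have "\<dots> < e/2" using elim by blast
        finally have "norm (h n \<zeta> / of_real (\<tau> n) - q n \<zeta>) < e/2"
          using \<tau>nz[of n] by (simp add: diff_divide_distrib)
        moreover have "dist (q n \<zeta>) (q0 \<zeta>) < e/2" using elim \<zeta> by blast
        ultimately show "dist (h n \<zeta> / of_real (\<tau> n)) (q0 \<zeta>) < e"
          using dist_triangle_less_add[of "h n \<zeta> / of_real (\<tau> n)" "q n \<zeta>" "e/2" "q0 \<zeta>" "e/2"]
          by (simp add: dist_norm norm_minus_commute)
      qed
    qed
  qed
  have ci: "\<forall>\<^sub>F n in sequentially. (\<lambda>\<zeta>. h n \<zeta> / of_real (\<tau> n)) contour_integrable_on ?\<gamma>"
    using ev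
    by eventually_elim (rule has_contour_integral_integrable[OF has_contour_integral_div[OF main]], auto)
  have "(\<lambda>n. contour_integral ?\<gamma> (\<lambda>\<zeta>. h n \<zeta> / of_real (\<tau> n))) \<longlonglongrightarrow> contour_integral ?\<gamma> q0"
    using contour_integral_uniform_limit_circlepath[OF ci lim_h _ \<delta>(1)] by simp
  moreover have "\<forall>\<^sub>F n in sequentially. contour_integral ?\<gamma> (\<lambda>\<zeta>. h n \<zeta> / of_real (\<tau> n))
      = 2 * of_real pi * \<i> * (of_nat \<mu> * (x n - \<zeta>0)) / of_real (\<tau> n)"
    using ev
    by eventually_elim (rule contour_integral_unique[OF has_contour_integral_div[OF main]], auto)
  ultimately have "(\<lambda>n. 2 * of_real pi * \<i> * (of_nat \<mu> * (x n - \<zeta>0)) / of_real (\<tau> n)) \<longlonglongrightarrow> contour_integral ?\<gamma> q0"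
    by (rule Lim_transform_eventually)
  then have "(\<lambda>n. 2 * of_real pi * \<i> * (of_nat \<mu> * (x n - \<zeta>0)) / of_real (\<tau> n) / (2 * of_real pi * \<i>)) \<longlonglongrightarrow>
      contour_integral ?\<gamma> q0 / (2 * of_real pi * \<i>)"
    by (intro tendsto_intros) auto
  then show ?thesis by simp
qed

subsection \<open>Regularity in time\<close>

text \<open>Written over the fixed interval [0, 1], Cauchy's formulas become parametric integrals,
  to which the continuity and Leibniz rules for such integrals apply.\<close>

lemma deriv_eq_circle_integral:
  assumes "continuous_on (cball 0 r) h" "h holomorphic_on ball 0 r" "w \<in> ball 0 r"
  shows "deriv h w = integral (cbox 0 1) (\<lambda>x. h (circlepath 0 r x) / (circlepath 0 r x - w)\<^sup>2 *
           vector_derivative (circlepath 0 r) (at x)) / (2 * of_real pi * \<i>)"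
  using Cauchy_contour_integral_circlepath_2[OF assms]
  by (simp add: contour_integral_integral field_simps)

lemma eq_circle_integral:
  assumes "continuous_on (cball 0 r) h" "h holomorphic_on ball 0 r" "w \<in> ball 0 r"
  shows "h w = integral (cbox 0 1) (\<lambda>x. h (circlepath 0 r x) / (circlepath 0 r x - w) *
           vector_derivative (circlepath 0 r) (at x)) / (2 * of_real pi * \<i>)"
  using Cauchy_contour_integral_circlepath[OF assms, of 0]
  by (simp add: contour_integral_integral field_simps)

lemma continuous_on_circle_kernel:
  fixes H :: "real \<Rightarrow> complex \<Rightarrow> complex"
  assumes H: "continuous_on (U \<times> ball 0 \<rho>) (\<lambda>(t, \<zeta>). H t \<zeta>)" and r: "0 < r" "r < \<rho>"
  shows "continuous_on ((U \<times> ball 0 r) \<times> cbox 0 1) (\<lambda>(p, x). H (fst p) (circlepath 0 r x) / (circlepath 0 r x - snd p) ^ k *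
           vector_derivative (circlepath 0 r) (at x))"
proof -
  have c: "norm (circlepath 0 r x) = r" for x
    using r by (simp add: circlepath norm_mult)
  have 1: "continuous_on ((U \<times> ball 0 r) \<times> cbox 0 1) (\<lambda>p. H (fst (fst p)) (circlepath 0 r (snd p)))"
  proof -
    have "continuous_on ((U \<times> ball 0 r) \<times> cbox 0 1) (\<lambda>p. (\<lambda>(t, \<zeta>). H t \<zeta>) (fst (fst p), circlepath 0 r (snd p)))"
      by (rule continuous_on_compose2[OF H])
        (use r c in \<open>auto intro!: continuous_intros simp: circlepath\<close>)
    then show ?thesis by simp
  qed
  have 2: "circlepath 0 r x - w \<noteq> 0" if "w \<in> ball 0 r" for w x
    using that c[of x] by auto
  show ?thesis
    unfolding split_beta vector_derivative_circlepath
    by (intro continuous_intros 1) (use 2 in \<open>auto intro!: continuous_intros simp: circlepath\<close>)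
qed

lemma continuous_on_deriv_param:
  fixes H :: "real \<Rightarrow> complex \<Rightarrow> complex"
  assumes H: "continuous_on (U \<times> ball 0 \<rho>) (\<lambda>(t, \<zeta>). H t \<zeta>)" and r: "0 < r" "r < \<rho>"
    and hol: "\<And>t. t \<in> U \<Longrightarrow> H t holomorphic_on ball 0 r"
  shows "continuous_on (U \<times> ball 0 r) (\<lambda>(t, \<zeta>). deriv (H t) \<zeta>)"
proof -
  have cont: "continuous_on (cball 0 r) (H t)" if "t \<in> U" for t
  proof -
    have "continuous_on (cball 0 r) (\<lambda>\<zeta>. (\<lambda>(t, \<zeta>). H t \<zeta>) (t, \<zeta>))"
      by (rule continuous_on_compose2[OF H]) (use that r in \<open>auto intro!: continuous_intros\<close>)
    then show ?thesis by simp
  qed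
  have "continuous_on (U \<times> ball 0 r) (\<lambda>p. integral (cbox 0 1) (\<lambda>x. H (fst p) (circlepath 0 r x) /
      (circlepath 0 r x - snd p)\<^sup>2 * vector_derivative (circlepath 0 r) (at x)) / (2 * of_real pi * \<i>))"
    by (intro continuous_intros integral_continuous_on_param continuous_on_circle_kernel[OF H r]) auto
  then show ?thesis
    by (rule continuous_on_eq) (auto simp: deriv_eq_circle_integral[OF cont hol])
qed

text \<open>\<open>smooth_in_time\<close> asks for joint continuity of the time derivative only;
  that of the function itself is recovered by integrating along the segment from \<open>t0\<close>
  to t, rescaled to [0, 1].\<close>

lemma joint_continuity_from_time_derivative:
  fixes F F' :: "real \<Rightarrow> complex \<Rightarrow> complex"
  assumes U: "convex U" "t0 \<in> U"
    and d: "\<And>t \<zeta>. t \<in> U \<Longrightarrow> \<zeta> \<in> S \<Longrightarrow> ((\<lambda>s. F s \<zeta>) has_vector_derivative F' t \<zeta>) (at t within U)"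
    and c: "continuous_on (U \<times> S) (\<lambda>(t, \<zeta>). F' t \<zeta>)"
    and F0: "continuous_on S (F t0)"
  shows "continuous_on (U \<times> S) (\<lambda>(t, \<zeta>). F t \<zeta>)"
proof -
  have seg: "t0 + x * (t - t0) \<in> U" if "t \<in> U" "0 \<le> x" "x \<le> 1" for t x
  proof -
    have "(1 - x) *\<^sub>R t0 + x *\<^sub>R t \<in> U" using U that by (intro convexD) auto
    then show ?thesis by (simp add: algebra_simps)
  qed
  have eq: "F t \<zeta> = F t0 \<zeta> + (t - t0) *\<^sub>R integral (cbox 0 1) (\<lambda>x. F' (t0 + x * (t - t0)) \<zeta>)"
    if t: "t \<in> U" and \<zeta>: "\<zeta> \<in> S" for t \<zeta>
  proof -
    have "((\<lambda>x. (t - t0) *\<^sub>R F' (t0 + x * (t - t0)) \<zeta>) has_integral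
        F (t0 + 1 * (t - t0)) \<zeta> - F (t0 + 0 * (t - t0)) \<zeta>) {0..1}"
    proof (rule fundamental_theorem_of_calculus)
      fix x :: real assume x: "x \<in> {0..1}"
      have "((\<lambda>x. t0 + x * (t - t0)) has_vector_derivative (t - t0)) (at x within {0..1})"
        by (auto intro!: derivative_eq_intros simp flip: has_real_derivative_iff_has_vector_derivative)
      moreover have "((\<lambda>s. F s \<zeta>) has_vector_derivative F' (t0 + x * (t - t0)) \<zeta>)
          (at (t0 + x * (t - t0)) within ((\<lambda>x. t0 + x * (t - t0)) ` {0..1}))"
        by (rule has_vector_derivative_within_subset[OF d]) (use seg[OF t] x \<zeta> in auto)
      ultimately show "((\<lambda>x. F (t0 + x * (t - t0)) \<zeta>) has_vector_derivative
          (t - t0) *\<^sub>R F' (t0 + x * (t - t0)) \<zeta>) (at x within {0..1})"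
        using vector_diff_chain_within by (fastforce simp: o_def)
    qed simp
    from integral_unique[OF this] show ?thesis by (simp add: cbox_interval)
  qed
  have "continuous_on ((U \<times> S) \<times> cbox 0 1) (\<lambda>p. (\<lambda>(t, \<zeta>). F' t \<zeta>) (t0 + snd p * (fst (fst p) - t0), snd (fst p)))"
    by (rule continuous_on_compose2[OF c]) (use seg in \<open>auto intro!: continuous_intros\<close>)
  then have "continuous_on ((U \<times> S) \<times> cbox 0 1) (\<lambda>(p, x). F' (t0 + x * (fst p - t0)) (snd p))"
    by (simp add: split_beta)
  then have "continuous_on (U \<times> S) (\<lambda>p. integral (cbox 0 1) (\<lambda>x. F' (t0 + x * (fst p - t0)) (snd p)))"
    by (rule integral_continuous_on_param)
  moreover have "continuous_on (U \<times> S) (\<lambda>p. F t0 (snd p))"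
    by (rule continuous_on_compose2[OF F0]) (auto intro!: continuous_intros)
  ultimately have "continuous_on (U \<times> S) (\<lambda>p. F t0 (snd p) + (fst p - t0) *\<^sub>R integral (cbox 0 1) (\<lambda>x. F' (t0 + x * (fst p - t0)) (snd p)))"
    by (intro continuous_intros)
  then show ?thesis
    by (rule continuous_on_eq) (auto simp: eq)
qed

text \<open>Holomorphy of the time derivative and the mixed derivatives are not part of
  \<open>smooth_in_time\<close>. They come from differentiating Cauchy's formula under the integral
  sign; the circle of radius \<open>r\<close> has to fit inside the larger disk.\<close>

lemma holomorphic_family_time_derivative:
  fixes F F' :: "real \<Rightarrow> complex \<Rightarrow> complex"
  assumes U: "convex U" "t0 \<in> U" and nb: "\<And>t. t \<in> U \<Longrightarrow> at t within U \<noteq> bot"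
    and hol: "\<And>t. t \<in> U \<Longrightarrow> F t holomorphic_on ball 0 \<rho>"
    and d: "\<And>t \<zeta>. t \<in> U \<Longrightarrow> \<zeta> \<in> ball 0 \<rho> \<Longrightarrow> ((\<lambda>s. F s \<zeta>) has_vector_derivative F' t \<zeta>) (at t within U)"
    and c: "continuous_on (U \<times> ball 0 \<rho>) (\<lambda>(t, \<zeta>). F' t \<zeta>)"
    and r: "0 < r" "r < \<rho>"
  shows "continuous_on (U \<times> ball 0 \<rho>) (\<lambda>(t, \<zeta>). F t \<zeta>)"
    and "\<And>t. t \<in> U \<Longrightarrow> F' t holomorphic_on ball 0 r"
    and "continuous_on (U \<times> ball 0 r) (\<lambda>(t, \<zeta>). deriv (F t) \<zeta>)"
    and "continuous_on (U \<times> ball 0 r) (\<lambda>(t, \<zeta>). deriv (F' t) \<zeta>)"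
    and "\<And>t \<zeta>. t \<in> U \<Longrightarrow> \<zeta> \<in> ball 0 r \<Longrightarrow>
      ((\<lambda>s. deriv (F s) \<zeta>) has_vector_derivative deriv (F' t) \<zeta>) (at t within U)"
proof -
  show cF: "continuous_on (U \<times> ball 0 \<rho>) (\<lambda>(t, \<zeta>). F t \<zeta>)"
    by (rule joint_continuity_from_time_derivative[OF U d c])
      (use hol U in \<open>auto intro: holomorphic_on_imp_continuous_on\<close>)
  have circ: "circlepath 0 r x \<in> ball 0 \<rho>" "norm (circlepath 0 r x) = r" for x
    using r by (auto simp: circlepath norm_mult)
  have holr: "F t holomorphic_on ball 0 r" "continuous_on (cball 0 r) (F t)" if "t \<in> U" for t
  proof -
    show "F t holomorphic_on ball 0 r"
      by (rule holomorphic_on_subset[OF hol[OF that]]) (use r in auto)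
    have "F t holomorphic_on cball 0 r"
      by (rule holomorphic_on_subset[OF hol[OF that]]) (use r in auto)
    then show "continuous_on (cball 0 r) (F t)" by (rule holomorphic_on_imp_continuous_on)
  qed
  have cF': "continuous_on (cball 0 r) (F' t)" if "t \<in> U" for t
  proof -
    have "continuous_on (cball 0 r) (\<lambda>\<zeta>. (\<lambda>(t, \<zeta>). F' t \<zeta>) (t, \<zeta>))"
      by (rule continuous_on_compose2[OF c]) (use that r in \<open>auto intro!: continuous_intros\<close>)
    then show ?thesis by simp
  qed
  have leib: "((\<lambda>s. integral (cbox 0 1) (\<lambda>x. F s (circlepath 0 r x) / (circlepath 0 r x - w) ^ k *
           vector_derivative (circlepath 0 r) (at x)) / (2 * of_real pi * \<i>)) has_vector_derivative
         integral (cbox 0 1) (\<lambda>x. F' t (circlepath 0 r x) / (circlepath 0 r x - w) ^ k *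
           vector_derivative (circlepath 0 r) (at x)) / (2 * of_real pi * \<i>)) (at t within U)"
    if t: "t \<in> U" and w: "w \<in> ball 0 r" for t w k
  proof -
    have pair: "continuous_on (U \<times> cbox 0 1) (\<lambda>(t, x). H t (circlepath 0 r x) / (circlepath 0 r x - w) ^ k *
           vector_derivative (circlepath 0 r) (at x))"
      if H: "continuous_on (U \<times> ball 0 \<rho>) (\<lambda>(t, \<zeta>). H t \<zeta>)" for H :: "real \<Rightarrow> complex \<Rightarrow> complex"
    proof -
      have "continuous_on (U \<times> cbox 0 1) (\<lambda>p. (\<lambda>(p, x). H (fst p) (circlepath 0 r x) / (circlepath 0 r x - snd p) ^ k *
           vector_derivative (circlepath 0 r) (at x)) ((fst p, w), snd p))"
        by (rule continuous_on_compose2[OF continuous_on_circle_kernel[OF H r]])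
          (use w in \<open>auto intro!: continuous_intros\<close>)
      then show ?thesis by (simp add: split_beta)
    qed
    have "((\<lambda>s. integral (cbox 0 1) (\<lambda>x. F s (circlepath 0 r x) / (circlepath 0 r x - w) ^ k *
           vector_derivative (circlepath 0 r) (at x))) has_vector_derivative
         integral (cbox 0 1) (\<lambda>x. F' t (circlepath 0 r x) / (circlepath 0 r x - w) ^ k *
           vector_derivative (circlepath 0 r) (at x))) (at t within U)"
    proof (rule leibniz_rule_vector_derivative[OF _ _ pair[OF c] t U(1)])
      fix s x assume s: "s \<in> U" and x: "x \<in> cbox 0 (1::real)"
      have "((\<lambda>x'. F x' (circlepath 0 r x)) has_vector_derivative F' s (circlepath 0 r x)) (at s within U)"
        using d[OF s] circ by blast
      then have "((\<lambda>x'. F x' (circlepath 0 r x) * (inverse ((circlepath 0 r x - w) ^ k) *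
           vector_derivative (circlepath 0 r) (at x))) has_vector_derivative F' s (circlepath 0 r x) * (inverse ((circlepath 0 r x - w) ^ k) *
           vector_derivative (circlepath 0 r) (at x))) (at s within U)"
        by (rule has_vector_derivative_mult_left)
      then show "((\<lambda>x'. F x' (circlepath 0 r x) / (circlepath 0 r x - w) ^ k *
           vector_derivative (circlepath 0 r) (at x)) has_vector_derivative F' s (circlepath 0 r x) / (circlepath 0 r x - w) ^ k *
           vector_derivative (circlepath 0 r) (at x)) (at s within U)"
        by (simp add: divide_inverse mult.assoc)
    next
      fix s assume s: "s \<in> U"
      have "continuous_on (cbox 0 1) (\<lambda>x. (\<lambda>(t, x). F t (circlepath 0 r x) / (circlepath 0 r x - w) ^ k *
           vector_derivative (circlepath 0 r) (at x)) (s, x))"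
        by (rule continuous_on_compose2[OF pair[OF cF]]) (use s in \<open>auto intro!: continuous_intros\<close>)
      then show "(\<lambda>x. F s (circlepath 0 r x) / (circlepath 0 r x - w) ^ k *
           vector_derivative (circlepath 0 r) (at x)) integrable_on cbox 0 1"
        by (intro integrable_continuous) simp
    qed
    then show ?thesis
      using has_vector_derivative_mult_left[of _ _ _ "1 / (2 * of_real pi * \<i>)"] by fastforce
  qed
  \<comment> \<open>Two expressions for one time derivative: uniqueness shows that
    \<open>F' t\<close> satisfies Cauchy's formula, although it is so far only known to be
    continuous.\<close>
  have F'eq: "F' t w = integral (cbox 0 1) (\<lambda>x. F' t (circlepath 0 r x) / (circlepath 0 r x - w) *
           vector_derivative (circlepath 0 r) (at x)) / (2 * of_real pi * \<i>)"
    if t: "t \<in> U" and w: "w \<in> ball 0 r" for t w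
  proof -
    have "((\<lambda>s. F s w) has_vector_derivative integral (cbox 0 1) (\<lambda>x. F' t (circlepath 0 r x) / (circlepath 0 r x - w) *
           vector_derivative (circlepath 0 r) (at x)) / (2 * of_real pi * \<i>)) (at t within U)"
      by (rule has_vector_derivative_transform[OF t _ leib[OF t w, of 1, unfolded power_one_right]])
        (use eq_circle_integral[OF holr(2,1) w] in auto)
    moreover have "((\<lambda>s. F s w) has_vector_derivative F' t w) (at t within U)"
      using d[OF t] w r by auto
    ultimately show ?thesis using vector_derivative_unique_within[OF nb[OF t]] by blast
  qed
  show hol': "F' t holomorphic_on ball 0 r" if t: "t \<in> U" for t
    unfolding holomorphic_on_open[OF open_ball]
  proof
    fix w assume w: "w \<in> ball (0::complex) r"
    \<comment> \<open>A Cauchy integral of continuous boundary values is differentiable inside the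
      circle, which makes \<open>F' t\<close> holomorphic.\<close>
    have "(F' t has_field_derivative (of_nat 1 * contour_integral (circlepath 0 r)
        (\<lambda>u. F' t u / (2 * of_real pi * \<i>) / (u - w) ^ Suc 1))) (at w)"
    proof (rule Cauchy_next_derivative_circlepath(2)[OF _ _ _ w])
      show "continuous_on (path_image (circlepath 0 r)) (\<lambda>u. F' t u / (2 * of_real pi * \<i>))"
        by (intro continuous_intros continuous_on_subset[OF cF'[OF t]]) (use r in auto)
      fix w assume w: "w \<in> ball (0::complex) r"
      have ci: "(\<lambda>u. F' t u / (2 * of_real pi * \<i>) / (u - w) ^ 1) contour_integrable_on circlepath 0 r"
      proof (rule contour_integrable_continuous_circlepath)
        have "u \<noteq> w" if "norm u = r" for u using that w by auto
        then show "continuous_on (path_image (circlepath 0 r)) (\<lambda>u. F' t u / (2 * of_real pi * \<i>) / (u - w) ^ 1)"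
          by (intro continuous_intros continuous_on_subset[OF cF'[OF t]]) (use r in auto)
      qed
      have "contour_integral (circlepath 0 r) (\<lambda>u. F' t u / (2 * of_real pi * \<i>) / (u - w) ^ 1) = F' t w"
        unfolding F'eq[OF t w] contour_integral_integral
        by (simp add: field_simps flip: integral_divide)
      then show "((\<lambda>u. F' t u / (2 * of_real pi * \<i>) / (u - w) ^ 1) has_contour_integral F' t w) (circlepath 0 r)"
        using ci has_contour_integral_integral by metis
    qed simp
    then show "\<exists>f'. (F' t has_field_derivative f') (at w)" by blast
  qed
  show "continuous_on (U \<times> ball 0 r) (\<lambda>(t, \<zeta>). deriv (F t) \<zeta>)"
    by (rule continuous_on_deriv_param[OF cF r holr(1)])
  show "continuous_on (U \<times> ball 0 r) (\<lambda>(t, \<zeta>). deriv (F' t) \<zeta>)"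
    by (rule continuous_on_deriv_param[OF c r hol'])
  show "((\<lambda>s. deriv (F s) \<zeta>) has_vector_derivative deriv (F' t) \<zeta>) (at t within U)"
    if t: "t \<in> U" and \<zeta>: "\<zeta> \<in> ball 0 r" for t \<zeta>
    unfolding deriv_eq_circle_integral[OF cF'[OF t] hol'[OF t] \<zeta>]
    by (rule has_vector_derivative_transform[OF t _ leib[OF t \<zeta>, of 2]])
      (use deriv_eq_circle_integral[OF holr(2,1) \<zeta>] in auto)
qed

locale pg_solution =
  fixes q :: "real \<Rightarrow> real" and f :: "real \<Rightarrow> complex \<Rightarrow> complex"
  assumes q_cont: "continuous_on {0..} q"
    and q_pos: "\<And>t. 0 \<le> t \<Longrightarrow> 0 < q t"
    and sol: "locally_univalent_solution q f"
begin

abbreviation fdot :: "real \<Rightarrow> complex \<Rightarrow> complex" where "fdot \<equiv> time_deriv f"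

lemma f_zero: "0 \<le> t \<Longrightarrow> f t 0 = 0"
  and deriv_f_nonzero: "0 \<le> t \<Longrightarrow> \<zeta> \<in> cball 0 1 \<Longrightarrow> deriv (f t) \<zeta> \<noteq> 0"
  using sol by (auto simp: locally_univalent_solution_def)

definition a :: "real \<Rightarrow> real" where "a t = Re (deriv (f t) 0)"

lemma deriv_f_0: "0 \<le> t \<Longrightarrow> deriv (f t) 0 = of_real (a t)"
  and a_pos: "0 \<le> t \<Longrightarrow> 0 < a t"
  using sol by (force simp: locally_univalent_solution_def a_def)+

lemma pg: "0 \<le> t \<Longrightarrow> norm \<zeta> = 1 \<Longrightarrow> Re (fdot t \<zeta> * cnj (\<zeta> * deriv (f t) \<zeta>)) = q t"
  using sol by (auto simp: locally_univalent_solution_def polubarinova_galin_def)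

lemma local_regularity:
  assumes "0 \<le> t0"
  obtains \<rho> \<epsilon> U where "1 < \<rho>" "0 < \<epsilon>" "U = {0..} \<inter> ball t0 \<epsilon>"
    "\<And>t. t \<in> U \<Longrightarrow> f t holomorphic_on ball 0 \<rho>" "\<And>t. t \<in> U \<Longrightarrow> fdot t holomorphic_on ball 0 \<rho>"
    "continuous_on (U \<times> ball 0 \<rho>) (\<lambda>(t, \<zeta>). f t \<zeta>)"
    "continuous_on (U \<times> ball 0 \<rho>) (\<lambda>(t, \<zeta>). fdot t \<zeta>)"
    "continuous_on (U \<times> ball 0 \<rho>) (\<lambda>(t, \<zeta>). deriv (f t) \<zeta>)"
    "continuous_on (U \<times> ball 0 \<rho>) (\<lambda>(t, \<zeta>). deriv (fdot t) \<zeta>)"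
    "\<And>t \<zeta>. t \<in> U \<Longrightarrow> \<zeta> \<in> ball 0 \<rho> \<Longrightarrow> ((\<lambda>s. f s \<zeta>) has_vector_derivative fdot t \<zeta>) (at t within U)"
    "\<And>t \<zeta>. t \<in> U \<Longrightarrow> \<zeta> \<in> ball 0 \<rho> \<Longrightarrow>
      ((\<lambda>s. deriv (f s) \<zeta>) has_vector_derivative deriv (fdot t) \<zeta>) (at t within U)"
proof -
  have "smooth_in_time f" using sol by (simp add: locally_univalent_solution_def)
  then obtain \<rho> \<epsilon> where \<rho>: "\<rho> > 1" and \<epsilon>: "\<epsilon> > 0"
    and hol: "\<And>t. t \<in> {0..} \<inter> ball t0 \<epsilon> \<Longrightarrow> f t holomorphic_on ball 0 \<rho>"
    and diff: "\<And>t \<zeta>. t \<in> {0..} \<inter> ball t0 \<epsilon> \<Longrightarrow> \<zeta> \<in> ball 0 \<rho> \<Longrightarrow> (\<lambda>s. f s \<zeta>) differentiable (at t within {0..})"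
    and cont: "continuous_on (({0..} \<inter> ball t0 \<epsilon>) \<times> ball 0 \<rho>) (\<lambda>(t, \<zeta>). fdot t \<zeta>)"
    unfolding smooth_in_time_def using assms by blast
  define U where "U = {0..} \<inter> ball t0 \<epsilon>"
  \<comment> \<open>Cauchy integrals cost some radius; the midpoint still leaves a disk larger than
    the closed unit disk.\<close>
  define r where "r = (1 + \<rho>) / 2"
  have r: "0 < r" "r < \<rho>" "1 < r" using \<rho> by (auto simp: r_def)
  have convU: "convex U" unfolding U_def by (intro convex_Int) auto
  have tU: "t0 \<in> U" using assms \<epsilon> by (simp add: U_def)
  \<comment> \<open>Needed for uniqueness of derivatives within \<open>U\<close>; at t = 0 it is the
    points to the right that count.\<close>
  have nb: "at t within U \<noteq> bot" if "t \<in> U" for t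
  proof -
    have "at t within U = at t within {0..}"
      using that by (intro at_within_nhd[of _ "ball t0 \<epsilon>"]) (auto simp: U_def)
    moreover have "at_right t \<le> at t within {0..}"
      using that by (intro at_le) (auto simp: U_def)
    ultimately show ?thesis using trivial_limit_at_right_real[of t] by (metis bot.extremum_uniqueI)
  qed
  have d: "((\<lambda>s. f s \<zeta>) has_vector_derivative fdot t \<zeta>) (at t within U)" if "t \<in> U" "\<zeta> \<in> ball 0 \<rho>" for t \<zeta>
  proof -
    have "((\<lambda>s. f s \<zeta>) has_vector_derivative fdot t \<zeta>) (at t within {0..})"
      unfolding time_deriv_def using diff[of t \<zeta>] that by (simp add: U_def vector_derivative_works)
    then show ?thesis by (rule has_vector_derivative_within_subset) (auto simp: U_def)
  qed
  have cont': "continuous_on (U \<times> ball 0 \<rho>) (\<lambda>(t, \<zeta>). fdot t \<zeta>)" using cont by (simp add: U_def)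
  note R = holomorphic_family_time_derivative[where F=f and F'=fdot, OF convU tU nb hol[folded U_def] d cont' r(1,2)]
  have sub: "U \<times> ball (0::complex) r \<subseteq> U \<times> ball 0 \<rho>" "ball (0::complex) r \<subseteq> ball 0 \<rho>"
    using r by auto
  show thesis
  proof (rule that[OF r(3) \<epsilon> U_def])
    show "continuous_on (U \<times> ball 0 r) (\<lambda>(t, \<zeta>). f t \<zeta>)"
      by (rule continuous_on_subset[OF R(1) sub(1)])
    show "continuous_on (U \<times> ball 0 r) (\<lambda>(t, \<zeta>). fdot t \<zeta>)"
      by (rule continuous_on_subset[OF cont' sub(1)])
    show "continuous_on (U \<times> ball 0 r) (\<lambda>(t, \<zeta>). deriv (f t) \<zeta>)" by (rule R(3))
    show "continuous_on (U \<times> ball 0 r) (\<lambda>(t, \<zeta>). deriv (fdot t) \<zeta>)" by (rule R(4))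
    fix t assume t: "t \<in> U"
    show "f t holomorphic_on ball 0 r"
      using holomorphic_on_subset[OF hol sub(2)] t by (simp add: U_def)
    show "fdot t holomorphic_on ball 0 r" by (rule R(2)) (simp_all add: t)
    fix \<zeta> :: complex assume \<zeta>: "\<zeta> \<in> ball 0 r"
    show "((\<lambda>s. f s \<zeta>) has_vector_derivative fdot t \<zeta>) (at t within U)"
      using d[OF t] \<zeta> sub(2) by blast
    show "((\<lambda>s. deriv (f s) \<zeta>) has_vector_derivative deriv (fdot t) \<zeta>) (at t within U)"
      by (rule R(5)) (use t \<zeta> in simp_all)
  qed
qed

end

subsection \<open>Averages over the unit circle and harmonic moments\<close>

text \<open>The mean over the unit circle is preferred to the contour integral because it commutes
  with complex conjugation, and the moments involve both \<open>f\<close> and its conjugate.\<close>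

definition circle_avg :: "(complex \<Rightarrow> complex) \<Rightarrow> complex" where
  "circle_avg \<phi> = integral (cbox 0 1) (\<lambda>x. \<phi> (circlepath 0 1 x))"

lemma norm_circlepath_0_1 [simp]: "norm (circlepath 0 1 x) = 1"
  by (simp add: circlepath norm_mult)

lemma circle_avg_integrable:
  fixes \<phi> :: "complex \<Rightarrow> complex"
  assumes "continuous_on (sphere 0 1) \<phi>"
  shows "(\<lambda>x. \<phi> (circlepath 0 1 x)) integrable_on cbox 0 1"
proof (rule integrable_continuous)
  show "continuous_on (cbox 0 1) (\<lambda>x. \<phi> (circlepath 0 1 x))"
    by (rule continuous_on_compose2[OF assms]) (auto simp: circlepath norm_mult intro!: continuous_intros)
qed

lemma contour_integral_eq_circle_avg:
  "1 / (2 * of_real pi * \<i>) * contour_integral (circlepath 0 1) \<phi> = circle_avg (\<lambda>\<zeta>. \<zeta> * \<phi> \<zeta>)"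
proof -
  have eq: "(\<lambda>x. \<phi> (circlepath 0 1 x) * vector_derivative (circlepath 0 1) (at x)) =
      (\<lambda>x. (2 * of_real pi * \<i>) * (circlepath 0 1 x * \<phi> (circlepath 0 1 x)))"
    unfolding vector_derivative_circlepath by (simp add: circlepath fun_eq_iff)
  show ?thesis
    unfolding contour_integral_integral circle_avg_def eq integral_mult_right
    by (simp add: cbox_interval)
qed

lemma circle_avg_holomorphic:
  assumes "h holomorphic_on ball 0 \<rho>" "1 < \<rho>"
  shows "circle_avg h = h 0"
proof -
  have h: "h holomorphic_on cball 0 1" using assms by (auto intro: holomorphic_on_subset)
  have "((\<lambda>u. h u / (u - 0)) has_contour_integral 2 * of_real pi * \<i> * h 0) (circlepath 0 1)"
    by (rule Cauchy_integral_circlepath)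
      (use h in \<open>auto intro: holomorphic_on_subset holomorphic_on_imp_continuous_on\<close>)
  then have "1 / (2 * of_real pi * \<i>) * contour_integral (circlepath 0 1) (\<lambda>u. h u / u) = h 0"
    by (simp add: contour_integral_unique)
  moreover have "circle_avg (\<lambda>\<zeta>. \<zeta> * (h \<zeta> / \<zeta>)) = circle_avg h"
    unfolding circle_avg_def by (intro integral_cong) (auto simp: circlepath)
  ultimately show ?thesis using contour_integral_eq_circle_avg[of "\<lambda>u. h u / u"] by metis
qed

lemma circle_avg_cong: "(\<And>\<zeta>. norm \<zeta> = 1 \<Longrightarrow> \<phi> \<zeta> = \<psi> \<zeta>) \<Longrightarrow> circle_avg \<phi> = circle_avg \<psi>"
  unfolding circle_avg_def by (intro integral_cong) auto

lemma circle_avg_diff: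
  assumes "continuous_on (sphere 0 1) \<phi>" "continuous_on (sphere 0 1) \<psi>"
  shows "circle_avg (\<lambda>\<zeta>. \<phi> \<zeta> - \<psi> \<zeta>) = circle_avg \<phi> - circle_avg \<psi>"
  unfolding circle_avg_def using circle_avg_integrable assms by (intro integral_diff) auto

lemma circle_avg_cmult: "circle_avg (\<lambda>\<zeta>. c * \<phi> \<zeta>) = c * circle_avg \<phi>"
  unfolding circle_avg_def by (rule integral_mult_right)

lemma circle_avg_cnj: "circle_avg (\<lambda>\<zeta>. cnj (\<phi> \<zeta>)) = cnj (circle_avg \<phi>)"
  unfolding circle_avg_def by (rule integral_cnj[symmetric])

lemma norm_circle_avg_le:
  assumes "continuous_on (sphere 0 1) \<phi>" "\<And>\<zeta>. norm \<zeta> = 1 \<Longrightarrow> norm (\<phi> \<zeta>) \<le> B"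
  shows "norm (circle_avg \<phi>) \<le> B"
proof -
  have "0 \<le> B" using assms(2)[of 1] norm_ge_zero[of "\<phi> 1"] by (simp only: norm_one) linarith
  then show ?thesis
    using integrable_bound[of B "\<lambda>x. \<phi> (circlepath 0 1 x)" 0 "1::real"] assms(2)
      circle_avg_integrable[OF assms(1)]
    unfolding circle_avg_def by simp
qed

context pg_solution
begin

lemma at_within_nonneg_ball: "0 \<le> t \<Longrightarrow> \<epsilon> > 0 \<Longrightarrow> at t within {0..} \<inter> ball t \<epsilon> = at t within {0..}"
  by (intro at_within_nhd[of _ "ball t \<epsilon>"]) auto

lemma f_holomorphic:
  assumes "0 \<le> t"
  obtains \<rho> where "1 < \<rho>" "f t holomorphic_on ball 0 \<rho>" "fdot t holomorphic_on ball 0 \<rho>"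
    "\<And>\<zeta>. \<zeta> \<in> ball 0 \<rho> \<Longrightarrow> ((\<lambda>s. f s \<zeta>) has_vector_derivative fdot t \<zeta>) (at t within {0..})"
    "\<And>\<zeta>. \<zeta> \<in> ball 0 \<rho> \<Longrightarrow> ((\<lambda>s. deriv (f s) \<zeta>) has_vector_derivative deriv (fdot t) \<zeta>) (at t within {0..})"
proof -
  obtain \<rho> \<epsilon> U where \<rho>: "1 < \<rho>" and \<epsilon>: "0 < \<epsilon>" and U: "U = {0..} \<inter> ball t \<epsilon>"
    and hol: "\<And>t. t \<in> U \<Longrightarrow> f t holomorphic_on ball 0 \<rho>" "\<And>t. t \<in> U \<Longrightarrow> fdot t holomorphic_on ball 0 \<rho>"
    and d: "\<And>t \<zeta>. t \<in> U \<Longrightarrow> \<zeta> \<in> ball 0 \<rho> \<Longrightarrow> ((\<lambda>s. f s \<zeta>) has_vector_derivative fdot t \<zeta>) (at t within U)"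
      "\<And>t \<zeta>. t \<in> U \<Longrightarrow> \<zeta> \<in> ball 0 \<rho> \<Longrightarrow>
       ((\<lambda>s. deriv (f s) \<zeta>) has_vector_derivative deriv (fdot t) \<zeta>) (at t within U)"
    by (rule local_regularity[OF assms]) (rule that)
  have t: "t \<in> U" using assms \<epsilon> by (simp add: U)
  have at: "at t within U = at t within {0..}"
    unfolding U by (rule at_within_nonneg_ball[OF assms \<epsilon>])
  show thesis by (rule that[OF \<rho> hol[OF t] d[OF t, unfolded at]])
qed

text \<open>On the circle 1 / cnj \<zeta> = \<zeta>, so the reflected function in the harmonic
  moment is there the plain conjugate.\<close>

definition moment :: "nat \<Rightarrow> real \<Rightarrow> complex" where
  "moment k t = circle_avg (\<lambda>\<zeta>. \<zeta> * (f t \<zeta> ^ k * cnj (f t \<zeta>) * deriv (f t) \<zeta>))"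

lemma harmonic_moment_eq: "harmonic_moment (f t) k = moment k t"
proof -
  have "1 / cnj \<zeta> = \<zeta>" if "norm \<zeta> = 1" for \<zeta> :: complex
  proof -
    have "\<zeta> * cnj \<zeta> = 1" using that by (simp add: complex_norm_square[symmetric])
    then show ?thesis by (metis div_by_0 mult.commute mult_zero_left nonzero_eq_divide_eq zero_neq_one)
  qed
  then show ?thesis
    unfolding harmonic_moment_def contour_integral_eq_circle_avg moment_def
    by (intro circle_avg_cong) simp
qed

text \<open>Up to a total derivative along the circle, the time derivative of the integrand is
  \<open>f\<^sup>k\<close> times twice the left side of the Polubarinova-Galin equation. What
  remains is the mean of 2 q f^k, which by the mean value property and f(0) = 0 vanishes unless k =
  0.\<close>

lemma moment_derivative:
  assumes "0 \<le> t0"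
  shows "((\<lambda>t. moment k t) has_vector_derivative (if k = 0 then 2 * of_real (q t0) else 0)) (at t0 within {0..})"
proof -
  obtain \<rho> \<epsilon> U where \<rho>: "1 < \<rho>" and \<epsilon>: "0 < \<epsilon>" and U: "U = {0..} \<inter> ball t0 \<epsilon>"
    and hol: "\<And>t. t \<in> U \<Longrightarrow> f t holomorphic_on ball 0 \<rho>" "\<And>t. t \<in> U \<Longrightarrow> fdot t holomorphic_on ball 0 \<rho>"
    and cont: "continuous_on (U \<times> ball 0 \<rho>) (\<lambda>(t, \<zeta>). f t \<zeta>)"
      "continuous_on (U \<times> ball 0 \<rho>) (\<lambda>(t, \<zeta>). fdot t \<zeta>)"
      "continuous_on (U \<times> ball 0 \<rho>) (\<lambda>(t, \<zeta>). deriv (f t) \<zeta>)"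
      "continuous_on (U \<times> ball 0 \<rho>) (\<lambda>(t, \<zeta>). deriv (fdot t) \<zeta>)"
    and d: "\<And>t \<zeta>. t \<in> U \<Longrightarrow> \<zeta> \<in> ball 0 \<rho> \<Longrightarrow> ((\<lambda>s. f s \<zeta>) has_vector_derivative fdot t \<zeta>) (at t within U)"
      "\<And>t \<zeta>. t \<in> U \<Longrightarrow> \<zeta> \<in> ball 0 \<rho> \<Longrightarrow>
       ((\<lambda>s. deriv (f s) \<zeta>) has_vector_derivative deriv (fdot t) \<zeta>) (at t within U)"
    by (rule local_regularity[OF assms]) (rule that)
  have t0: "t0 \<in> U" using assms \<epsilon> by (simp add: U)
  have convU: "convex U" unfolding U by (intro convex_Int) auto
  let ?c = "circlepath 0 1"
  have cin: "?c x \<in> ball 0 \<rho>" for x using \<rho> by simp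
  have cc: "continuous_on T (\<lambda>x. H (fst x) (?c (snd x)))" if "continuous_on (U \<times> ball 0 \<rho>) (\<lambda>(t, \<zeta>). H t \<zeta>)"
     and "T \<subseteq> U \<times> UNIV"
     for H :: "real \<Rightarrow> complex \<Rightarrow> complex" and T
  proof -
    have "continuous_on T (\<lambda>x. (\<lambda>(t, \<zeta>). H t \<zeta>) (fst x, ?c (snd x)))"
      by (rule continuous_on_compose2[OF that(1)]) (use \<rho> that(2) in \<open>auto intro!: continuous_intros simp: circlepath norm_mult\<close>)
    then show ?thesis by simp
  qed
  have ccirc: "continuous_on T (\<lambda>x. ?c (snd x))" for T :: "(real \<times> real) set"
    unfolding circlepath by (intro continuous_intros)
  define D where "D = (\<lambda>t \<zeta>. \<zeta> * ((of_nat k * f t \<zeta> ^ (k - 1) * fdot t \<zeta> * cnj (f t \<zeta>) + f t \<zeta> ^ k * cnj (fdot t \<zeta>)) * deriv (f t) \<zeta>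
      + f t \<zeta> ^ k * cnj (f t \<zeta>) * deriv (fdot t) \<zeta>))"
  have "((\<lambda>t. integral (cbox 0 1) (\<lambda>x. ?c x * (f t (?c x) ^ k * cnj (f t (?c x)) * deriv (f t) (?c x))))
      has_vector_derivative integral (cbox 0 1) (\<lambda>x. D t0 (?c x))) (at t0 within U)"
  proof (rule leibniz_rule_vector_derivative[OF _ _ _ t0 convU])
    fix t x assume t: "t \<in> U"
    have 1: "((\<lambda>s. f s (?c x)) has_vector_derivative fdot t (?c x)) (at t within U)"
      using d(1)[OF t cin] .
    have 2: "((\<lambda>s. deriv (f s) (?c x)) has_vector_derivative deriv (fdot t) (?c x)) (at t within U)"
      using d(2)[OF t cin] .
    have "((\<lambda>w. w ^ k) has_field_derivative of_nat k * f t (?c x) ^ (k - 1)) (at (f t (?c x)) within (\<lambda>s. f s (?c x)) ` U)"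
      by (auto intro!: derivative_eq_intros)
    from field_vector_diff_chain_within[OF 1 this]
    have 3: "((\<lambda>s. f s (?c x) ^ k) has_vector_derivative fdot t (?c x) * (of_nat k * f t (?c x) ^ (k - 1))) (at t within U)"
      by (simp add: o_def)
    have "((\<lambda>s. ?c x * (f s (?c x) ^ k * cnj (f s (?c x)) * deriv (f s) (?c x))) has_vector_derivative
        ?c x * (f t (?c x) ^ k * cnj (f t (?c x)) * deriv (fdot t) (?c x) +
          (f t (?c x) ^ k * cnj (fdot t (?c x)) + fdot t (?c x) * (of_nat k * f t (?c x) ^ (k - 1)) * cnj (f t (?c x))) * deriv (f t) (?c x)))
        (at t within U)"
      by (intro has_vector_derivative_mult_right has_vector_derivative_mult has_vector_derivative_cnj 1 2 3)
    then show "((\<lambda>s. ?c x * (f s (?c x) ^ k * cnj (f s (?c x)) * deriv (f s) (?c x))) has_vector_derivative D t (?c x)) (at t within U)"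
      by (simp add: D_def algebra_simps)
  next
    fix t assume t: "t \<in> U"
    have "continuous_on ({t} \<times> cbox 0 1) (\<lambda>p. ?c (snd p) * (f (fst p) (?c (snd p)) ^ k * cnj (f (fst p) (?c (snd p))) * deriv (f (fst p)) (?c (snd p))))"
      by (intro continuous_intros ccirc cc cont continuous_on_cnj) (use t in auto)
    then have "continuous_on (cbox 0 1) (\<lambda>x. (\<lambda>p. ?c (snd p) * (f (fst p) (?c (snd p)) ^ k * cnj (f (fst p) (?c (snd p))) * deriv (f (fst p)) (?c (snd p)))) (t, x))"
      by (rule continuous_on_compose2) (auto intro!: continuous_intros)
    then show "(\<lambda>x. ?c x * (f t (?c x) ^ k * cnj (f t (?c x)) * deriv (f t) (?c x))) integrable_on cbox 0 1"
      by (intro integrable_continuous) simp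
  next
    show "continuous_on (U \<times> cbox 0 1) (\<lambda>(t, x). D t (?c x))"
      unfolding D_def split_beta
      by (intro continuous_intros ccirc cc cont continuous_on_cnj) auto
  qed
  then have der: "((\<lambda>t. moment k t) has_vector_derivative circle_avg (D t0)) (at t0 within {0..})"
    using at_within_nonneg_ball[OF assms \<epsilon>] by (simp add: moment_def circle_avg_def U)
  let ?F = "f t0" and ?G = "fdot t0"
  note hF = hol(1)[OF t0] and hG = hol(2)[OF t0]
  have dF: "(?F has_field_derivative deriv ?F \<zeta>) (at \<zeta>)" "(?G has_field_derivative deriv ?G \<zeta>) (at \<zeta>)" if "norm \<zeta> = 1" for \<zeta>
    using hF hG that \<rho> by (auto intro!: holomorphic_derivI[of _ "ball 0 \<rho>"])
  have cont1: "continuous_on (sphere 0 1) h" if "h holomorphic_on ball 0 \<rho>" for h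
    by (rule holomorphic_on_imp_continuous_on[OF holomorphic_on_subset[OF that]]) (use \<rho> in auto)
  note cs = cont1[OF hF] cont1[OF hG] cont1[OF holomorphic_deriv[OF hF open_ball]] cont1[OF holomorphic_deriv[OF hG open_ball]]
  \<comment> \<open>\<open>E\<close> is, up to the factor 2 pi i, the derivative of
    \<open>?F\<^sup>k * ?G * cnj ?F\<close> along the closed circle, hence has mean 0. The minus
    sign comes from conjugating i.\<close>
  define E where "E = (\<lambda>\<zeta>. \<zeta> * ((of_nat k * ?F \<zeta> ^ (k - 1) * deriv ?F \<zeta> * ?G \<zeta> + ?F \<zeta> ^ k * deriv ?G \<zeta>) * cnj (?F \<zeta>))
      - ?F \<zeta> ^ k * ?G \<zeta> * cnj (\<zeta> * deriv ?F \<zeta>))"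
  have "((\<lambda>x. 2 * of_real pi * \<i> * E (?c x)) has_integral
      ?F (?c 1) ^ k * ?G (?c 1) * cnj (?F (?c 1)) - ?F (?c 0) ^ k * ?G (?c 0) * cnj (?F (?c 0))) {0..1}"
  proof (rule fundamental_theorem_of_calculus)
    fix x :: real
    have c': "(?c has_vector_derivative 2 * of_real pi * \<i> * ?c x) (at x within {0..1})"
      using has_vector_derivative_circlepath[of 0 1 x "{0..1}"] by (simp add: circlepath)
    have 1: "((\<lambda>x. ?F (?c x)) has_vector_derivative (2 * of_real pi * \<i> * ?c x) * deriv ?F (?c x)) (at x within {0..1})"
      using field_vector_diff_chain_within[OF c' has_field_derivative_at_within[OF dF(1)[OF norm_circlepath_0_1]]] by (simp add: o_def)
    have "((\<lambda>\<zeta>. ?F \<zeta> ^ k * ?G \<zeta>) has_field_derivative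
        (of_nat k * ?F (?c x) ^ (k - 1) * deriv ?F (?c x) * ?G (?c x) + ?F (?c x) ^ k * deriv ?G (?c x))) (at (?c x))"
      by (rule derivative_eq_intros dF[OF norm_circlepath_0_1] refl)+ (simp add: algebra_simps)
    from field_vector_diff_chain_within[OF c' has_field_derivative_at_within[OF this]]
    have 2: "((\<lambda>x. ?F (?c x) ^ k * ?G (?c x)) has_vector_derivative (2 * of_real pi * \<i> * ?c x) *
        (of_nat k * ?F (?c x) ^ (k - 1) * deriv ?F (?c x) * ?G (?c x) + ?F (?c x) ^ k * deriv ?G (?c x))) (at x within {0..1})"
      by (simp add: o_def)
    show "((\<lambda>x. ?F (?c x) ^ k * ?G (?c x) * cnj (?F (?c x))) has_vector_derivative 2 * of_real pi * \<i> * E (?c x)) (at x within {0..1})"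
      using has_vector_derivative_mult[OF 2 has_vector_derivative_cnj[OF 1]]
      by (simp add: E_def algebra_simps)
  qed simp
  then have "((\<lambda>x. 2 * of_real pi * \<i> * E (?c x)) has_integral 0) {0..1}"
    by (simp add: circlepath)
  then have "2 * of_real pi * \<i> * circle_avg E = 0"
    by (metis circle_avg_def box_real(2) integral_mult_right integral_unique)
  then have E0: "circle_avg E = 0" by simp
  have "circle_avg (D t0) = circle_avg (\<lambda>\<zeta>. D t0 \<zeta> - E \<zeta>)"
  proof -
    have "continuous_on (sphere 0 1) (D t0)" "continuous_on (sphere 0 1) E"
      unfolding D_def E_def by (intro continuous_intros continuous_on_cnj cs)+
    then show ?thesis by (simp add: circle_avg_diff E0)
  qed
  also have "\<dots> = circle_avg (\<lambda>\<zeta>. (2 * of_real (q t0)) * ?F \<zeta> ^ k)"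
  proof (rule circle_avg_cong)
    fix \<zeta> :: complex assume \<zeta>: "norm \<zeta> = 1"
    have "D t0 \<zeta> - E \<zeta> = ?F \<zeta> ^ k * (?G \<zeta> * cnj (\<zeta> * deriv ?F \<zeta>) + cnj (?G \<zeta> * cnj (\<zeta> * deriv ?F \<zeta>)))"
      by (simp add: D_def E_def algebra_simps)
    also have "?G \<zeta> * cnj (\<zeta> * deriv ?F \<zeta>) + cnj (?G \<zeta> * cnj (\<zeta> * deriv ?F \<zeta>)) = of_real (2 * q t0)"
      unfolding complex_add_cnj pg[OF assms \<zeta>] ..
    finally show "D t0 \<zeta> - E \<zeta> = (2 * of_real (q t0)) * ?F \<zeta> ^ k" by simp
  qed
  also have "\<dots> = 2 * of_real (q t0) * ?F 0 ^ k"
    unfolding circle_avg_cmult using circle_avg_holomorphic[of "\<lambda>\<zeta>. ?F \<zeta> ^ k", OF _ \<rho>] hF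
    by (simp add: holomorphic_on_power)
  finally have "circle_avg (D t0) = (if k = 0 then 2 * of_real (q t0) else 0)"
    using f_zero[OF assms] by simp
  then show ?thesis using der by simp
qed

lemma moment_const:
  assumes "1 \<le> k" "0 \<le> s" "0 \<le> t"
  shows "moment k s = moment k t"
proof -
  have "(moment k has_derivative (\<lambda>_. 0)) (at x within {0..})" if "x \<in> {0..}" for x
    using moment_derivative[of x k] that assms(1) by (simp add: has_vector_derivative_def)
  then obtain c where "\<And>x. x \<in> {0..} \<Longrightarrow> moment k x = c"
    using has_derivative_zero_constant[of "{0..}" "moment k"] by auto
  then show ?thesis using assms by simp
qed

text \<open>\<open>moment 0\<close> is the area of the image, counted with multiplicity, divided by
  pi: the area grows with the injected amount of fluid.\<close>

lemma area_eq:
  assumes "0 \<le> t"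
  shows "moment 0 t = moment 0 0 + 2 * of_real (integral {0..t} q)"
proof -
  have "((\<lambda>s. 2 * of_real (q s)) has_integral moment 0 t - moment 0 0) {0..t}"
  proof (rule fundamental_theorem_of_calculus[OF assms])
    fix x assume "x \<in> {0..t}"
    then show "(moment 0 has_vector_derivative 2 * of_real (q x)) (at x within {0..t})"
      using moment_derivative[of x 0] by (auto intro: has_vector_derivative_within_subset)
  qed
  then have "integral {0..t} (\<lambda>s. 2 * of_real (q s) :: complex) = moment 0 t - moment 0 0" by (rule integral_unique)
  moreover have "q integrable_on {0..t}"
    using continuous_on_subset[OF q_cont] by (intro integrable_continuous_interval) auto
  then have "((\<lambda>s. of_real (q s) :: complex) has_integral of_real (integral {0..t} q)) {0..t}"
    by (intro has_integral_of_real integrable_integral)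
  then have "integral {0..t} (\<lambda>s. 2 * of_real (q s) :: complex) = 2 * of_real (integral {0..t} q)"
    by (intro integral_unique has_integral_mult_right)
  ultimately show ?thesis by (simp add: algebra_simps)
qed

end

subsection \<open>The velocity of the poles\<close>

text \<open>Factors \<open>1 - \<eta> j * \<zeta>\<close> instead of
  \<open>\<zeta> - 1 / \<eta> j\<close> normalise the value at 0 to 1, allow the parameter 0 (a root
  at infinity), and keep the coefficients bounded when the parameters are.\<close>

definition lin_prod :: "(nat \<Rightarrow> complex) \<Rightarrow> (nat \<Rightarrow> nat) \<Rightarrow> nat set \<Rightarrow> complex poly" where
  "lin_prod \<eta> \<nu> J = (\<Prod>j\<in>J. [:1, - \<eta> j:] ^ \<nu> j)"

lemma poly_lin_prod: "poly (lin_prod \<eta> \<nu> J) \<zeta> = (\<Prod>j\<in>J. (1 - \<eta> j * \<zeta>) ^ \<nu> j)"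
  by (simp add: lin_prod_def poly_prod mult.commute)

lemma poly_lin_prod_0 [simp]: "poly (lin_prod \<eta> \<nu> J) 0 = 1"
  by (simp add: poly_lin_prod)

lemma lin_prod_nonzero [simp]: "lin_prod \<eta> \<nu> J \<noteq> 0"
  using poly_lin_prod_0[of \<eta> \<nu> J] by (metis poly_0 zero_neq_one)

lemma poly_lin_prod_nonzero:
  "finite J \<Longrightarrow> (\<And>j. j \<in> J \<Longrightarrow> 1 - \<eta> j * \<zeta> \<noteq> 0) \<Longrightarrow> poly (lin_prod \<eta> \<nu> J) \<zeta> \<noteq> 0"
  by (auto simp: poly_lin_prod)

lemma poly_lin_prod_remove:
  assumes "finite J" "i \<in> J"
  shows "poly (lin_prod \<eta> \<nu> J) \<zeta> = (1 - \<eta> i * \<zeta>) ^ \<nu> i * poly (lin_prod \<eta> \<nu> (J - {i})) \<zeta>"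
  unfolding poly_lin_prod by (rule prod.remove[OF assms])

lemma degree_lin_prod_le:
  assumes "finite J"
  shows "degree (lin_prod \<eta> \<nu> J) \<le> sum \<nu> J"
proof -
  have "degree ([:1, - \<eta> j:] ^ \<nu> j) \<le> \<nu> j" for j
  proof -
    have "degree ([:1, - \<eta> j:] ^ \<nu> j) \<le> degree [:1, - \<eta> j:] * \<nu> j" by (rule degree_power_le)
    also have "\<dots> \<le> 1 * \<nu> j" by (intro mult_right_mono) auto
    finally show ?thesis by simp
  qed
  then show ?thesis unfolding lin_prod_def
    using degree_prod_sum_le[OF assms, of "\<lambda>j. [:1, - \<eta> j:] ^ \<nu> j"] sum_mono[of J "\<lambda>j. degree ([:1, - \<eta> j:] ^ \<nu> j)" \<nu>]
    by (auto simp: o_def intro: order_trans)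
qed

lemma degree_lin_prod_eq:
  assumes "finite J" "\<And>j. j \<in> J \<Longrightarrow> \<eta> j \<noteq> 0"
  shows "degree (lin_prod \<eta> \<nu> J) = sum \<nu> J"
proof -
  have "degree (lin_prod \<eta> \<nu> J) = (\<Sum>j\<in>J. degree ([:1, - \<eta> j:] ^ \<nu> j))"
    unfolding lin_prod_def by (rule degree_prod_eq_sum_degree) simp
  also have "\<dots> = sum \<nu> J"
    using assms by (intro sum.cong) (auto simp: degree_power_eq)
  finally show ?thesis .
qed

lemma coprime_linear: 
  fixes \<theta> \<eta> :: complex
  assumes "\<theta> \<noteq> \<eta>"
  shows "coprime [:1, - \<theta>:] [:1, - \<eta>:]"
proof (rule coprimeI)
  fix c assume "c dvd [:1, - \<theta>:]" "c dvd [:1, - \<eta>:]"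
  then have "c dvd smult \<eta> [:1, - \<theta>:] - smult \<theta> [:1, - \<eta>:]"
    by (intro dvd_diff dvd_smult)
  also have "smult \<eta> [:1, - \<theta>:] - smult \<theta> [:1, - \<eta>:] = [:\<eta> - \<theta>:]" by simp
  finally have "c dvd [:\<eta> - \<theta>:]" .
  moreover have "is_unit [:\<eta> - \<theta>:]" using assms by (simp add: is_unit_const_poly_iff dvd_field_iff)
  ultimately show "is_unit c" by (rule dvd_trans)
qed

lemma coprime_lin_prod:
  assumes "\<And>i j. i \<in> I \<Longrightarrow> j \<in> J \<Longrightarrow> \<theta> i \<noteq> \<eta> j"
  shows "coprime (lin_prod \<theta> \<mu> I) (lin_prod \<eta> \<nu> J)"
  unfolding lin_prod_def
  by (intro prod_coprime_left prod_coprime_right coprime_power_left_iff[THEN iffD2] coprime_power_right_iff[THEN iffD2] disjI1 coprime_linear assms)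

lemma poly_eq_on_infinite:
  fixes p q :: "complex poly"
  assumes "infinite S" "\<And>x. x \<in> S \<Longrightarrow> poly p x = poly q x"
  shows "p = q"
proof (rule ccontr)
  assume "p \<noteq> q"
  then have "finite {x. poly (p - q) x = 0}" by (intro poly_roots_finite) simp
  moreover have "S \<subseteq> {x. poly (p - q) x = 0}" using assms by auto
  ultimately show False using assms finite_subset by blast
qed

text \<open>The unprimed fraction is in lowest terms. The primed one will be a limit, where
  cancellation or loss of degree is conceivable. Coprimality makes one denominator divide the other,
  the degree bound makes the quotient constant, and the value 1 at the origin fixes the
  constant.\<close>

lemma lin_prod_uniqueness:
  assumes fin: "finite I" "finite J"
    and ne: "\<And>i j. i \<in> I \<Longrightarrow> j \<in> J \<Longrightarrow> \<theta> i \<noteq> \<eta> j" and nz: "\<And>j. j \<in> J \<Longrightarrow> \<eta> j \<noteq> 0"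
    and eq: "lin_prod \<theta>' \<mu> I * lin_prod \<eta> \<nu> J = lin_prod \<theta> \<mu> I * lin_prod \<eta>' \<nu> J"
  shows "lin_prod \<eta>' \<nu> J = lin_prod \<eta> \<nu> J" "lin_prod \<theta>' \<mu> I = lin_prod \<theta> \<mu> I"
proof -
  have "lin_prod \<eta> \<nu> J dvd lin_prod \<theta> \<mu> I * lin_prod \<eta>' \<nu> J"
    by (metis eq dvd_triv_right)
  moreover have "coprime (lin_prod \<eta> \<nu> J) (lin_prod \<theta> \<mu> I)"
    using coprime_lin_prod[of I J \<theta> \<eta> \<mu> \<nu>] ne by (simp add: coprime_commute)
  ultimately have "lin_prod \<eta> \<nu> J dvd lin_prod \<eta>' \<nu> J"
    by (simp add: coprime_dvd_mult_right_iff)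
  then obtain D where D: "lin_prod \<eta>' \<nu> J = lin_prod \<eta> \<nu> J * D" by (elim dvdE)
  then have Dnz: "D \<noteq> 0" using lin_prod_nonzero[of \<eta>' \<nu> J] by auto
  have "degree (lin_prod \<eta>' \<nu> J) = sum \<nu> J + degree D"
    unfolding D using Dnz by (simp add: degree_mult_eq degree_lin_prod_eq[OF fin(2) nz])
  then have "degree D = 0" using degree_lin_prod_le[OF fin(2), of \<eta>' \<nu>] by simp
  then obtain d where d: "D = [:d:]" by (elim degree_eq_zeroE)
  have "poly (lin_prod \<eta>' \<nu> J) 0 = d" unfolding D d by simp
  then have "d = 1" by simp
  then show *: "lin_prod \<eta>' \<nu> J = lin_prod \<eta> \<nu> J" using D d by (simp add: one_pCons[symmetric])
  show "lin_prod \<theta>' \<mu> I = lin_prod \<theta> \<mu> I"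
    using eq[unfolded *] by simp
qed

section \<open>The function P of Loewner-Kufarev type and its reflection in the circle\<close>

context pg_solution
begin

definition a' :: "real \<Rightarrow> real" where "a' t = Re (deriv (fdot t) 0)"

lemma a_has_derivative:
  assumes "0 \<le> t"
  shows "(a has_real_derivative a' t) (at t within {0..})"
proof -
  obtain \<rho> where "1 < \<rho>" and d: "\<And>\<zeta>. \<zeta> \<in> ball 0 \<rho> \<Longrightarrow>
      ((\<lambda>s. deriv (f s) \<zeta>) has_vector_derivative deriv (fdot t) \<zeta>) (at t within {0..})"
    using f_holomorphic[OF assms] by metis
  then have "((\<lambda>s. deriv (f s) 0) has_vector_derivative deriv (fdot t) 0) (at t within {0..})" by simp
  from bounded_linear.has_vector_derivative[OF bounded_linear_Re this]
  show ?thesis by (simp add: a_def[abs_def] a'_def has_real_derivative_iff_has_vector_derivative)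
qed

lemma fdot_zero: "0 \<le> t \<Longrightarrow> fdot t 0 = 0"
proof -
  assume t: "0 \<le> t"
  obtain \<rho> where \<rho>: "1 < \<rho>" and d: "\<And>\<zeta>. \<zeta> \<in> ball 0 \<rho> \<Longrightarrow>
      ((\<lambda>s. f s \<zeta>) has_vector_derivative fdot t \<zeta>) (at t within {0..})"
    using f_holomorphic[OF t] by metis
  have "((\<lambda>s. f s 0) has_vector_derivative 0) (at t within {0..})"
    by (rule has_vector_derivative_transform[where f = "\<lambda>_. 0"]) (use t f_zero in auto)
  moreover have "((\<lambda>s. f s 0) has_vector_derivative fdot t 0) (at t within {0..})" using d \<rho> by simp
  moreover have "at t within {0..} \<noteq> bot"
  proof -
    have "at_right t \<le> at t within {0..}" using t by (intro at_le) auto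
    then show ?thesis using trivial_limit_at_right_real[of t] by (metis bot.extremum_uniqueI)
  qed
  ultimately show ?thesis using vector_derivative_unique_within by blast
qed

text \<open>Dividing the Polubarinova-Galin equation by |f'|^2 on the circle shows that the real
  part of fdot / (\<zeta> f') is positive there, hence also inside. The radius \<open>\<rho>\<close>
  exceeds 1 so that \<open>P\<close> can later be reflected across the circle.\<close>

lemma loewner_function:
  assumes "0 \<le> t"
  obtains \<rho> P where "1 < \<rho>" "f t holomorphic_on ball 0 \<rho>" "fdot t holomorphic_on ball 0 \<rho>"
    "\<And>\<zeta>. \<zeta> \<in> ball 0 \<rho> \<Longrightarrow> deriv (f t) \<zeta> \<noteq> 0" "P holomorphic_on ball 0 \<rho>"
    "\<And>\<zeta>. \<zeta> \<in> ball 0 \<rho> \<Longrightarrow> fdot t \<zeta> = \<zeta> * deriv (f t) \<zeta> * P \<zeta>"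
    "\<And>\<zeta>. norm \<zeta> = 1 \<Longrightarrow> Re (P \<zeta>) = q t / (norm (deriv (f t) \<zeta>))\<^sup>2"
    "0 < a' t"
    "\<And>w. norm w < 1 \<Longrightarrow> a' t / a t * ((1 - norm w) / (1 + norm w)) \<le> Re (P w)"
proof -
  obtain \<rho>0 where \<rho>0: "1 < \<rho>0" "f t holomorphic_on ball 0 \<rho>0" "fdot t holomorphic_on ball 0 \<rho>0"
    using f_holomorphic[OF assms] by metis
  have dh: "deriv (f t) holomorphic_on ball 0 \<rho>0" using \<rho>0 by (intro holomorphic_deriv) auto
  \<comment> \<open>\<open>f'\<close> has no zeros on the compact closed disk, therefore none on a
    slightly larger one.\<close>
  define V where "V = {\<zeta> \<in> ball 0 \<rho>0. deriv (f t) \<zeta> \<noteq> 0}"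
  have "open V"
  proof -
    have "V = ball 0 \<rho>0 \<inter> deriv (f t) -` (- {0})" by (auto simp: V_def)
    then show ?thesis
      using continuous_open_preimage[OF holomorphic_on_imp_continuous_on[OF dh] open_ball, of "- {0}"] by auto
  qed
  moreover have "cball 0 1 \<subseteq> V" using \<rho>0 deriv_f_nonzero[OF assms] by (auto simp: V_def)
  ultimately obtain e where e: "e > 0" "(\<Union>x\<in>cball 0 1. ball x e) \<subseteq> V"
    using compact_subset_open_imp_ball_epsilon_subset[OF compact_cball] by metis
  define \<rho> where "\<rho> = 1 + e"
  have \<rho>: "1 < \<rho>" using e by (simp add: \<rho>_def)
  have sub: "ball 0 \<rho> \<subseteq> V"
  proof
    fix \<zeta> :: complex assume \<zeta>: "\<zeta> \<in> ball 0 \<rho>"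
    show "\<zeta> \<in> V"
    proof (cases "norm \<zeta> \<le> 1")
      case True then show ?thesis using e by force
    next
      case False
      have "dist (sgn \<zeta>) \<zeta> = norm \<zeta> - 1"
      proof -
        have "sgn \<zeta> - \<zeta> = (1 - norm \<zeta>) *\<^sub>R sgn \<zeta>"
        proof -
          have "\<zeta> \<noteq> 0" using False by auto
          then have "norm \<zeta> *\<^sub>R sgn \<zeta> = \<zeta>" by (simp add: sgn_div_norm)
          moreover have "sgn \<zeta> - norm \<zeta> *\<^sub>R sgn \<zeta> = (1 - norm \<zeta>) *\<^sub>R sgn \<zeta>"
            by (simp add: scaleR_left_diff_distrib)
          ultimately show ?thesis by (simp only:)
        qed
        then have "norm (sgn \<zeta> - \<zeta>) = \<bar>1 - norm \<zeta>\<bar> * norm (sgn \<zeta>)" by simp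
        moreover have "norm (sgn \<zeta>) = 1" using False by (auto simp: norm_sgn)
        ultimately show ?thesis using False by (simp add: dist_norm)
      qed
      then have "\<zeta> \<in> ball (sgn \<zeta>) e" using \<zeta> by (simp add: \<rho>_def)
      moreover have "sgn \<zeta> \<in> cball 0 1" by (simp add: norm_sgn)
      ultimately show ?thesis using e(2) by blast
    qed
  qed
  have hol: "f t holomorphic_on ball 0 \<rho>" "fdot t holomorphic_on ball 0 \<rho>" "deriv (f t) holomorphic_on ball 0 \<rho>"
  proof -
    have "ball (0::complex) \<rho> \<subseteq> ball 0 \<rho>0" using sub unfolding V_def by blast
    then show "f t holomorphic_on ball 0 \<rho>" "fdot t holomorphic_on ball 0 \<rho>" "deriv (f t) holomorphic_on ball 0 \<rho>"
      using \<rho>0 dh holomorphic_on_subset by blast+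
  qed
  have nz: "deriv (f t) \<zeta> \<noteq> 0" if "\<zeta> \<in> ball 0 \<rho>" for \<zeta> using sub that by (auto simp: V_def)
  \<comment> \<open>\<open>fdot\<close> vanishes at 0, so the quotient by \<zeta> has a removable
    singularity there; the value filled in yields Re (P 0) = a' / a.\<close>
  define k where "k = (\<lambda>\<zeta>. if \<zeta> = 0 then deriv (fdot t) 0 else (fdot t \<zeta> - fdot t 0) / (\<zeta> - 0))"
  define P where "P = (\<lambda>\<zeta>. k \<zeta> / deriv (f t) \<zeta>)"
  have kh: "k holomorphic_on ball 0 \<rho>"
    unfolding k_def by (rule pole_lemma_open[OF hol(2) open_ball])
  have Ph: "P holomorphic_on ball 0 \<rho>" unfolding P_def by (intro holomorphic_intros kh hol nz)
  have eq: "fdot t \<zeta> = \<zeta> * deriv (f t) \<zeta> * P \<zeta>" if "\<zeta> \<in> ball 0 \<rho>" for \<zeta>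
    using nz[OF that] fdot_zero[OF assms] by (auto simp: P_def k_def)
  have ReP: "Re (P \<zeta>) = q t / (norm (deriv (f t) \<zeta>))\<^sup>2" if "norm \<zeta> = 1" for \<zeta>
  proof -
    have in': "\<zeta> \<in> ball 0 \<rho>" using that \<rho> by simp
    let ?w = "\<zeta> * deriv (f t) \<zeta>"
    have "fdot t \<zeta> * cnj ?w = P \<zeta> * (?w * cnj ?w)"
      by (subst eq[OF in']) (simp add: algebra_simps)
    also have "?w * cnj ?w = of_real ((norm ?w)\<^sup>2)" by (simp only: complex_norm_square)
    finally have "q t = Re (P \<zeta> * of_real ((norm ?w)\<^sup>2))" using pg[OF assms that] by simp
    also have "\<dots> = Re (P \<zeta>) * (norm (deriv (f t) \<zeta>))\<^sup>2" using that by (simp add: norm_mult)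
    finally show ?thesis using nz[OF in'] by simp
  qed
  have "continuous_on (cball 0 1) P"
    using Ph \<rho> by (intro holomorphic_on_imp_continuous_on) (auto intro: holomorphic_on_subset)
  then have cP: "continuous_on (sphere 0 1) P" by (rule continuous_on_subset) auto
  have "(1::complex) \<in> sphere 0 1" by simp
  then have ne: "sphere (0::complex) 1 \<noteq> {}" by blast
  obtain \<zeta>m where \<zeta>m: "norm \<zeta>m = 1" "\<And>\<zeta>. norm \<zeta> = 1 \<Longrightarrow> Re (P \<zeta>m) \<le> Re (P \<zeta>)"
    using continuous_attains_inf[OF compact_sphere ne continuous_on_Re[OF cP]] by auto
  have mpos: "Re (P \<zeta>m) > 0"
    using ReP[OF \<zeta>m(1)] q_pos[OF assms] nz[of \<zeta>m] \<zeta>m(1) \<rho> by simp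
  \<comment> \<open>The minimum principle for Re P, obtained as the maximum principle for exp (-
    P).\<close>
  have Repos: "0 < Re (P z)" if "norm z < 1" for z
  proof -
    have "norm (exp (- P z)) \<le> exp (- Re (P \<zeta>m))"
    proof (rule maximum_modulus_frontier[of "\<lambda>z. exp (- P z)" "cball 0 1"])
      show "(\<lambda>z. exp (- P z)) holomorphic_on interior (cball 0 1)"
        using Ph \<rho> by (intro holomorphic_intros) (auto intro: holomorphic_on_subset)
      show "continuous_on (closure (cball 0 1)) (\<lambda>z. exp (- P z))"
        using \<open>continuous_on (cball 0 1) P\<close> by (auto intro!: continuous_intros)
    qed (use that \<zeta>m in auto)
    then have "Re (P \<zeta>m) \<le> Re (P z)" by simp
    then show ?thesis using mpos by simp
  qed
  have P0: "Re (P 0) = a' t / a t"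
    using deriv_f_0[OF assms] by (simp add: P_def k_def a'_def)
  have "0 < a' t" using Repos[of 0] P0 a_pos[OF assms] by (simp add: zero_less_divide_iff)
  moreover have "a' t / a t * ((1 - norm w) / (1 + norm w)) \<le> Re (P w)" if "norm w < 1" for w
  proof -
    have "P holomorphic_on ball 0 1" by (rule holomorphic_on_subset[OF Ph]) (use \<rho> in auto)
    from harnack_lower_bound[OF this Repos that] show ?thesis by (simp add: P0)
  qed
  ultimately show thesis using that[OF \<rho> hol(1,2) nz Ph eq ReP] by blast
qed

text \<open>On the unit circle \<open>cnj (P \<zeta>)\<close> equals \<open>Pst \<zeta> = cnj (P (1 / cnj \<zeta>))\<close>, so there the
  Polubarinova-Galin equation reads \<open>fdot = - \<zeta> f' Pst + 2 q \<zeta> / f'st\<close>, an identity between functions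
  that continue to the exterior of the disk. It is a transport equation with velocity \<open>\<zeta> Pst\<close>,
  and the poles of \<open>f'\<close> move with that velocity.\<close>

lemma pole_velocity:
  assumes t: "0 \<le> t"
    and form: "\<And>\<zeta>. \<zeta> \<in> ball 0 1 \<Longrightarrow> deriv (f t) \<zeta> * poly B \<zeta> = poly A \<zeta>"
    and B: "\<And>\<zeta>. \<zeta> \<in> ball 0 1 \<Longrightarrow> poly B \<zeta> \<noteq> 0"
    and N: "\<And>\<zeta>. \<zeta> \<in> ball 0 1 \<Longrightarrow> poly N \<zeta> = deriv (fdot t) \<zeta> * (poly B \<zeta>)\<^sup>2"
    and BC: "\<And>\<zeta>. poly B \<zeta> = (1 - \<eta> * \<zeta>) ^ \<nu> * poly C \<zeta>"
    and \<eta>: "\<eta> \<noteq> 0" "norm \<eta> < 1" and \<nu>: "1 \<le> \<nu>"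
    and \<delta>: "0 < \<delta>" "\<And>\<zeta>. \<zeta> \<in> cball (1 / \<eta>) \<delta> \<Longrightarrow> 1 < norm \<zeta> \<and> poly A \<zeta> \<noteq> 0 \<and> poly C \<zeta> \<noteq> 0"
  shows "\<exists>p. a' t / a t * ((1 - norm \<eta>) / (1 + norm \<eta>)) \<le> Re p \<and>
    contour_integral (circlepath (1 / \<eta>) \<delta>) (\<lambda>\<zeta>. poly N \<zeta> / (poly B \<zeta> * poly A \<zeta>)) =
      2 * of_real pi * \<i> * (of_nat \<nu> * p / \<eta>)"
proof -
  obtain \<rho> P where \<rho>: "1 < \<rho>" and hol: "f t holomorphic_on ball 0 \<rho>" "fdot t holomorphic_on ball 0 \<rho>"
    and nz: "\<And>\<zeta>. \<zeta> \<in> ball 0 \<rho> \<Longrightarrow> deriv (f t) \<zeta> \<noteq> 0" and P: "P holomorphic_on ball 0 \<rho>"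
    and eq: "\<And>\<zeta>. \<zeta> \<in> ball 0 \<rho> \<Longrightarrow> fdot t \<zeta> = \<zeta> * deriv (f t) \<zeta> * P \<zeta>"
    and ReP: "\<And>\<zeta>. norm \<zeta> = 1 \<Longrightarrow> Re (P \<zeta>) = q t / (norm (deriv (f t) \<zeta>))\<^sup>2"
    and Har: "\<And>w. norm w < 1 \<Longrightarrow> a' t / a t * ((1 - norm w) / (1 + norm w)) \<le> Re (P w)"
    using loewner_function[OF t] by metis
  let ?g = "deriv (f t)"
  have holg: "?g holomorphic_on ball 0 \<rho>" using hol by (intro holomorphic_deriv) auto
  define W where "W = {\<zeta>::complex. 1 / \<rho> < norm \<zeta>}"
  have openW: "open W" unfolding W_def by (intro open_Collect_less continuous_intros)
  have connW: "connected W"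
  proof -
    have "W = - cball 0 (1 / \<rho>)" by (auto simp: W_def)
    then show ?thesis using connected_complement_bounded_convex[of "cball (0::complex) (1/\<rho>)"] by simp
  qed
  have W0: "\<zeta> \<noteq> 0" if "\<zeta> \<in> W" for \<zeta> using that \<rho> by (auto simp: W_def)
  \<comment> \<open>Schwarz reflection in the unit circle: it turns functions holomorphic for
    |\<zeta>| < \<rho> into functions holomorphic for |\<zeta>| > 1 / \<rho>, in particular at the
    poles of \<open>f'\<close>.\<close>
  define star where "star = (\<lambda>h \<zeta>. cnj (h (cnj (1 / \<zeta>))))" for h :: "complex \<Rightarrow> complex"
  have inv: "cnj (1 / \<zeta>) \<in> ball 0 \<rho>" if "\<zeta> \<in> W" for \<zeta>
  proof -
    have "0 < norm \<zeta>" using W0[OF that] by simp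
    then show ?thesis using that \<rho> by (simp add: W_def norm_divide field_simps)
  qed
  have star_hol: "star h holomorphic_on W" if h: "h holomorphic_on ball 0 \<rho>" for h
  proof -
    have "cnj \<circ> h \<circ> cnj holomorphic_on ball 0 \<rho>"
    proof (rule holomorphic_on_compose_cnj_cnj)
      have "cnj ` ball 0 \<rho> \<subseteq> ball 0 \<rho>" by auto
      then show "h holomorphic_on cnj ` ball 0 \<rho>" using h holomorphic_on_subset by blast
    qed simp
    moreover have "(\<lambda>\<zeta>. 1 / \<zeta>) holomorphic_on W" using W0 by (intro holomorphic_intros) auto
    moreover have "(\<lambda>\<zeta>. 1 / \<zeta>) ` W \<subseteq> ball 0 \<rho>"
      using inv by (metis complex_mod_cnj image_subsetI mem_ball_0)
    ultimately have "(cnj \<circ> h \<circ> cnj) \<circ> (\<lambda>\<zeta>. 1 / \<zeta>) holomorphic_on W"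
      using holomorphic_on_compose_gen by blast
    then show ?thesis by (simp add: star_def o_def)
  qed
  define K where "K = (\<lambda>\<zeta>. \<zeta> * star P \<zeta>)"
  define s where "s = (\<lambda>\<zeta>. 2 * of_real (q t) * \<zeta> / star ?g \<zeta>)"
  have Kh: "K holomorphic_on W" unfolding K_def by (intro holomorphic_intros star_hol P)
  have sh: "s holomorphic_on W" unfolding s_def
    by (intro holomorphic_intros star_hol holg) (use nz inv in \<open>auto simp: star_def\<close>)
  define An where "An = {\<zeta>::complex. 1 / \<rho> < norm (\<zeta> - 0) \<and> norm (\<zeta> - 0) < \<rho>}"
  have connA: "connected An" unfolding An_def by (rule connected_annulus) simp
  have openA: "open An" unfolding An_def by (intro open_Collect_conj open_Collect_less continuous_intros)
  have AnW: "An \<subseteq> W" "An \<subseteq> ball 0 \<rho>" by (auto simp: An_def W_def)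
  have r1: "1 / \<rho> < 1" using \<rho> by simp
  \<comment> \<open>The equation is given on the circle only; both sides are holomorphic on the
    annulus \<open>An\<close>, so the identity theorem extends it.\<close>
  have tr: "fdot t \<zeta> = s \<zeta> - K \<zeta> * ?g \<zeta>" if "\<zeta> \<in> An" for \<zeta>
  proof -
    have "fdot t \<zeta> - (s \<zeta> - K \<zeta> * ?g \<zeta>) = 0"
    proof (rule analytic_continuation[of "\<lambda>\<zeta>. fdot t \<zeta> - (s \<zeta> - K \<zeta> * ?g \<zeta>)" An "sphere 0 1" 1])
      show "(\<lambda>\<zeta>. fdot t \<zeta> - (s \<zeta> - K \<zeta> * ?g \<zeta>)) holomorphic_on An"
        by (intro holomorphic_intros holomorphic_on_subset[OF hol(2)] holomorphic_on_subset[OF sh]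
            holomorphic_on_subset[OF Kh] holomorphic_on_subset[OF holg] AnW)
      show "sphere 0 1 \<subseteq> An" "1 \<in> An" using \<rho> r1 by (auto simp: An_def)
      show "1 islimpt sphere (0::complex) 1"
      proof -
        have "connected (sphere (0::complex) 1)" by (rule connected_sphere) simp
        moreover have "\<not> (\<exists>x. sphere (0::complex) 1 = {x})"
        proof
          assume "\<exists>x. sphere (0::complex) 1 = {x}"
          moreover have "1 \<in> sphere (0::complex) 1" "-1 \<in> sphere (0::complex) 1" by auto
          ultimately have "(1::complex) = -1" by (metis singletonD)
          then show False by simp
        qed
        ultimately show ?thesis by (intro connected_imp_perfect) auto
      qed
      fix z assume z: "z \<in> sphere (0::complex) 1"
      then have nz1: "norm z = 1" by simp
      then have z0: "z \<noteq> 0" by auto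
      have "z * cnj z = 1" using nz1 by (simp add: complex_norm_square[symmetric])
      then have cz: "1 / cnj z = z" using z0 by (simp add: field_simps)
      have zb: "z \<in> ball 0 \<rho>" using nz1 \<rho> by simp
      have g0: "?g z \<noteq> 0" using nz[OF zb] .
      have "P z + cnj (P z) = 2 * of_real (q t) / (?g z * cnj (?g z))"
        using ReP[OF nz1] by (simp add: complex_add_cnj complex_norm_square[symmetric])
      then have "z * ?g z * (P z + cnj (P z)) = z * ?g z * (2 * of_real (q t) / (?g z * cnj (?g z)))" by simp
      also have "\<dots> = 2 * of_real (q t) * z / cnj (?g z)" using g0 by simp
      finally have "z * ?g z * P z = 2 * of_real (q t) * z / cnj (?g z) - z * cnj (P z) * ?g z"
        by (simp add: algebra_simps)
      then show "fdot t z - (s z - K z * ?g z) = 0"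
        using eq[OF zb] by (simp add: s_def K_def star_def cz)
    qed (use connA openA that in auto)
    then show ?thesis by simp
  qed
  have pd: "(poly p has_field_derivative poly (pderiv p) \<zeta>) (at \<zeta>)" for p :: "complex poly" and \<zeta>
    by (rule poly_DERIV)
  have Kd: "(K has_field_derivative deriv K \<zeta>) (at \<zeta>)" "(s has_field_derivative deriv s \<zeta>) (at \<zeta>)" if "\<zeta> \<in> W" for \<zeta>
    using Kh sh openW that by (auto intro: holomorphic_derivI)
  \<comment> \<open>This is the derivative of \<open>s - K * (A / B)\<close> multiplied by
    \<open>B\<^sup>2\<close>. No denominator \<open>B\<close> is left, so \<open>R\<close> is
    holomorphic across the poles and its equality with the polynomial \<open>N\<close> continues to
    all of \<open>W\<close>.\<close>
  define R where "R = (\<lambda>\<zeta>. deriv s \<zeta> * (poly B \<zeta>)\<^sup>2 - deriv K \<zeta> * (poly A \<zeta> * poly B \<zeta>)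
      - K \<zeta> * (poly (pderiv A) \<zeta> * poly B \<zeta> - poly A \<zeta> * poly (pderiv B) \<zeta>))"
  have NR: "poly N \<zeta> = R \<zeta>" if "\<zeta> \<in> W" for \<zeta>
  proof -
    let ?U = "{\<zeta>::complex. 1 / \<rho> < norm \<zeta> \<and> norm \<zeta> < 1}"
    have openU: "open ?U" by (intro open_Collect_conj open_Collect_less continuous_intros)
    define z0 :: complex where "z0 = of_real ((1 / \<rho> + 1) / 2)"
    have nz0: "norm z0 = (1 / \<rho> + 1) / 2" using \<rho> unfolding z0_def norm_of_real by (simp add: add_pos_pos)
    have z0: "z0 \<in> ?U" unfolding mem_Collect_eq nz0 using r1 by (simp add: field_simps)
    have "poly N \<zeta> - R \<zeta> = 0"
    proof (rule analytic_continuation[of "\<lambda>\<zeta>. poly N \<zeta> - R \<zeta>" W ?U z0])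
      show "(\<lambda>\<zeta>. poly N \<zeta> - R \<zeta>) holomorphic_on W"
        unfolding R_def by (intro holomorphic_intros holomorphic_deriv Kh sh openW)
      show "?U \<subseteq> W" by (auto simp: W_def)
      show "z0 \<in> W" using z0 by (auto simp: W_def)
      show "z0 islimpt ?U" using openU z0 by (simp add: interior_limit_point interior_open)
      fix z assume z: "z \<in> ?U"
      have zW: "z \<in> W" and zA: "z \<in> An" and z1: "z \<in> ball 0 1" using z \<rho> by (auto simp: W_def An_def)
      have Bz: "poly B z \<noteq> 0" using B[OF z1] .
      have "((\<lambda>\<zeta>. s \<zeta> - K \<zeta> * (poly A \<zeta> / poly B \<zeta>)) has_field_derivative
          deriv s z - (deriv K z * (poly A z / poly B z) + (poly (pderiv A) z * poly B z - poly A z * poly (pderiv B) z) / (poly B z * poly B z) * K z)) (at z)"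
        by (rule DERIV_diff[OF Kd(2)[OF zW] DERIV_mult[OF Kd(1)[OF zW] DERIV_divide[OF pd pd Bz]]])
      then have "(fdot t has_field_derivative
          deriv s z - (deriv K z * (poly A z / poly B z) + (poly (pderiv A) z * poly B z - poly A z * poly (pderiv B) z) / (poly B z * poly B z) * K z)) (at z)"
      proof (rule has_field_derivative_transform_within_open[OF _ openU z])
        fix w assume w: "w \<in> ?U"
        then have "w \<in> An" and w1: "w \<in> ball 0 1" using \<rho> by (auto simp: An_def)
        moreover have "?g w = poly A w / poly B w" using form[OF w1] B[OF w1] by (simp add: field_simps)
        ultimately show "s w - K w * (poly A w / poly B w) = fdot t w" using tr by simp
      qed
      then have "deriv (fdot t) z =
          deriv s z - (deriv K z * (poly A z / poly B z) + (poly (pderiv A) z * poly B z - poly A z * poly (pderiv B) z) / (poly B z * poly B z) * K z)"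
        by (rule DERIV_imp_deriv)
      then have "poly N z = R z"
        unfolding N[OF z1] R_def using Bz by (simp add: field_simps power2_eq_square)
      then show "poly N z - R z = 0" by simp
    qed (use openW connW that in auto)
    then show ?thesis by simp
  qed
  let ?z = "1 / \<eta>"
  define X where "X = (\<lambda>\<zeta>. deriv s \<zeta> * poly B \<zeta> / poly A \<zeta> - deriv K \<zeta> - K \<zeta> * poly (pderiv A) \<zeta> / poly A \<zeta>
      + K \<zeta> * poly (pderiv C) \<zeta> / poly C \<zeta>)"
  have cW: "cball ?z \<delta> \<subseteq> W" using \<delta>(2) r1 by (force simp: W_def)
  have Xh: "X holomorphic_on cball ?z \<delta>"
    unfolding X_def using \<delta>(2)
    by (intro holomorphic_intros holomorphic_on_subset[OF Kh cW]
        holomorphic_on_subset[OF holomorphic_deriv[OF Kh openW] cW]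
        holomorphic_on_subset[OF holomorphic_deriv[OF sh openW] cW]) auto
  \<comment> \<open>Near \<open>?z\<close> the only singular term of the integrand is
    \<open>K\<close> times the logarithmic derivative of \<open>B\<close>; it has a simple pole with
    residue \<nu> K(?z), which is the value of \<open>H\<close> there.\<close>
  define H where "H = (\<lambda>\<zeta>. X \<zeta> * (\<zeta> - ?z) + of_nat \<nu> * K \<zeta>)"
  have Hh: "H holomorphic_on cball ?z \<delta>"
    unfolding H_def by (intro holomorphic_intros Xh holomorphic_on_subset[OF Kh cW])
  have dB: "poly (pderiv B) \<zeta> = - (of_nat \<nu> * \<eta> * (1 - \<eta> * \<zeta>) ^ (\<nu> - 1) * poly C \<zeta>) + (1 - \<eta> * \<zeta>) ^ \<nu> * poly (pderiv C) \<zeta>" for \<zeta>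
  proof -
    have "(poly B has_field_derivative - (of_nat \<nu> * \<eta> * (1 - \<eta> * \<zeta>) ^ (\<nu> - 1) * poly C \<zeta>) + (1 - \<eta> * \<zeta>) ^ \<nu> * poly (pderiv C) \<zeta>) (at \<zeta>)"
    proof -
      have "((\<lambda>\<zeta>. 1 - \<eta> * \<zeta>) has_field_derivative - \<eta>) (at \<zeta>)"
        by (auto intro!: derivative_eq_intros)
      from DERIV_mult[OF DERIV_power[OF this, of \<nu>] pd[of C]]
      show ?thesis unfolding BC[abs_def] by (simp add: algebra_simps)
    qed
    then show ?thesis using pd DERIV_unique by blast
  qed
  have quot: "poly N \<zeta> / (poly B \<zeta> * poly A \<zeta>) = H \<zeta> / (\<zeta> - ?z)" if \<zeta>: "\<zeta> \<in> cball ?z \<delta>" "\<zeta> \<noteq> ?z" for \<zeta>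
  proof -
    have AC: "poly A \<zeta> \<noteq> 0" "poly C \<zeta> \<noteq> 0" using \<delta>(2) \<zeta> by auto
    define y where "y = 1 - \<eta> * \<zeta>"
    have y: "y \<noteq> 0" using \<zeta>(2) \<eta>(1) by (auto simp: y_def field_simps)
    have zy: "\<zeta> - ?z = - (y / \<eta>)" using \<eta>(1) by (simp add: y_def field_simps)
    have Bz: "poly B \<zeta> \<noteq> 0" unfolding BC using AC y by (simp add: y_def)
    have BB: "poly (pderiv B) \<zeta> / poly B \<zeta> = of_nat \<nu> / (\<zeta> - ?z) + poly (pderiv C) \<zeta> / poly C \<zeta>"
    proof -
      have yp: "y ^ \<nu> = y * y ^ (\<nu> - 1)" using \<nu> by (cases \<nu>) auto
      show ?thesis unfolding dB BC zy y_def[symmetric] yp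
        using y AC \<eta>(1) by (simp add: field_simps)
    qed
    have "poly N \<zeta> / (poly B \<zeta> * poly A \<zeta>) = deriv s \<zeta> * poly B \<zeta> / poly A \<zeta> - deriv K \<zeta> - K \<zeta> * poly (pderiv A) \<zeta> / poly A \<zeta>
        + K \<zeta> * (poly (pderiv B) \<zeta> / poly B \<zeta>)"
      using NR[of \<zeta>] cW \<zeta> AC Bz by (simp add: R_def field_simps power2_eq_square subset_iff)
    also have "\<dots> = X \<zeta> + of_nat \<nu> * K \<zeta> / (\<zeta> - ?z)"
      unfolding BB X_def by (simp add: algebra_simps)
    also have "\<dots> = H \<zeta> / (\<zeta> - ?z)" using \<zeta>(2) by (simp add: H_def add_divide_distrib)
    finally show ?thesis .
  qed
  have "((\<lambda>\<zeta>. H \<zeta> / (\<zeta> - ?z)) has_contour_integral 2 * of_real pi * \<i> * H ?z) (circlepath ?z \<delta>)"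
    by (rule Cauchy_integral_circlepath)
      (use Hh \<delta> in \<open>auto intro: holomorphic_on_imp_continuous_on holomorphic_on_subset\<close>)
  then have "((\<lambda>\<zeta>. poly N \<zeta> / (poly B \<zeta> * poly A \<zeta>)) has_contour_integral 2 * of_real pi * \<i> * H ?z) (circlepath ?z \<delta>)"
    by (rule has_contour_integral_eq) (use quot \<delta> in auto)
  then have "contour_integral (circlepath ?z \<delta>) (\<lambda>\<zeta>. poly N \<zeta> / (poly B \<zeta> * poly A \<zeta>)) = 2 * of_real pi * \<i> * H ?z"
    by (rule contour_integral_unique)
  \<comment> \<open>The velocity is read off at the reflected point \<open>cnj \<eta>\<close>, which
    lies in the disk, where Harnack's bound for \<open>P\<close> is available.\<close>
  also have "H ?z = of_nat \<nu> * cnj (P (cnj \<eta>)) / \<eta>"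
    using \<eta>(1) by (simp add: H_def K_def star_def)
  finally have "contour_integral (circlepath ?z \<delta>) (\<lambda>\<zeta>. poly N \<zeta> / (poly B \<zeta> * poly A \<zeta>)) =
      2 * of_real pi * \<i> * (of_nat \<nu> * cnj (P (cnj \<eta>)) / \<eta>)" .
  moreover have "a' t / a t * ((1 - norm \<eta>) / (1 + norm \<eta>)) \<le> Re (cnj (P (cnj \<eta>)))"
    using Har[of "cnj \<eta>"] \<eta>(2) by simp
  ultimately show ?thesis by blast
qed

end

section \<open>Limits of configurations of zeros and poles\<close>

lemma vector_difference_quotient_tendsto:
  fixes g :: "real \<Rightarrow> 'a::real_normed_vector"
  assumes "(g has_vector_derivative g') (at T within S)"
  shows "((\<lambda>s. (g s - g T) /\<^sub>R (s - T)) \<longlongrightarrow> g') (at T within S)"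
proof -
  have "((\<lambda>s. norm ((g s - g T) - (s - T) *\<^sub>R g') / norm (s - T)) \<longlongrightarrow> 0) (at T within S)"
    using assms by (simp add: has_vector_derivative_def has_derivative_iff_norm)
  moreover have "\<forall>\<^sub>F s in at T within S. norm ((g s - g T) - (s - T) *\<^sub>R g') / norm (s - T) =
      norm ((g s - g T) /\<^sub>R (s - T) - g')"
    unfolding eventually_at_filter
  proof (intro always_eventually allI impI)
    fix s assume "s \<noteq> T" "s \<in> S"
    then have "(g s - g T) /\<^sub>R (s - T) - g' = ((g s - g T) - (s - T) *\<^sub>R g') /\<^sub>R (s - T)"
      by (simp add: scaleR_right_diff_distrib)
    then show "norm ((g s - g T) - (s - T) *\<^sub>R g') / norm (s - T) = norm ((g s - g T) /\<^sub>R (s - T) - g')"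
      by (simp add: divide_inverse)
  qed
  ultimately have "((\<lambda>s. norm ((g s - g T) /\<^sub>R (s - T) - g')) \<longlongrightarrow> 0) (at T within S)"
    by (rule Lim_transform_eventually)
  then show ?thesis using Lim_null tendsto_norm_zero_iff by blast
qed

lemma poly_uniform_limit_of_pointwise:
  fixes p :: "nat \<Rightarrow> complex poly"
  assumes "\<And>n. degree (p n) \<le> D" "\<And>x. (\<lambda>n. poly (p n) x) \<longlonglongrightarrow> poly P x" "bounded K"
  shows "uniform_limit K (\<lambda>n. poly (p n)) (poly P) sequentially"
proof -
  obtain Q where Q: "\<And>K. bounded K \<Longrightarrow> uniform_limit K (\<lambda>n. poly (p n)) (poly Q) sequentially"
    using poly_uniform_limit_bounded[of p D UNIV] assms(1,2) infinite_UNIV_char_0[where 'a = complex]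
    by (auto simp: convergent_def)
  have "poly Q x = poly P x" for x
    using tendsto_uniform_limitI[OF Q, of "{x}" x] assms(2)[of x] LIMSEQ_unique by auto
  then show ?thesis using Q[OF assms(3)] by (metis ext)
qed

lemma uniform_limit_eventually_nonzero:
  fixes P :: "complex \<Rightarrow> complex"
  assumes "uniform_limit K p P sequentially" "compact K" "continuous_on K P" "\<And>x. x \<in> K \<Longrightarrow> P x \<noteq> 0"
  shows "\<forall>\<^sub>F n in sequentially. \<forall>x\<in>K. p n x \<noteq> 0"
proof (cases "K = {}")
  case False
  obtain x0 where x0: "x0 \<in> K" "\<And>x. x \<in> K \<Longrightarrow> norm (P x0) \<le> norm (P x)"
    using continuous_attains_inf[OF assms(2) False continuous_on_norm[OF assms(3)]] by auto
  have "norm (P x0) > 0" using assms(4) x0 by simp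
  then have "\<forall>\<^sub>F n in sequentially. \<forall>x\<in>K. dist (p n x) (P x) < norm (P x0)"
    using uniform_limitD[OF assms(1)] by blast
  then show ?thesis
  proof eventually_elim
    case (elim n)
    show ?case
    proof
      fix x assume "x \<in> K"
      then have "dist (p n x) (P x) < norm (P x)" using elim x0(2) by fastforce
      then show "p n x \<noteq> 0" by auto
    qed
  qed
qed simp

text \<open>\<open>\<theta>\<close> and \<open>\<eta>\<close> are the reciprocals of zeros and
  poles. Only conditions at single times are imposed on them; the sole link between different times
  is the smoothness of \<open>f\<close>. There are always \<open>m\<close> zeros, some possibly at
  infinity, which is why \<open>\<theta>\<close> may be 0 and \<open>\<eta>\<close> may not.\<close>

locale rational_solution = pg_solution +
  fixes m l :: nat and \<nu> :: "nat \<Rightarrow> nat" and \<theta> \<eta> :: "nat \<Rightarrow> real \<Rightarrow> complex"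
  assumes nu: "\<And>j. j \<in> {1..l} \<Longrightarrow> 1 \<le> \<nu> j"
    and eta_inj: "\<And>t. 0 \<le> t \<Longrightarrow> inj_on (\<lambda>j. \<eta> j t) {1..l}"
    and eta_nonzero: "\<And>t j. 0 \<le> t \<Longrightarrow> j \<in> {1..l} \<Longrightarrow> \<eta> j t \<noteq> 0"
    and norm_eta: "\<And>t j. 0 \<le> t \<Longrightarrow> j \<in> {1..l} \<Longrightarrow> norm (\<eta> j t) < 1"
    and norm_theta: "\<And>t k. 0 \<le> t \<Longrightarrow> k \<in> {1..m} \<Longrightarrow> norm (\<theta> k t) < 1"
    and theta_neq_eta: "\<And>t k j. 0 \<le> t \<Longrightarrow> k \<in> {1..m} \<Longrightarrow> j \<in> {1..l} \<Longrightarrow> \<theta> k t \<noteq> \<eta> j t"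
    and form: "\<And>t \<zeta>. 0 \<le> t \<Longrightarrow> norm \<zeta> \<le> 1 \<Longrightarrow>
      deriv (f t) \<zeta> * poly (lin_prod (\<lambda>j. \<eta> j t) \<nu> {1..l}) \<zeta> =
      of_real (a t) * poly (lin_prod (\<lambda>k. \<theta> k t) (\<lambda>_. 1) {1..m}) \<zeta>"
begin

abbreviation A :: "real \<Rightarrow> complex poly" where "A t \<equiv> lin_prod (\<lambda>k. \<theta> k t) (\<lambda>_. 1) {1..m}"
abbreviation B :: "real \<Rightarrow> complex poly" where "B t \<equiv> lin_prod (\<lambda>j. \<eta> j t) \<nu> {1..l}"

lemma B_nonzero:
  assumes "0 \<le> t" "norm \<zeta> \<le> 1"
  shows "poly (B t) \<zeta> \<noteq> 0"
proof (rule poly_lin_prod_nonzero)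
  fix j assume j: "j \<in> {1..l}"
  have "norm (\<eta> j t * \<zeta>) \<le> norm (\<eta> j t) * 1" unfolding norm_mult using assms by (intro mult_left_mono) auto
  also have "\<dots> < 1" using norm_eta[OF assms(1) j] by simp
  finally show "1 - \<eta> j t * \<zeta> \<noteq> 0" by auto
qed simp

lemma degree_A: "degree (A t) \<le> m"
  using degree_lin_prod_le[of "{1..m}" "\<lambda>k. \<theta> k t" "\<lambda>_. 1"] by simp

lemma degree_B: "degree (B t) \<le> sum \<nu> {1..l}"
  by (rule degree_lin_prod_le) simp

text \<open>This replaces continuity and differentiability of the poles. Labels need not persist, so
  the pole labelled j at times near \<open>T\<close> is matched with the pole labelled
  \<open>\<sigma> j\<close> at time \<open>T\<close>; the multiplicities on both sides of the
  velocity formula carry these respective labels.\<close>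

lemma pole_limits:
  assumes T: "0 \<le> T" and t: "\<And>n. 0 \<le> t n" "\<And>n. t n \<noteq> T" "t \<longlonglongrightarrow> T"
  shows "\<exists>r \<sigma>. strict_mono (r :: nat \<Rightarrow> nat) \<and> \<sigma> ` {1..l} = {1..l} \<and> (\<forall>j\<in>{1..l}.
    (\<lambda>n. \<eta> j (t (r n))) \<longlonglongrightarrow> \<eta> (\<sigma> j) T \<and>
    (\<exists>p. a' T / a T * ((1 - norm (\<eta> (\<sigma> j) T)) / (1 + norm (\<eta> (\<sigma> j) T))) \<le> Re p \<and>
      (\<lambda>n. of_nat (\<nu> j) * (1 / \<eta> j (t (r n)) - 1 / \<eta> (\<sigma> j) T) / of_real (t (r n) - T))
        \<longlonglongrightarrow> of_nat (\<nu> (\<sigma> j)) * p / \<eta> (\<sigma> j) T))"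
proof -
  \<comment> \<open>Zeros and poles are packed into one family so that a single subsequence makes
    all of them converge.\<close>
  define x where "x = (\<lambda>n. case_sum (\<lambda>k. \<theta> k (t n)) (\<lambda>j. \<eta> j (t n)))"
  have "norm (x n i) \<le> 1" if "i \<in> Inl ` {1..m} \<union> Inr ` {1..l}" for n i
    using that t(1) norm_theta norm_eta by (auto simp: x_def intro: less_imp_le)
  then obtain r y where r: "strict_mono (r :: nat \<Rightarrow> nat)"
    and y: "\<forall>i\<in>Inl ` {1..m} \<union> Inr ` {1..l}. (\<lambda>n. x (r n) i) \<longlonglongrightarrow> y i"
    using bounded_family_convergent_subseq[of "Inl ` {1..m} \<union> Inr ` {1..l}" x 1] by blast
  define \<theta>s where "\<theta>s = (\<lambda>k. y (Inl k))"
  define \<eta>s where "\<eta>s = (\<lambda>j. y (Inr j))"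
  define u where "u = (\<lambda>n. t (r n))"
  have \<theta>lim: "(\<lambda>n. \<theta> k (u n)) \<longlonglongrightarrow> \<theta>s k" if "k \<in> {1..m}" for k
    using bspec[OF y, of "Inl k"] that by (auto simp: x_def u_def \<theta>s_def)
  have \<eta>lim: "(\<lambda>n. \<eta> j (u n)) \<longlonglongrightarrow> \<eta>s j" if "j \<in> {1..l}" for j
    using bspec[OF y, of "Inr j"] that by (auto simp: x_def u_def \<eta>s_def)
  have u: "0 \<le> u n" "u n \<noteq> T" for n using t by (auto simp: u_def)
  have uT: "u \<longlonglongrightarrow> T" using LIMSEQ_subseq_LIMSEQ[OF t(3) r] by (simp add: u_def o_def)
  have fu: "filterlim u (at T within {0..}) sequentially"
    using u uT by (simp add: filterlim_at)
  have alim: "(\<lambda>n. a (u n)) \<longlonglongrightarrow> a T"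
    using filterlim_compose[OF DERIV_continuous[OF a_has_derivative[OF T], unfolded continuous_within] fu] .
  obtain \<rho> where \<rho>: "1 < \<rho>" and dg: "\<And>\<zeta>. \<zeta> \<in> ball 0 \<rho> \<Longrightarrow>
      ((\<lambda>s. deriv (f s) \<zeta>) has_vector_derivative deriv (fdot T) \<zeta>) (at T within {0..})"
    using f_holomorphic[OF T] by metis
  have glim: "(\<lambda>n. deriv (f (u n)) \<zeta>) \<longlonglongrightarrow> deriv (f T) \<zeta>" if "\<zeta> \<in> ball 0 1" for \<zeta>
  proof -
    have "\<zeta> \<in> ball 0 \<rho>" using that \<rho> by auto
    from has_vector_derivative_continuous[OF dg[OF this]]
    show ?thesis using filterlim_compose[OF _ fu] by (simp add: continuous_within)
  qed
  have gdiff: "(\<lambda>n. (deriv (f (u n)) \<zeta> - deriv (f T) \<zeta>) / of_real (u n - T)) \<longlonglongrightarrow> deriv (fdot T) \<zeta>"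
    if "\<zeta> \<in> ball 0 1" for \<zeta>
  proof -
    have "\<zeta> \<in> ball 0 \<rho>" using that \<rho> by auto
    from filterlim_compose[OF vector_difference_quotient_tendsto[OF dg[OF this]] fu]
    show ?thesis by (simp add: scaleR_conv_of_real divide_inverse mult.commute)
  qed
  define As where "As = lin_prod \<theta>s (\<lambda>_. 1) {1..m}"
  define Bs where "Bs = lin_prod \<eta>s \<nu> {1..l}"
  have Alim: "(\<lambda>n. poly (A (u n)) \<zeta>) \<longlonglongrightarrow> poly As \<zeta>" for \<zeta>
    unfolding As_def poly_lin_prod by (intro tendsto_intros \<theta>lim)
  have Blim': "(\<lambda>n. poly (lin_prod (\<lambda>j. \<eta> j (u n)) \<nu> J) \<zeta>) \<longlonglongrightarrow> poly (lin_prod \<eta>s \<nu> J) \<zeta>"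
    if "J \<subseteq> {1..l}" for \<zeta> J
    unfolding poly_lin_prod by (intro tendsto_intros \<eta>lim) (use that in auto)
  have Blim: "(\<lambda>n. poly (B (u n)) \<zeta>) \<longlonglongrightarrow> poly Bs \<zeta>" for \<zeta>
    unfolding Bs_def by (rule Blim') simp
  \<comment> \<open>Passing to the limit in \<open>f' B = a A\<close> shows that the limiting
    fraction and the one at time \<open>T\<close> represent the same function; cross-multiplication
    turns this into a polynomial identity.\<close>
  have id: "poly (As * B T) \<zeta> = poly (A T * Bs) \<zeta>" if "\<zeta> \<in> ball 0 1" for \<zeta>
  proof -
    have \<zeta>: "norm \<zeta> \<le> 1" using that by simp
    have "(\<lambda>n. deriv (f (u n)) \<zeta> * poly (B (u n)) \<zeta>) \<longlonglongrightarrow> deriv (f T) \<zeta> * poly Bs \<zeta>"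
      by (intro tendsto_intros glim Blim that)
    moreover have "(\<lambda>n. of_real (a (u n)) * poly (A (u n)) \<zeta>) \<longlonglongrightarrow> of_real (a T) * poly As \<zeta>"
      by (intro tendsto_intros alim Alim)
    ultimately have "deriv (f T) \<zeta> * poly Bs \<zeta> = of_real (a T) * poly As \<zeta>"
      using form[OF u(1) \<zeta>] LIMSEQ_unique by auto
    then have "of_real (a T) * (poly As \<zeta> * poly (B T) \<zeta>) = deriv (f T) \<zeta> * poly (B T) \<zeta> * poly Bs \<zeta>"
      by (simp add: algebra_simps)
    also have "\<dots> = of_real (a T) * (poly (A T) \<zeta> * poly Bs \<zeta>)"
      unfolding form[OF T \<zeta>] by simp
    finally show ?thesis using a_pos[OF T] by simp
  qed
  have inf: "infinite (ball (0::complex) 1)"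
    using uncountable_ball[of 1 "0::complex"] countable_finite by auto
  have poly_id: "As * B T = A T * Bs" by (rule poly_eq_on_infinite[OF inf id])
  have BsB: "Bs = B T" and AsA: "As = A T"
    using lin_prod_uniqueness[OF _ _ theta_neq_eta[OF T] eta_nonzero[OF T] poly_id[unfolded As_def Bs_def]]
    by (auto simp: As_def Bs_def)
  have "\<exists>j\<in>{1..l}. \<eta>s j = \<eta> i T" if i: "i \<in> {1..l}" for i
  proof -
    have nz: "\<eta> i T \<noteq> 0" using eta_nonzero[OF T i] .
    have "poly (B T) (1 / \<eta> i T) = 0"
      unfolding poly_lin_prod using i nz nu[OF i] by (auto intro!: bexI[of _ i])
    then have "poly Bs (1 / \<eta> i T) = 0" by (simp add: BsB)
    then obtain j where "j \<in> {1..l}" "1 - \<eta>s j * (1 / \<eta> i T) = 0"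
      unfolding Bs_def poly_lin_prod by auto
    then show ?thesis using nz by (intro bexI[of _ j]) (auto simp: field_simps)
  qed
  then obtain \<tau>' where \<tau>': "\<And>i. i \<in> {1..l} \<Longrightarrow> \<tau>' i \<in> {1..l}" "\<And>i. i \<in> {1..l} \<Longrightarrow> \<eta>s (\<tau>' i) = \<eta> i T"
    by metis
  have inj\<tau>: "inj_on \<tau>' {1..l}"
    using eta_inj[OF T] \<tau>'(2) by (metis (mono_tags, lifting) inj_on_def)
  have im\<tau>: "\<tau>' ` {1..l} = {1..l}" using \<tau>'(1) inj\<tau> by (intro endo_inj_surj) auto
  \<comment> \<open>\<open>\<tau>'\<close> assigns to each pole at time \<open>T\<close> a label
    converging to it. As an injective self-map of a finite set it is a bijection, and its inverse is
    the matching sought.\<close>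
  define \<sigma> where "\<sigma> = inv_into {1..l} \<tau>'"
  have \<sigma>in: "\<sigma> j \<in> {1..l}" and \<tau>\<sigma>: "\<tau>' (\<sigma> j) = j" if "j \<in> {1..l}" for j
    using inv_into_into[of j \<tau>' "{1..l}"] f_inv_into_f[of j \<tau>' "{1..l}"] that unfolding im\<tau> \<sigma>_def by blast+
  have \<sigma>im: "\<sigma> ` {1..l} = {1..l}"
  proof
    show "{1..l} \<subseteq> \<sigma> ` {1..l}"
    proof
      fix i assume "i \<in> {1..l}"
      then have "i = \<sigma> (\<tau>' i)" "\<tau>' i \<in> {1..l}" using inj\<tau> \<tau>'(1) by (simp_all only: \<sigma>_def inv_into_f_f)
      then show "i \<in> \<sigma> ` {1..l}" by (rule image_eqI)
    qed
  qed (use \<sigma>in in auto)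
  have \<eta>s: "\<eta>s j = \<eta> (\<sigma> j) T" if "j \<in> {1..l}" for j
    using \<tau>'(2)[OF \<sigma>in[OF that]] \<tau>\<sigma>[OF that] by simp
  \<comment> \<open>The difference quotient of \<open>f'\<close> in time, cleared of denominators.
    These polynomials have bounded degree and converge on the unit disk, hence locally uniformly in
    the plane.\<close>
  define Np where "Np = (\<lambda>n. smult (1 / of_real (u n - T))
      (smult (of_real (a (u n))) (A (u n)) * B T - smult (of_real (a T)) (A T) * B (u n)))"
  have degN: "degree (Np n) \<le> m + sum \<nu> {1..l}" for n
  proof -
    have d: "degree (smult c (A s) * B s') \<le> m + sum \<nu> {1..l}" for c s s'
    proof -
      have "degree (smult c (A s) * B s') \<le> degree (smult c (A s)) + degree (B s')" by (rule degree_mult_le)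
      also have "\<dots> \<le> m + sum \<nu> {1..l}"
        using degree_A[of s] degree_B[of s'] degree_smult_le[of c "A s"] by linarith
      finally show ?thesis .
    qed
    have "degree (Np n) \<le> degree (smult (of_real (a (u n))) (A (u n)) * B T - smult (of_real (a T)) (A T) * B (u n))"
      unfolding Np_def by (rule degree_smult_le)
    also have "\<dots> \<le> m + sum \<nu> {1..l}" by (rule degree_diff_le) (rule d)+
    finally show ?thesis .
  qed
  have Nlim: "(\<lambda>n. poly (Np n) \<zeta>) \<longlonglongrightarrow> deriv (fdot T) \<zeta> * (poly (B T) \<zeta>)\<^sup>2" if "\<zeta> \<in> ball 0 1" for \<zeta>
  proof -
    have \<zeta>: "norm \<zeta> \<le> 1" using that by simp
    have "poly (Np n) \<zeta> = (deriv (f (u n)) \<zeta> - deriv (f T) \<zeta>) / of_real (u n - T) * (poly (B (u n)) \<zeta> * poly (B T) \<zeta>)" for n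
      unfolding Np_def poly_smult poly_diff poly_mult form[OF u(1) \<zeta>, symmetric] form[OF T \<zeta>, symmetric]
      by (simp add: algebra_simps diff_divide_distrib)
    then show ?thesis
      using tendsto_mult[OF gdiff[OF that] tendsto_mult[OF Blim[of \<zeta>] tendsto_const[of "poly (B T) \<zeta>"]]]
      by (simp add: BsB power2_eq_square)
  qed
  obtain N where N: "\<And>K. bounded K \<Longrightarrow> uniform_limit K (\<lambda>n. poly (Np n)) (poly N) sequentially"
    using poly_uniform_limit_bounded[of Np, OF degN inf] Nlim by (auto simp: convergent_def)
  have Neq: "poly N \<zeta> = deriv (fdot T) \<zeta> * (poly (B T) \<zeta>)\<^sup>2" if "\<zeta> \<in> ball 0 1" for \<zeta>
    using tendsto_uniform_limitI[OF N, of "{\<zeta>}" \<zeta>] Nlim[OF that] LIMSEQ_unique by auto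
  have main: "\<exists>p. a' T / a T * ((1 - norm (\<eta> (\<sigma> j) T)) / (1 + norm (\<eta> (\<sigma> j) T))) \<le> Re p \<and>
      (\<lambda>n. of_nat (\<nu> j) * (1 / \<eta> j (u n) - 1 / \<eta> (\<sigma> j) T) / of_real (u n - T))
        \<longlonglongrightarrow> of_nat (\<nu> (\<sigma> j)) * p / \<eta> (\<sigma> j) T" if j: "j \<in> {1..l}" for j
  proof -
    define i where "i = \<sigma> j"
    have i: "i \<in> {1..l}" using \<sigma>in[OF j] by (simp add: i_def)
    define \<eta>0 where "\<eta>0 = \<eta> i T"
    let ?A = "smult (of_real (a T)) (A T)"
    have \<eta>0: "\<eta>0 \<noteq> 0" "norm \<eta>0 < 1" using eta_nonzero[OF T i] norm_eta[OF T i] by (auto simp: \<eta>0_def)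
    have \<eta>j: "\<eta> j (u n) \<noteq> 0" for n using eta_nonzero[OF u(1) j] .
    define C where "C = lin_prod (\<lambda>j. \<eta> j T) \<nu> ({1..l} - {i})"
    define Cn where "Cn = (\<lambda>n. lin_prod (\<lambda>j. \<eta> j (u n)) \<nu> ({1..l} - {j}))"
    define Cs where "Cs = lin_prod \<eta>s \<nu> ({1..l} - {j})"
    \<comment> \<open>A neighbourhood of the pole in the exterior of the disk, free of zeros and of
      the other poles; \<delta> is half of \<delta>', so that the circle has room around it.\<close>
    define G where "G = {\<zeta>::complex. 1 < norm \<zeta>} \<inter> (\<Inter>k\<in>{1..m}. {\<zeta>. 1 - \<theta> k T * \<zeta> \<noteq> 0}) \<inter>
        (\<Inter>i'\<in>{1..l} - {i}. {\<zeta>. 1 - \<eta> i' T * \<zeta> \<noteq> 0})"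
    have "open G" unfolding G_def
      by (intro open_Int open_INT ballI open_Collect_less open_Collect_neq continuous_intros) auto
    moreover have "1 / \<eta>0 \<in> G"
    proof -
      have "\<theta> k T \<noteq> \<eta>0" if "k \<in> {1..m}" for k using theta_neq_eta[OF T that i] by (simp add: \<eta>0_def)
      moreover have "\<eta> i' T \<noteq> \<eta>0" if "i' \<in> {1..l} - {i}" for i'
        using inj_onD[OF eta_inj[OF T] _ _ i, of i'] that by (auto simp: \<eta>0_def)
      moreover have "1 < norm (1 / \<eta>0)" using \<eta>0 by (simp add: norm_divide)
      ultimately show ?thesis using \<eta>0 by (auto simp: G_def field_simps)
    qed
    ultimately obtain \<delta>' where \<delta>': "\<delta>' > 0" "cball (1 / \<eta>0) \<delta>' \<subseteq> G"
      using open_contains_cball by blast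
    define \<delta> where "\<delta> = \<delta>' / 2"
    have \<delta>: "0 < \<delta>" "\<delta> < \<delta>'" using \<delta>' by (auto simp: \<delta>_def)
    have aT: "of_real (a T) \<noteq> (0::complex)" "of_real (a s) \<noteq> (0::complex)" if "0 \<le> s" for s
      using a_pos[OF T] a_pos[OF that] by auto
    have Anz: "poly (A T) \<zeta> \<noteq> 0" and Cnz: "poly C \<zeta> \<noteq> 0" and Csnz: "poly Cs \<zeta> \<noteq> 0" and n1: "1 < norm \<zeta>"
      if "\<zeta> \<in> cball (1 / \<eta>0) \<delta>'" for \<zeta>
    proof -
      have \<zeta>: "\<zeta> \<in> G" using that \<delta>' by auto
      show "poly (A T) \<zeta> \<noteq> 0" by (rule poly_lin_prod_nonzero) (use \<zeta> in \<open>auto simp: G_def\<close>)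
      show "poly C \<zeta> \<noteq> 0" unfolding C_def by (rule poly_lin_prod_nonzero) (use \<zeta> in \<open>auto simp: G_def\<close>)
      show "1 < norm \<zeta>" using \<zeta> by (auto simp: G_def)
      show "poly Cs \<zeta> \<noteq> 0" unfolding Cs_def
      proof (rule poly_lin_prod_nonzero)
        fix j' assume j': "j' \<in> {1..l} - {j}"
        then have "\<sigma> j' \<in> {1..l}" using \<sigma>in by auto
        moreover have "\<sigma> j' \<noteq> i" using \<tau>\<sigma> j' j by (metis DiffE i_def insertI1)
        ultimately have "1 - \<eta> (\<sigma> j') T * \<zeta> \<noteq> 0" using \<zeta> by (auto simp: G_def)
        then show "1 - \<eta>s j' * \<zeta> \<noteq> 0" using \<eta>s[of j'] j' by auto
      qed simp
    qed
    have BC: "poly (B T) \<zeta> = (1 - \<eta>0 * \<zeta>) ^ \<nu> i * poly C \<zeta>" for \<zeta>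
      unfolding C_def \<eta>0_def using poly_lin_prod_remove[OF _ i] by auto
    have BCn: "poly (B (u n)) \<zeta> = (1 - \<eta> j (u n) * \<zeta>) ^ \<nu> j * poly (Cn n) \<zeta>" for \<zeta> n
      unfolding Cn_def using poly_lin_prod_remove[OF _ j] by auto
    have lin: "1 - h * \<zeta> = - h * (\<zeta> - 1 / h)" if "h \<noteq> 0" for h \<zeta> :: complex
      using that by (simp add: field_simps)
    have cont: "\<exists>p. a' T / a T * ((1 - norm \<eta>0) / (1 + norm \<eta>0)) \<le> Re p \<and>
      contour_integral (circlepath (1 / \<eta>0) \<delta>) (\<lambda>\<zeta>. poly N \<zeta> / (poly (B T) \<zeta> * poly ?A \<zeta>)) =
      2 * of_real pi * \<i> * (of_nat (\<nu> i) * p / \<eta>0)"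
    proof (rule pole_velocity[OF T _ _ Neq BC \<eta>0 nu[OF i] \<delta>(1)])
      show "deriv (f T) \<zeta> * poly (B T) \<zeta> = poly ?A \<zeta>" if "\<zeta> \<in> ball 0 1" for \<zeta>
        using form[OF T] that by simp
      show "poly (B T) \<zeta> \<noteq> 0" if "\<zeta> \<in> ball 0 1" for \<zeta> using B_nonzero[OF T] that by simp
      show "1 < norm \<zeta> \<and> poly ?A \<zeta> \<noteq> 0 \<and> poly C \<zeta> \<noteq> 0" if "\<zeta> \<in> cball (1 / \<eta>0) \<delta>" for \<zeta>
        using that \<delta> Anz[of \<zeta>] Cnz[of \<zeta>] n1[of \<zeta>] aT(1)[OF T] by auto
    qed
    then obtain p where p: "a' T / a T * ((1 - norm \<eta>0) / (1 + norm \<eta>0)) \<le> Re p"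
      and pc: "contour_integral (circlepath (1 / \<eta>0) \<delta>) (\<lambda>\<zeta>. poly N \<zeta> / (poly (B T) \<zeta> * poly ?A \<zeta>)) =
      2 * of_real pi * \<i> * (of_nat (\<nu> i) * p / \<eta>0)" by blast
    \<comment> \<open>\<open>1 + (u n - T) * qn\<close> is the quotient of \<open>f'\<close> at time
      \<open>u n\<close> by \<open>f'\<close> at time \<open>T\<close>. Its factors vanishing or
      singular near the pole are split off, and \<open>\<kappa>\<close> is the zero-free
      rest.\<close>
    define qn where "qn = (\<lambda>n \<zeta>. poly (Np n) \<zeta> / (poly (B (u n)) \<zeta> * poly ?A \<zeta>))"
    define q0 where "q0 = (\<lambda>\<zeta>. poly N \<zeta> / (poly (B T) \<zeta> * poly ?A \<zeta>))"
    define \<kappa> where "\<kappa> = (\<lambda>n \<zeta>. (of_real (a (u n)) * poly (A (u n)) \<zeta> * poly C \<zeta> * (- \<eta>0) ^ \<nu> i) /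
        (of_real (a T) * poly (A T) \<zeta> * poly (Cn n) \<zeta> * (- \<eta> j (u n)) ^ \<nu> j))"
    have uA: "uniform_limit K (\<lambda>n. poly (A (u n))) (poly (A T)) sequentially" if "bounded K" for K
      by (rule poly_uniform_limit_of_pointwise[OF degree_A _ that]) (use Alim AsA in auto)
    have uB: "uniform_limit K (\<lambda>n. poly (B (u n))) (poly (B T)) sequentially" if "bounded K" for K
      by (rule poly_uniform_limit_of_pointwise[OF degree_B _ that]) (use Blim BsB in auto)
    have uC: "uniform_limit K (\<lambda>n. poly (Cn n)) (poly Cs) sequentially" if "bounded K" for K
      unfolding Cn_def Cs_def
      by (rule poly_uniform_limit_of_pointwise[OF degree_lin_prod_le _ that]) (auto intro: Blim')
    have evA: "\<forall>\<^sub>F n in sequentially. \<forall>\<zeta>\<in>cball (1 / \<eta>0) \<delta>'. poly (A (u n)) \<zeta> \<noteq> 0"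
      by (rule uniform_limit_eventually_nonzero[OF uA[OF bounded_cball] compact_cball _ Anz]) (intro continuous_intros)
    have evC: "\<forall>\<^sub>F n in sequentially. \<forall>\<zeta>\<in>cball (1 / \<eta>0) \<delta>'. poly (Cn n) \<zeta> \<noteq> 0"
      by (rule uniform_limit_eventually_nonzero[OF uC[OF bounded_cball] compact_cball _ Csnz]) (intro continuous_intros)
    have sph: "\<zeta> \<in> cball (1 / \<eta>0) \<delta>'" "\<zeta> \<noteq> 1 / \<eta>0" if "\<zeta> \<in> sphere (1 / \<eta>0) \<delta>" for \<zeta>
      using that \<delta> by auto
    have BTnz: "poly (B T) \<zeta> * poly ?A \<zeta> \<noteq> 0" if "\<zeta> \<in> sphere (1 / \<eta>0) \<delta>" for \<zeta>
      using BC[of \<zeta>] lin[OF \<eta>0(1), of \<zeta>] sph[OF that] Anz[of \<zeta>] Cnz[of \<zeta>] aT(1)[OF T] \<eta>0(1) by auto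
    have qlim: "uniform_limit (sphere (1 / \<eta>0) \<delta>) qn q0 sequentially"
    proof -
      have bd: "bounded ((\<lambda>\<zeta>. poly P \<zeta>) ` sphere (1 / \<eta>0) \<delta>)" for P :: "complex poly"
        by (intro compact_imp_bounded compact_continuous_image continuous_intros) auto
      have ne: "sphere (1 / \<eta>0) \<delta> \<noteq> {}" using \<delta> by simp
      have "continuous_on (sphere (1 / \<eta>0) \<delta>) (\<lambda>\<zeta>. norm (poly (B T) \<zeta> * poly ?A \<zeta>))"
        by (intro continuous_intros)
      then obtain z0 where z0: "z0 \<in> sphere (1 / \<eta>0) \<delta>" "\<And>z. z \<in> sphere (1 / \<eta>0) \<delta> \<Longrightarrow>
          norm (poly (B T) z0 * poly ?A z0) \<le> norm (poly (B T) z * poly ?A z)"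
        using continuous_attains_inf[OF compact_sphere ne] by blast
      show ?thesis unfolding qn_def q0_def
      proof (rule uniform_lim_divide[OF N _ bd])
        show "uniform_limit (sphere (1 / \<eta>0) \<delta>) (\<lambda>n \<zeta>. poly (B (u n)) \<zeta> * poly ?A \<zeta>)
            (\<lambda>\<zeta>. poly (B T) \<zeta> * poly ?A \<zeta>) sequentially"
          by (rule uniform_lim_mult[OF uB uniform_limit_const bd bd]) auto
        show "norm (poly (B T) z0 * poly ?A z0) > 0" using BTnz[OF z0(1)] by simp
      qed (use z0 in auto)
    qed
    have x: "(\<lambda>n. 1 / \<eta> j (u n)) \<longlonglongrightarrow> 1 / \<eta>0"
      using \<eta>lim[OF j] \<eta>s[OF j] \<eta>0(1) by (intro tendsto_intros) (auto simp: \<eta>0_def i_def)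
    have "(\<lambda>n. of_nat (\<nu> j) * (1 / \<eta> j (u n) - 1 / \<eta>0) / of_real (u n - T)) \<longlonglongrightarrow>
        contour_integral (circlepath (1 / \<eta>0) \<delta>) q0 / (2 * of_real pi * \<i>)"
    proof (rule pole_speed_contour[OF \<delta> _ _ x qlim])
      show "(\<lambda>n. u n - T) \<longlonglongrightarrow> 0" using uT by (simp add: LIM_zero)
      show "u n - T \<noteq> 0" for n using u by simp
      show "continuous_on (sphere (1 / \<eta>0) \<delta>) q0"
        unfolding q0_def using BTnz by (intro continuous_intros) auto
      show "\<forall>\<^sub>F n in sequentially. \<kappa> n holomorphic_on ball (1 / \<eta>0) \<delta>' \<and> (\<forall>\<zeta>\<in>ball (1 / \<eta>0) \<delta>'. \<kappa> n \<zeta> \<noteq> 0) \<and>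
        (\<forall>\<zeta>\<in>ball (1 / \<eta>0) \<delta>' - {1 / \<eta>0, 1 / \<eta> j (u n)}.
        1 + of_real (u n - T) * qn n \<zeta> = (\<zeta> - 1 / \<eta>0) ^ \<nu> i / (\<zeta> - 1 / \<eta> j (u n)) ^ \<nu> j * \<kappa> n \<zeta>)"
        using evA evC
      proof eventually_elim
        case (elim n)
        have nz: "poly (A T) \<zeta> \<noteq> 0" "poly C \<zeta> \<noteq> 0" "poly (A (u n)) \<zeta> \<noteq> 0" "poly (Cn n) \<zeta> \<noteq> 0"
          if "\<zeta> \<in> ball (1 / \<eta>0) \<delta>'" for \<zeta>
          using that elim Anz[of \<zeta>] Cnz[of \<zeta>] by auto
        have au: "of_real (a (u n)) \<noteq> (0::complex)" "of_real (a T) \<noteq> (0::complex)" using aT[OF u(1)] by auto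
        have "\<kappa> n holomorphic_on ball (1 / \<eta>0) \<delta>'"
          unfolding \<kappa>_def by (intro holomorphic_intros) (use nz au \<eta>j in auto)
        moreover have "\<kappa> n \<zeta> \<noteq> 0" if "\<zeta> \<in> ball (1 / \<eta>0) \<delta>'" for \<zeta>
          unfolding \<kappa>_def using nz[OF that] au \<eta>j \<eta>0 by auto
        moreover have "1 + of_real (u n - T) * qn n \<zeta> = (\<zeta> - 1 / \<eta>0) ^ \<nu> i / (\<zeta> - 1 / \<eta> j (u n)) ^ \<nu> j * \<kappa> n \<zeta>"
          if \<zeta>: "\<zeta> \<in> ball (1 / \<eta>0) \<delta>' - {1 / \<eta>0, 1 / \<eta> j (u n)}" for \<zeta>
        proof -
          note nz' = nz[of \<zeta>]
          have B1: "poly (B T) \<zeta> = (- \<eta>0) ^ \<nu> i * (\<zeta> - 1 / \<eta>0) ^ \<nu> i * poly C \<zeta>"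
            unfolding BC lin[OF \<eta>0(1)] power_mult_distrib ..
          have B2: "poly (B (u n)) \<zeta> = (- \<eta> j (u n)) ^ \<nu> j * (\<zeta> - 1 / \<eta> j (u n)) ^ \<nu> j * poly (Cn n) \<zeta>"
            unfolding BCn lin[OF \<eta>j] power_mult_distrib ..
          have y0: "(\<zeta> - 1 / \<eta> j (u n)) ^ \<nu> j \<noteq> 0" "(- \<eta> j (u n)) ^ \<nu> j \<noteq> 0" using \<zeta> \<eta>j by auto
          then have Bu: "poly (B (u n)) \<zeta> \<noteq> 0" unfolding B2 using nz' \<zeta> by auto
          have uT0: "of_real (u n - T) \<noteq> (0::complex)" using u(2)[of n] by (simp add: of_real_eq_0_iff del: of_real_diff)
          define D where "D = poly ?A \<zeta>"
          have D: "D \<noteq> 0" using nz' \<zeta> au by (simp add: D_def)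
          have "of_real (u n - T) * poly (Np n) \<zeta> = of_real (a (u n)) * poly (A (u n)) \<zeta> * poly (B T) \<zeta> - D * poly (B (u n)) \<zeta>"
            unfolding Np_def D_def poly_smult poly_diff poly_mult using uT0 by simp
          then have "of_real (u n - T) * qn n \<zeta> = (of_real (a (u n)) * poly (A (u n)) \<zeta> * poly (B T) \<zeta> - D * poly (B (u n)) \<zeta>) / (poly (B (u n)) \<zeta> * D)"
            by (simp only: qn_def D_def[symmetric] times_divide_eq_right)
          then have "1 + of_real (u n - T) * qn n \<zeta> = of_real (a (u n)) * poly (A (u n)) \<zeta> * poly (B T) \<zeta> / (poly (B (u n)) \<zeta> * D)"
            using Bu D by (simp add: diff_divide_distrib)
          also have "\<dots> = (\<zeta> - 1 / \<eta>0) ^ \<nu> i / (\<zeta> - 1 / \<eta> j (u n)) ^ \<nu> j * \<kappa> n \<zeta>"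
            unfolding B1 B2 \<kappa>_def D_def poly_smult by (simp add: ac_simps)
          finally show ?thesis .
        qed
        ultimately show ?case by blast
      qed
    qed
    also have "contour_integral (circlepath (1 / \<eta>0) \<delta>) q0 / (2 * of_real pi * \<i>) = of_nat (\<nu> i) * p / \<eta>0"
      unfolding q0_def pc by simp
    finally show ?thesis using p unfolding i_def[symmetric] \<eta>0_def[symmetric] by blast
  qed
  have "(\<lambda>n. \<eta> j (t (r n))) \<longlonglongrightarrow> \<eta> (\<sigma> j) T" if "j \<in> {1..l}" for j
    using \<eta>lim[OF that] \<eta>s[OF that] by (simp add: u_def)
  then show ?thesis
    using r \<sigma>im main[unfolded u_def] by (intro exI[of _ r] exI[of _ \<sigma>] conjI ballI) assumption+
qed

end

subsection \<open>Escape of the poles to infinity\<close>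

context pg_solution
begin

lemma a_mono:
  assumes "0 \<le> s" "s \<le> t"
  shows "a s \<le> a t"
proof -
  have "\<exists>x\<in>{s..t}. a t - a s = (\<lambda>h. a' x * h) (t - s)"
  proof (rule mvt_very_simple[OF assms(2)])
    fix x assume x: "s \<le> x" "x \<le> t"
    have "(a has_real_derivative a' x) (at x within {s..t})"
      by (rule DERIV_subset[OF a_has_derivative]) (use x assms in auto)
    then show "(a has_derivative (\<lambda>h. a' x * h)) (at x within {s..t})"
      by (simp add: has_field_derivative_def)
  qed
  then obtain x where x: "x \<in> {s..t}" "a t - a s = a' x * (t - s)" by auto
  have "0 \<le> x" using x assms by auto
  then have "0 < a' x" by (rule loewner_function)
  then show ?thesis using x assms by (metis diff_ge_0_iff_ge less_imp_le mult_nonneg_nonneg)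
qed

end

context rational_solution
begin

text \<open>By Harnack's inequality \<open>norm (\<eta> j t) * a t powr \<kappa>\<close> cannot increase for suitable \<open>\<kappa>\<close>; the
  factor \<open>2\<close> in the choice of \<open>\<kappa>\<close> makes the relevant differential inequality strict.\<close>

lemma pole_escape:
  shows "\<exists>\<kappa> w. 0 < \<kappa> \<and> 0 < w \<and> w < 1 \<and> (\<forall>t\<ge>0. \<forall>j\<in>{1..l}. norm (\<eta> j t) * a t powr \<kappa> \<le> w * a 0 powr \<kappa>)"
proof -
  \<comment> \<open>The element 1/2 makes the maximum meaningful and positive also without
    poles.\<close>
  define w where "w = Max (insert (1/2) ((\<lambda>j. norm (\<eta> j 0)) ` {1..l}))"
  have w1: "w < 1" unfolding w_def using norm_eta[of 0] by (subst Max_less_iff) auto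
  have w0: "1/2 \<le> w" unfolding w_def by (rule Max_ge) auto
  have wj: "norm (\<eta> j 0) \<le> w" if "j \<in> {1..l}" for j unfolding w_def by (rule Max_ge) (use that in auto)
  \<comment> \<open>\<open>n\<close> exceeds every multiplicity, so 1 / n bounds from below the
    ratios \<open>\<nu> i / \<nu> j\<close> that enter the velocities of matched poles;
    \<open>Suc\<close> keeps it positive when there are none.\<close>
  define n where "n = real (Suc (sum \<nu> {1..l}))"
  define \<kappa> where "\<kappa> = (1 - w) / (1 + w) / (2 * n)"
  have n: "n > 0" by (simp only: n_def of_nat_0_less_iff zero_less_Suc)
  have \<kappa>: "\<kappa> > 0" using w1 w0 n by (simp add: \<kappa>_def)
  define D where "D = w * a 0 powr \<kappa>"
  define good where "good = (\<lambda>t. \<forall>j\<in>{1..l}. norm (\<eta> j t) * a t powr \<kappa> \<le> D)"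
  \<comment> \<open>Since \<open>a\<close> is nondecreasing, the barrier \<open>D\<close> implies
    |\<eta>_j| \<le> w. Thus the Harnack constant (1 - w) / (1 + w) computed from time 0 remains
    valid at every good time.\<close>
  have good_le: "norm (\<eta> j t) \<le> w" if "good t" "0 \<le> t" "j \<in> {1..l}" for t j
  proof -
    have "norm (\<eta> j t) * a 0 powr \<kappa> \<le> norm (\<eta> j t) * a t powr \<kappa>"
      using a_mono[of 0 t] a_pos[of 0] that(2) \<kappa> by (intro mult_left_mono powr_mono2) auto
    also have "\<dots> \<le> w * a 0 powr \<kappa>" using that by (auto simp: good_def D_def)
    finally show ?thesis using a_pos[of 0] by (simp add: mult_le_cancel_right)
  qed
  have acont: "((\<lambda>s. a s powr \<kappa>) \<longlongrightarrow> a T powr \<kappa>) (at T within {0..})" if "0 \<le> T" for T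
    using DERIV_continuous[OF a_has_derivative[OF that]] a_pos[OF that]
    unfolding continuous_within by (intro tendsto_intros) auto
  have "good t" if "0 \<le> t" for t
  proof (rule ccontr)
    assume ng: "\<not> good t"
    define S where "S = {t. 0 \<le> t \<and> \<not> good t}"
    \<comment> \<open>The first exit time. It is good itself, by limits of poles from the left or by
      the choice of \<open>D\<close> if it is 0, and bad times accumulate at it from the right; the
      strict differential inequality excludes the latter.\<close>
    define T where "T = Inf S"
    have Sne: "S \<noteq> {}" and Sbd: "bdd_below S" using ng that by (auto simp: S_def intro: bdd_belowI[of _ 0])
    have T0: "0 \<le> T" unfolding T_def by (rule cInf_greatest[OF Sne]) (auto simp: S_def)
    have before: "good s" if "0 \<le> s" "s < T" for s
      using cInf_lower[OF _ Sbd, of s] that by (force simp: S_def T_def)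
    have goodT: "good T"
    proof (cases "T = 0")
      case True
      have "norm (\<eta> j 0) * a 0 powr \<kappa> \<le> D" if "j \<in> {1..l}" for j
        unfolding D_def using wj[OF that] by (intro mult_right_mono) auto
      then show ?thesis using True by (simp add: good_def)
    next
      case False
      then have Tp: "0 < T" using T0 by simp
      define s where "s = (\<lambda>n. T - T * inverse (real (Suc n)))"
      have s: "0 \<le> s n" "s n \<noteq> T" "s n < T" for n
        using Tp by (auto simp: s_def field_simps)
      have "s \<longlonglongrightarrow> T - T * 0" unfolding s_def by (intro tendsto_intros LIMSEQ_inverse_real_of_nat)
      then have sT: "s \<longlonglongrightarrow> T" by simp
      obtain r \<sigma> where r: "strict_mono (r :: nat \<Rightarrow> nat)" and \<sigma>: "\<sigma> ` {1..l} = {1..l}"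
        and lim: "\<forall>j\<in>{1..l}. (\<lambda>n. \<eta> j (s (r n))) \<longlonglongrightarrow> \<eta> (\<sigma> j) T"
        using pole_limits[OF T0 s(1,2) sT] by blast
      have fs: "filterlim (\<lambda>n. s (r n)) (at T within {0..}) sequentially"
        using s LIMSEQ_subseq_LIMSEQ[OF sT r] by (simp add: filterlim_at o_def)
      show ?thesis unfolding good_def
      proof
        fix i assume "i \<in> {1..l}"
        then obtain j where j: "j \<in> {1..l}" "i = \<sigma> j" using \<sigma> by blast
        have "(\<lambda>n. norm (\<eta> j (s (r n))) * a (s (r n)) powr \<kappa>) \<longlonglongrightarrow> norm (\<eta> i T) * a T powr \<kappa>"
          using lim j by (intro tendsto_intros filterlim_compose[OF acont[OF T0] fs]) auto
        then show "norm (\<eta> i T) * a T powr \<kappa> \<le> D"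
          by (rule LIMSEQ_le_const2) (use before[OF s(1,3)] j in \<open>auto simp: good_def\<close>)
      qed
    qed
    have "\<exists>s\<in>S. T < s \<and> s < T + inverse (real (Suc n))" for n
    proof -
      obtain s where s: "s \<in> S" "s < T + inverse (real (Suc n))"
        using cInf_lessD[OF Sne, of "T + inverse (real (Suc n))"] by (auto simp: T_def)
      moreover have "T \<le> s" unfolding T_def by (rule cInf_lower[OF s(1) Sbd])
      moreover have "s \<noteq> T" using goodT s by (auto simp: S_def)
      ultimately show ?thesis by (intro bexI[of _ s]) simp_all
    qed
    then obtain s where s: "\<And>n. s n \<in> S" "\<And>n. T < s n" "\<And>n. s n < T + inverse (real (Suc n))" by metis
    have up: "(\<lambda>n. T + inverse (real (Suc n))) \<longlonglongrightarrow> T"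
      using tendsto_add[OF tendsto_const[of T] LIMSEQ_inverse_real_of_nat] by simp
    have sT: "s \<longlonglongrightarrow> T"
      by (rule tendsto_sandwich[OF always_eventually always_eventually tendsto_const[of T] up])
        (use s(2,3) in \<open>blast intro: less_imp_le\<close>)+
    have s0: "0 \<le> s n" "s n \<noteq> T" for n using s(2)[of n] T0 by auto
    obtain r \<sigma> where r: "strict_mono (r :: nat \<Rightarrow> nat)" and \<sigma>: "\<sigma> ` {1..l} = {1..l}"
      and lim: "\<forall>j\<in>{1..l}. (\<exists>p. a' T / a T * ((1 - norm (\<eta> (\<sigma> j) T)) / (1 + norm (\<eta> (\<sigma> j) T))) \<le> Re p \<and>
      (\<lambda>n. of_nat (\<nu> j) * (1 / \<eta> j (s (r n)) - 1 / \<eta> (\<sigma> j) T) / of_real (s (r n) - T))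
        \<longlonglongrightarrow> of_nat (\<nu> (\<sigma> j)) * p / \<eta> (\<sigma> j) T)"
      using pole_limits[OF T0 s0 sT] by blast
    define u where "u = (\<lambda>n. s (r n))"
    have u: "u n > T" "0 \<le> u n" for n using s(2) s0 by (auto simp: u_def)
    have fu: "filterlim u (at T within {0..}) sequentially"
      using u s0 LIMSEQ_subseq_LIMSEQ[OF sT r] by (auto simp: filterlim_at o_def u_def)
    have aT: "0 < a T" "0 < a' T" using a_pos[OF T0] loewner_function[OF T0] by blast+
    have "((\<lambda>s. a s powr \<kappa>) has_real_derivative \<kappa> * a T powr (\<kappa> - 1) * a' T) (at T within {0..})"
      by (rule DERIV_chain'[OF a_has_derivative[OF T0] has_real_derivative_powr[OF aT(1)]])
    then have "((\<lambda>s. (a s powr \<kappa> - a T powr \<kappa>) / (s - T)) \<longlongrightarrow> \<kappa> * a T powr (\<kappa> - 1) * a' T) (at T within {0..})"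
      by (simp add: has_field_derivative_iff)
    from filterlim_compose[OF this fu]
    have "(\<lambda>n. (a (u n) powr \<kappa> - a T powr \<kappa>) / (u n - T) / a T powr \<kappa>) \<longlonglongrightarrow> \<kappa> * a T powr (\<kappa> - 1) * a' T / a T powr \<kappa>"
      by (intro tendsto_intros) (use aT in auto)
    also have "\<kappa> * a T powr (\<kappa> - 1) * a' T / a T powr \<kappa> = \<kappa> * (a' T / a T)"
      using aT by (simp add: powr_diff)
    finally have wlim: "(\<lambda>n. (a (u n) powr \<kappa> - a T powr \<kappa>) / (u n - T) / a T powr \<kappa>) \<longlonglongrightarrow> \<kappa> * (a' T / a T)" .
    have "\<forall>\<^sub>F n in sequentially. norm (\<eta> j (u n)) * a (u n) powr \<kappa> \<le> D" if j: "j \<in> {1..l}" for j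
    proof -
      define i where "i = \<sigma> j"
      have i: "i \<in> {1..l}" using \<sigma> j by (auto simp: i_def)
      obtain p where p: "a' T / a T * ((1 - norm (\<eta> i T)) / (1 + norm (\<eta> i T))) \<le> Re p"
        and plim: "(\<lambda>n. of_nat (\<nu> j) * (1 / \<eta> j (u n) - 1 / \<eta> i T) / of_real (u n - T))
          \<longlonglongrightarrow> of_nat (\<nu> i) * p / \<eta> i T"
        using bspec[OF lim j] unfolding i_def u_def by blast
      have \<eta>i: "\<eta> i T \<noteq> 0" using eta_nonzero[OF T0 i] .
      have \<nu>j: "\<nu> j \<ge> 1" "\<nu> i \<ge> 1" using nu j i by auto
      have "real (\<nu> j) \<le> n"
      proof -
        have "\<nu> j \<le> sum \<nu> {1..l}" using j by (intro member_le_sum) auto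
        then show ?thesis unfolding n_def of_nat_le_iff by (rule le_SucI)
      qed
      then have ratio: "1 / n \<le> real (\<nu> i) / real (\<nu> j)" using \<nu>j n by (intro frac_le) auto
      \<comment> \<open>The relative velocity of the pole. Its limit has to exceed the relative
        growth rate \<kappa> a' / a of a^\<kappa>.\<close>
      define Y where "Y = (\<lambda>n. (1 / \<eta> j (u n) - 1 / \<eta> i T) / of_real (u n - T) * \<eta> i T)"
      have "(\<lambda>n. of_nat (\<nu> j) * (1 / \<eta> j (u n) - 1 / \<eta> i T) / of_real (u n - T) * (\<eta> i T / of_nat (\<nu> j)))
          \<longlonglongrightarrow> of_nat (\<nu> i) * p / \<eta> i T * (\<eta> i T / of_nat (\<nu> j))"
        by (intro tendsto_mult plim tendsto_const)
      then have "Y \<longlonglongrightarrow> of_real (real (\<nu> i) / real (\<nu> j)) * p"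
        using \<eta>i \<nu>j by (simp add: Y_def)
      then have "(\<lambda>n. Re (Y n)) \<longlonglongrightarrow> Re (of_real (real (\<nu> i) / real (\<nu> j)) * p)" by (rule tendsto_Re)
      then have Ylim: "(\<lambda>n. Re (Y n)) \<longlonglongrightarrow> real (\<nu> i) / real (\<nu> j) * Re p" by simp
      have \<eta>w: "norm (\<eta> i T) \<le> w" using good_le[OF goodT T0 i] .
      have "\<kappa> * (a' T / a T) < real (\<nu> i) / real (\<nu> j) * Re p"
      proof -
        have "(1 - w) / (1 + w) \<le> (1 - norm (\<eta> i T)) / (1 + norm (\<eta> i T))"
          using \<eta>w w1 w0 by (intro frac_le) (auto intro: add_pos_nonneg)
        then have "a' T / a T * ((1 - w) / (1 + w)) \<le> a' T / a T * ((1 - norm (\<eta> i T)) / (1 + norm (\<eta> i T)))"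
          using aT by (intro mult_left_mono) auto
        then have 1: "a' T / a T * ((1 - w) / (1 + w)) \<le> Re p" using p by simp
        have 0: "0 < a' T / a T * ((1 - w) / (1 + w))" using aT w1 w0 by simp
        define X where "X = a' T / a T * ((1 - w) / (1 + w))"
        have X: "X > 0" "X \<le> Re p" using 0 1 by (simp_all only: X_def)
        have "\<kappa> * (a' T / a T) = 1 / 2 * (1 / n * X)"
          by (simp add: \<kappa>_def X_def field_simps)
        also have "\<dots> < 1 / n * X"
        proof -
          have "0 < 1 / n * X" using X n by simp
          then show ?thesis by linarith
        qed
        also have "\<dots> \<le> real (\<nu> i) / real (\<nu> j) * Re p"
          using ratio X n by (intro mult_mono) auto
        finally show ?thesis .
      qed
      then have "0 < real (\<nu> i) / real (\<nu> j) * Re p - \<kappa> * (a' T / a T)" by simp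
      with tendsto_diff[OF Ylim wlim]
      have "\<forall>\<^sub>F n in sequentially. 0 < Re (Y n) - (a (u n) powr \<kappa> - a T powr \<kappa>) / (u n - T) / a T powr \<kappa>"
        by (rule order_tendstoD(1))
      then show ?thesis
      proof eventually_elim
        case (elim n)
        have \<tau>: "0 < u n - T" using u by simp
        have \<eta>j: "\<eta> j (u n) \<noteq> 0" using eta_nonzero[OF u(2) j] .
        have "\<eta> i T / \<eta> j (u n) = 1 + of_real (u n - T) * Y n"
          using \<tau> \<eta>i \<eta>j by (simp add: Y_def field_simps del: of_real_diff)
        then have Re: "Re (\<eta> i T / \<eta> j (u n)) = 1 + (u n - T) * Re (Y n)"
          by (simp del: of_real_diff)
        \<comment> \<open>Both quotients are expanded around 1. As a modulus is at least its real
          part, control of Re p alone suffices, and that is what Harnack supplies.\<close>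
        have "a (u n) powr \<kappa> / a T powr \<kappa> = 1 + (u n - T) * ((a (u n) powr \<kappa> - a T powr \<kappa>) / (u n - T) / a T powr \<kappa>)"
          using \<tau> aT by (simp add: field_simps)
        also have "\<dots> \<le> 1 + (u n - T) * Re (Y n)"
          using elim \<tau> by (intro add_left_mono mult_left_mono) auto
        also have "\<dots> \<le> norm (\<eta> i T / \<eta> j (u n))" unfolding Re[symmetric] by (rule complex_Re_le_cmod)
        also have "\<dots> = norm (\<eta> i T) / norm (\<eta> j (u n))" by (rule norm_divide)
        finally have "norm (\<eta> j (u n)) * a (u n) powr \<kappa> \<le> norm (\<eta> i T) * a T powr \<kappa>"
          using \<eta>j aT by (simp add: field_simps)
        also have "\<dots> \<le> D" using goodT i by (simp add: good_def)
        finally show ?case .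
      qed
    qed
    then have "\<forall>\<^sub>F n in sequentially. \<forall>j\<in>{1..l}. norm (\<eta> j (u n)) * a (u n) powr \<kappa> \<le> D"
      by (intro eventually_ball_finite) auto
    then have "\<forall>\<^sub>F n in sequentially. False"
    proof eventually_elim
      case (elim n)
      then have "good (u n)" by (simp add: good_def)
      then show ?case using s(1)[of "r n"] by (simp add: S_def u_def)
    qed
    then show False by simp
  qed
  then show ?thesis using \<kappa> w0 w1 unfolding good_def D_def
    by (intro exI[of _ \<kappa>] exI[of _ w]) auto
qed

end

subsection \<open>Taylor coefficients\<close>

lemma higher_deriv_poly_0: "(deriv ^^ k) (poly p) 0 = fact k * coeff p k" for p :: "complex poly"
proof (induction k arbitrary: p)
  case (Suc k)
  have "deriv (poly p) = poly (pderiv p)" by (auto intro!: DERIV_imp_deriv poly_DERIV)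
  then have "(deriv ^^ Suc k) (poly p) 0 = (deriv ^^ k) (poly (pderiv p)) 0"
    by (simp add: funpow_swap1)
  then show ?case by (simp add: Suc.IH coeff_pderiv algebra_simps)
qed (simp add: poly_0_coeff_0)

lemma taylor_coeff_poly: "taylor_coeff (poly p) k = coeff p k"
  by (simp add: taylor_coeff_def higher_deriv_poly_0)

lemma taylor_coeff_deriv: "taylor_coeff (deriv F) k = of_nat (Suc k) * taylor_coeff F (Suc k)"
proof -
  have "of_nat (Suc k) \<noteq> (0::complex)" by (simp only: of_nat_eq_0_iff)
  then show ?thesis by (simp add: taylor_coeff_def funpow_swap1 fact_Suc del: of_nat_Suc)
qed

lemma taylor_coeff_mult_poly:
  assumes h: "h holomorphic_on ball 0 \<rho>" "0 < \<rho>"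
  shows "taylor_coeff (\<lambda>w. poly p w * h w) k = (\<Sum>i=0..k. coeff p i * taylor_coeff h (k - i))"
proof -
  have "(deriv ^^ k) (\<lambda>w. poly p w * h w) 0 =
      (\<Sum>i=0..k. of_nat (k choose i) * (deriv ^^ i) (poly p) 0 * (deriv ^^ (k - i)) h 0)"
    by (rule higher_deriv_mult[OF _ h(1) open_ball]) (use h in \<open>auto intro!: holomorphic_intros\<close>)
  also have "\<dots> = (\<Sum>i=0..k. fact k * (coeff p i * taylor_coeff h (k - i)))"
    by (intro sum.cong refl) (simp add: higher_deriv_poly_0 taylor_coeff_def binomial_fact)
  finally have "(deriv ^^ k) (\<lambda>w. poly p w * h w) 0 = fact k * (\<Sum>i=0..k. coeff p i * taylor_coeff h (k - i))"
    by (simp only: sum_distrib_left)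
  then show ?thesis unfolding taylor_coeff_def[of "\<lambda>w. poly p w * h w"] by simp
qed

lemma taylor_coeff_cong:
  assumes "open S" "0 \<in> S" "F holomorphic_on S" "\<And>z. z \<in> S \<Longrightarrow> F z = G z"
  shows "taylor_coeff F k = taylor_coeff G k"
proof -
  have "G holomorphic_on S" using assms holomorphic_transform by blast
  then show ?thesis
    unfolding taylor_coeff_def using higher_deriv_transform_within_open[OF assms(3) _ assms(1,2,4)] by metis
qed

lemma norm_taylor_coeff_le:
  assumes "h holomorphic_on ball 0 r" "continuous_on (cball 0 r) h" "0 < r"
    "\<And>x. norm x = r \<Longrightarrow> norm (h x) \<le> C"
  shows "norm (taylor_coeff h k) \<le> C / r ^ k"
  using Cauchy_inequality[OF assms(1-3), of C k] assms(4)
  by (simp add: taylor_coeff_def norm_divide field_simps)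

text \<open>Cauchy's inequality on the unit circle, where each linear factor is at most 2 in
  modulus. The bound is independent of the poles, hence of time.\<close>

lemma norm_coeff_lin_prod_le:
  assumes "finite J" "\<And>j. j \<in> J \<Longrightarrow> norm (\<eta> j) \<le> 1"
  shows "norm (coeff (lin_prod \<eta> \<nu> J) i) \<le> 2 ^ sum \<nu> J"
proof -
  have "norm (taylor_coeff (poly (lin_prod \<eta> \<nu> J)) i) \<le> 2 ^ sum \<nu> J / 1 ^ i"
  proof (rule norm_taylor_coeff_le)
    fix x :: complex assume x: "norm x = 1"
    have "norm (1 - \<eta> j * x) \<le> 2" if "j \<in> J" for j
      using norm_triangle_ineq4[of 1 "\<eta> j * x"] assms(2)[OF that] x by (simp add: norm_mult)
    then have "norm (poly (lin_prod \<eta> \<nu> J) x) \<le> (\<Prod>j\<in>J. 2 ^ \<nu> j)"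
      unfolding poly_lin_prod prod_norm[symmetric] by (intro prod_mono) (auto simp: norm_power intro!: power_mono)
    then show "norm (poly (lin_prod \<eta> \<nu> J) x) \<le> 2 ^ sum \<nu> J" by (simp add: power_sum)
  qed (auto intro!: holomorphic_intros continuous_intros)
  then show ?thesis by (simp add: taylor_coeff_poly)
qed

text \<open>Bounds the factor (n + j)! / n! produced by j differentiations of a power by the weight
  of \<open>taylor_tail\<close>.\<close>

lemma fact_add_le: "fact (n + j) \<le> fact n * (n + j) ^ j" for n j :: nat
proof (induction j)
  case (Suc j)
  have "fact (n + Suc j) = (n + Suc j) * fact (n + j)" by simp
  also have "\<dots> \<le> (n + Suc j) * (fact n * (n + j) ^ j)" by (intro mult_left_mono Suc.IH) auto
  also have "\<dots> \<le> (n + Suc j) * (fact n * (n + Suc j) ^ j)"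
    by (intro mult_left_mono power_mono) auto
  finally show ?case by (simp add: algebra_simps)
qed simp

text \<open>The weight k^j dominates what j differentiations produce, so one series controls the
  j-th derivative of the remainder; j = 1 controls \<open>f\<close> and \<open>f'\<close> together.
  Summing over all k with default 0 avoids index shifts.\<close>

definition taylor_tail :: "(complex \<Rightarrow> complex) \<Rightarrow> nat \<Rightarrow> nat \<Rightarrow> real" where
  "taylor_tail F N j = (\<Sum>k. if N < k then real k ^ j * norm (taylor_coeff F k) else 0)"

definition taylor_summable :: "(complex \<Rightarrow> complex) \<Rightarrow> nat \<Rightarrow> bool" where
  "taylor_summable F j \<longleftrightarrow> summable (\<lambda>k. real k ^ j * norm (taylor_coeff F k))"

lemma taylor_tail_summable:
  assumes "taylor_summable F j"
  shows "summable (\<lambda>k. if N < k then real k ^ j * norm (taylor_coeff F k) else 0)"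
  by (rule summable_comparison_test'[OF assms[unfolded taylor_summable_def], of 0]) auto

lemma taylor_tail_nonneg:
  assumes "taylor_summable F j"
  shows "0 \<le> taylor_tail F N j"
  unfolding taylor_tail_def by (rule suminf_nonneg[OF taylor_tail_summable[OF assms]]) auto

lemma taylor_tail_Suc:
  assumes "taylor_summable F j"
  shows "taylor_tail F N j = real (Suc N) ^ j * norm (taylor_coeff F (Suc N)) + taylor_tail F (Suc N) j"
proof -
  let ?g = "\<lambda>N k. if N < k then real k ^ j * norm (taylor_coeff F k) else 0"
  have eq: "?g N = (\<lambda>k. (if k = Suc N then real k ^ j * norm (taylor_coeff F k) else 0) + ?g (Suc N) k)"
    by (auto simp: fun_eq_iff)
  have s: "(\<lambda>k. if k = Suc N then real k ^ j * norm (taylor_coeff F k) else 0) sums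
      (real (Suc N) ^ j * norm (taylor_coeff F (Suc N)))"
    by (rule sums_single)
  show ?thesis
    unfolding taylor_tail_def eq suminf_add[OF sums_summable[OF s] taylor_tail_summable[OF assms], symmetric]
    using sums_unique[OF s] by simp
qed

lemma taylor_tail_mono:
  assumes "taylor_summable F j'" "j \<le> j'"
  shows "taylor_summable F j" "taylor_tail F N j \<le> taylor_tail F N j'"
proof -
  have le: "real k ^ j * norm (taylor_coeff F k) \<le> real k ^ j' * norm (taylor_coeff F k)" if "k > 0" for k
    using that assms(2) by (intro mult_right_mono power_increasing) auto
  show s: "taylor_summable F j"
    unfolding taylor_summable_def
    by (rule summable_comparison_test'[OF assms(1)[unfolded taylor_summable_def], of 1]) (use le in auto)
  show "taylor_tail F N j \<le> taylor_tail F N j'"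
    unfolding taylor_tail_def
    by (intro suminf_le taylor_tail_summable s assms) (use le in auto)
qed

lemma taylor_section_eq_poly:
  "taylor_section F N = poly (\<Sum>j=1..N. monom (taylor_coeff F j) j)"
  by (auto simp: taylor_section_def poly_sum poly_monom fun_eq_iff)

lemma taylor_section_holomorphic: "taylor_section F N holomorphic_on S"
  unfolding taylor_section_eq_poly by (intro holomorphic_intros)

lemma taylor_coeff_section:
  "taylor_coeff (taylor_section F N) k = (if 1 \<le> k \<and> k \<le> N then taylor_coeff F k else 0)"
  unfolding taylor_section_eq_poly taylor_coeff_poly by (simp add: coeff_sum)

lemma taylor_coeff_section_diff:
  assumes "F holomorphic_on ball 0 \<rho>" "0 < \<rho>" "F 0 = 0"
  shows "taylor_coeff (\<lambda>w. taylor_section F N w - F w) k = (if N < k then - taylor_coeff F k else 0)"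
proof -
  have "(deriv ^^ k) (\<lambda>w. taylor_section F N w - F w) 0 = (deriv ^^ k) (taylor_section F N) 0 - (deriv ^^ k) F 0"
    by (rule higher_deriv_diff[OF taylor_section_holomorphic assms(1)]) (use assms in auto)
  then have "taylor_coeff (\<lambda>w. taylor_section F N w - F w) k = taylor_coeff (taylor_section F N) k - taylor_coeff F k"
    by (simp add: taylor_coeff_def diff_divide_distrib)
  moreover have "taylor_coeff F 0 = 0" using assms(3) by (simp add: taylor_coeff_def)
  ultimately show ?thesis by (cases "k = 0") (auto simp: taylor_coeff_section)
qed

text \<open>The difference of section and function has the coefficients of -F beyond
  \<open>N\<close> and zeros before, the constant term included because F(0) = 0. Its differentiated
  power series is then estimated termwise on the closed disk.\<close>

lemma section_diff_le_tail:
  assumes F: "F holomorphic_on ball 0 \<rho>" "1 < \<rho>" "F 0 = 0" and s: "taylor_summable F j" and \<zeta>: "norm \<zeta> \<le> 1"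
  shows "norm ((deriv ^^ j) (taylor_section F N) \<zeta> - (deriv ^^ j) F \<zeta>) \<le> taylor_tail F N j"
proof -
  define H where "H = (\<lambda>w. taylor_section F N w - F w)"
  have H: "H holomorphic_on ball 0 \<rho>" unfolding H_def by (intro holomorphic_intros F taylor_section_holomorphic)
  have \<zeta>in: "\<zeta> \<in> ball 0 \<rho>" using \<zeta> F by simp
  have Hj: "(deriv ^^ j) H holomorphic_on ball 0 \<rho>" by (rule holomorphic_higher_deriv[OF H open_ball])
  have "(deriv ^^ j) (taylor_section F N) \<zeta> - (deriv ^^ j) F \<zeta> = (deriv ^^ j) H \<zeta>"
    unfolding H_def by (rule higher_deriv_diff[symmetric, OF taylor_section_holomorphic F(1) open_ball \<zeta>in])
  let ?g = "\<lambda>k. if N < k then real k ^ j * norm (taylor_coeff F k) else 0"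
  let ?u = "\<lambda>n. (deriv ^^ n) ((deriv ^^ j) H) 0 / fact n * (\<zeta> - 0) ^ n"
  have sums: "?u sums (deriv ^^ j) H \<zeta>"
    by (rule holomorphic_power_series[OF Hj \<zeta>in])
  have sg: "summable ?g" by (rule taylor_tail_summable[OF s])
  then have sg': "summable (\<lambda>n. ?g (n + j))" by (rule summable_ignore_initial_segment)
  have le: "norm (?u n) \<le> ?g (n + j)" for n
  proof -
    have "(deriv ^^ n) ((deriv ^^ j) H) 0 = fact (n + j) * taylor_coeff H (n + j)"
      by (simp add: taylor_coeff_def funpow_add)
    then have "norm (?u n) = fact (n + j) * norm (taylor_coeff H (n + j)) / fact n * norm \<zeta> ^ n"
      by (simp add: norm_mult norm_divide norm_power)
    also have "\<dots> \<le> fact (n + j) * norm (taylor_coeff H (n + j)) / fact n * 1"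
      using \<zeta> by (intro mult_left_mono power_le_one) auto
    also have "\<dots> = fact (n + j) / fact n * norm (taylor_coeff H (n + j))" by simp
    also have "\<dots> \<le> real (n + j) ^ j * norm (taylor_coeff H (n + j))"
    proof (intro mult_right_mono)
      have "real (fact (n + j)) \<le> real (fact n * (n + j) ^ j)" using fact_add_le by (intro of_nat_mono)
      then show "fact (n + j) / fact n \<le> real (n + j) ^ j" by (simp add: divide_le_eq mult.commute)
    qed simp
    also have "\<dots> = ?g (n + j)"
      unfolding H_def using taylor_coeff_section_diff[OF F(1) _ F(3)] F(2) by simp
    finally show ?thesis .
  qed
  have "norm ((deriv ^^ j) H \<zeta>) \<le> (\<Sum>n. ?g (n + j))"
    using norm_suminf_le[OF le sg'] sums_unique[OF sums] by simp
  also have "\<dots> \<le> (\<Sum>n. ?g n)"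
    using suminf_split_initial_segment[OF sg, of j] by (simp add: sum_nonneg)
  finally show ?thesis
    using \<open>(deriv ^^ j) (taylor_section F N) \<zeta> - (deriv ^^ j) F \<zeta> = (deriv ^^ j) H \<zeta>\<close>
    by (simp add: taylor_tail_def)
qed

lemma section_error_le_tail:
  assumes F: "F holomorphic_on ball 0 \<rho>" "1 < \<rho>" "F 0 = 0" and s: "taylor_summable F j"
  shows "0 \<le> section_error F N j" "section_error F N j \<le> taylor_tail F N j"
proof -
  let ?h = "\<lambda>\<zeta>. norm ((deriv ^^ j) (taylor_section F N) \<zeta> - (deriv ^^ j) F \<zeta>)"
  have le: "?h \<zeta> \<le> taylor_tail F N j" if "\<zeta> \<in> cball 0 1" for \<zeta>
    using section_diff_le_tail[OF F s] that by simp
  show "section_error F N j \<le> taylor_tail F N j"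
    unfolding section_error_def by (rule cSUP_least) (use le in auto)
  have "bdd_above (?h ` cball 0 1)" using le by (intro bdd_aboveI[of _ "taylor_tail F N j"]) auto
  then show "0 \<le> section_error F N j"
    unfolding section_error_def by (rule cSUP_upper2[of _ _ 0]) auto
qed

lemma circle_avg_taylor:
  assumes "h holomorphic_on ball 0 \<rho>" "1 < \<rho>"
  shows "circle_avg (\<lambda>\<zeta>. h \<zeta> * cnj \<zeta> ^ k) = taylor_coeff h k"
proof -
  have h: "h holomorphic_on cball 0 1" using assms by (auto intro: holomorphic_on_subset)
  have "contour_integral (circlepath 0 1) (\<lambda>u. h u / (u - 0) ^ Suc k) = 2 * pi * \<i> * (deriv ^^ k) h 0 / fact k"
    by (rule Cauchy_contour_integral_circlepath)
      (use h in \<open>auto intro: holomorphic_on_subset holomorphic_on_imp_continuous_on\<close>)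
  then have "taylor_coeff h k = 1 / (2 * of_real pi * \<i>) * contour_integral (circlepath 0 1) (\<lambda>u. h u / u ^ Suc k)"
    by (simp add: taylor_coeff_def)
  also have "\<dots> = circle_avg (\<lambda>\<zeta>. \<zeta> * (h \<zeta> / \<zeta> ^ Suc k))" by (rule contour_integral_eq_circle_avg)
  also have "\<dots> = circle_avg (\<lambda>\<zeta>. h \<zeta> * cnj \<zeta> ^ k)"
  proof (rule circle_avg_cong)
    fix \<zeta> :: complex assume n: "norm \<zeta> = 1"
    then have z: "\<zeta> \<noteq> 0" by auto
    have "\<zeta> * cnj \<zeta> = 1" using n by (simp add: complex_norm_square[symmetric])
    then have "cnj \<zeta> = 1 / \<zeta>" using z by (simp add: field_simps)
    then show "\<zeta> * (h \<zeta> / \<zeta> ^ Suc k) = h \<zeta> * cnj \<zeta> ^ k" using z by (simp add: power_divide)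
  qed
  finally show ?thesis ..
qed

text \<open>Applied with u = F / \<zeta> and v = F', which are both close to the leading coefficient
  when the tail is small.\<close>

lemma norm_power_mult_diff_le:
  fixes u v :: complex
  assumes "0 \<le> a" "0 \<le> e" "norm (u - of_real a) \<le> a * e" "norm (v - of_real a) \<le> a * e"
  shows "norm (u ^ k * v - of_real a ^ Suc k) \<le> a ^ Suc k * ((1 + e) ^ Suc k - 1)"
proof (induction k)
  case 0 then show ?case using assms by simp
next
  case (Suc k)
  have un: "norm u \<le> a * (1 + e)"
    using norm_triangle_ineq2[of u "of_real a"] assms by (simp add: algebra_simps)
  have "u ^ Suc k * v - of_real a ^ Suc (Suc k) = u * (u ^ k * v - of_real a ^ Suc k) + of_real a ^ Suc k * (u - of_real a)"
    by (simp add: algebra_simps)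
  also have "norm \<dots> \<le> norm u * norm (u ^ k * v - of_real a ^ Suc k) + norm (of_real a ^ Suc k :: complex) * norm (u - of_real a)"
    by (metis norm_mult norm_triangle_ineq)
  also have "\<dots> \<le> (a * (1 + e)) * (a ^ Suc k * ((1 + e) ^ Suc k - 1)) + a ^ Suc k * (a * e)"
    using Suc.IH un assms by (intro add_mono mult_mono) (auto simp: norm_power norm_mult)
  also have "\<dots> = a ^ Suc (Suc k) * ((1 + e) ^ Suc (Suc k) - 1)"
    by (simp add: algebra_simps)
  finally show ?case .
qed

text \<open>Writing F = \<zeta> u, the moment is the mean of \<zeta>^(k+1) u^k F' times the
  conjugate of F. The section of degree k + 1 in the conjugated factor yields the main term exactly.
  The error is a product of two small quantities: the deviation of u^k F' from a^(k+1), and the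
  remainder beyond k + 1. The extra small factor makes the later limits work.\<close>

lemma moment_coefficient_estimate:
  assumes F: "F holomorphic_on ball 0 \<rho>" "1 < \<rho>" "F 0 = 0" and a: "deriv F 0 = of_real a" "0 < a"
    and s: "taylor_summable F 1"
  defines "e \<equiv> \<lambda>N. taylor_tail F N 1 / a"
  shows "norm (circle_avg (\<lambda>\<zeta>. \<zeta> * (F \<zeta> ^ k * cnj (F \<zeta>) * deriv F \<zeta>)) - of_real a ^ Suc k * cnj (taylor_coeff F (Suc k)))
    \<le> a ^ (k + 2) * (((1 + e 1) ^ Suc k - 1) * e (Suc k))"
proof -
  have s0: "taylor_summable F 0" and tail01: "\<And>N. taylor_tail F N 0 \<le> taylor_tail F N 1"
    using taylor_tail_mono[OF s, of 0] by auto
  have e0: "0 \<le> e N" for N unfolding e_def using taylor_tail_nonneg[OF s] a by simp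
  define S where "S = taylor_section F (Suc k)"
  define R where "R = (\<lambda>w. S w - F w)"
  have Sh: "S holomorphic_on ball 0 \<rho>" unfolding S_def by (rule taylor_section_holomorphic)
  have Rh: "R holomorphic_on ball 0 \<rho>" unfolding R_def by (intro holomorphic_intros Sh F)
  define u where "u = (\<lambda>\<zeta>. if \<zeta> = 0 then deriv F 0 else (F \<zeta> - F 0) / (\<zeta> - 0))"
  have uh: "u holomorphic_on ball 0 \<rho>" unfolding u_def by (rule pole_lemma_open[OF F(1) open_ball])
  have Fu: "F \<zeta> = \<zeta> * u \<zeta>" for \<zeta> using F(3) by (simp add: u_def)
  have dFh: "deriv F holomorphic_on ball 0 \<rho>" using F by (intro holomorphic_deriv) auto
  define \<Phi> where "\<Phi> = (\<lambda>\<zeta>. u \<zeta> ^ k * deriv F \<zeta>)"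
  have \<Phi>h: "\<Phi> holomorphic_on ball 0 \<rho>" unfolding \<Phi>_def by (intro holomorphic_intros uh dFh)
  have \<Phi>0: "\<Phi> 0 = of_real a ^ Suc k" using a by (simp add: \<Phi>_def u_def)
  have cont: "continuous_on (sphere 0 1) h" if "h holomorphic_on ball 0 \<rho>" for h
    by (rule holomorphic_on_imp_continuous_on[OF holomorphic_on_subset[OF that]]) (use F in auto)
  note cs = cont[OF Sh] cont[OF Rh] cont[OF \<Phi>h] cont[OF F(1)]
  have c\<zeta>: "\<zeta> * cnj \<zeta> = 1" if "norm \<zeta> = 1" for \<zeta>
    using that by (simp add: complex_norm_square[symmetric])
  \<comment> \<open>On the circle \<zeta>^(k+1) cancels every conjugate power up to degree k + 1, so
    the integrand is holomorphic and its mean is its value at 0, where only the top coefficient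
    survives.\<close>
  have 1: "circle_avg (\<lambda>\<zeta>. \<zeta> ^ Suc k * \<Phi> \<zeta> * cnj (S \<zeta>)) = of_real a ^ Suc k * cnj (taylor_coeff F (Suc k))"
  proof -
    have "circle_avg (\<lambda>\<zeta>. \<zeta> ^ Suc k * \<Phi> \<zeta> * cnj (S \<zeta>)) =
        circle_avg (\<lambda>\<zeta>. (\<Sum>j=1..Suc k. cnj (taylor_coeff F j) * \<zeta> ^ (Suc k - j)) * \<Phi> \<zeta>)"
    proof (rule circle_avg_cong)
      fix \<zeta> :: complex assume n: "norm \<zeta> = 1"
      have "\<zeta> ^ Suc k * cnj \<zeta> ^ j = \<zeta> ^ (Suc k - j)" if "j \<in> {1..Suc k}" for j
      proof -
        have "\<zeta> ^ Suc k = \<zeta> ^ (Suc k - j) * \<zeta> ^ j" using that by (simp add: power_add[symmetric])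
        then have "\<zeta> ^ Suc k * cnj \<zeta> ^ j = \<zeta> ^ (Suc k - j) * (\<zeta> * cnj \<zeta>) ^ j" by (simp only: power_mult_distrib mult.assoc)
        then show ?thesis using c\<zeta>[OF n] by simp
      qed
      then have "(\<Sum>j=1..Suc k. cnj (taylor_coeff F j) * (\<zeta> ^ Suc k * cnj \<zeta> ^ j)) = (\<Sum>j=1..Suc k. cnj (taylor_coeff F j) * \<zeta> ^ (Suc k - j))"
        by (intro sum.cong refl) (simp only:)
      moreover have "\<zeta> ^ Suc k * cnj (S \<zeta>) = (\<Sum>j=1..Suc k. cnj (taylor_coeff F j) * (\<zeta> ^ Suc k * cnj \<zeta> ^ j))"
        unfolding S_def taylor_section_def cnj_sum sum_distrib_left by (intro sum.cong refl) (simp add: mult_ac)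
      ultimately show "\<zeta> ^ Suc k * \<Phi> \<zeta> * cnj (S \<zeta>) = (\<Sum>j=1..Suc k. cnj (taylor_coeff F j) * \<zeta> ^ (Suc k - j)) * \<Phi> \<zeta>"
        by (metis mult.assoc mult.commute)
    qed
    also have "\<dots> = (\<Sum>j=1..Suc k. cnj (taylor_coeff F j) * 0 ^ (Suc k - j)) * \<Phi> 0"
      by (rule circle_avg_holomorphic[OF _ F(2)]) (intro holomorphic_intros \<Phi>h)
    also have "(\<Sum>j=1..Suc k. cnj (taylor_coeff F j) * 0 ^ (Suc k - j)) = (\<Sum>j=1..Suc k. if j = Suc k then cnj (taylor_coeff F (Suc k)) else 0)"
      by (intro sum.cong refl) (auto simp: power_0_left)
    also have "\<dots> = cnj (taylor_coeff F (Suc k))" by (subst sum.delta) auto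
    finally show ?thesis by (simp add: \<Phi>0)
  qed
  \<comment> \<open>The constant part of \<open>\<Phi>\<close> pairs with the coefficient of
    \<open>R\<close> of index k + 1, which is 0 because \<open>R\<close> starts later. It may
    therefore be subtracted from \<open>\<Phi>\<close> at no cost.\<close>
  have 2: "circle_avg (\<lambda>\<zeta>. \<zeta> ^ Suc k * of_real a ^ Suc k * cnj (R \<zeta>)) = 0"
  proof -
    have "circle_avg (\<lambda>\<zeta>. \<zeta> ^ Suc k * of_real a ^ Suc k * cnj (R \<zeta>)) =
        circle_avg (\<lambda>\<zeta>. of_real a ^ Suc k * cnj (R \<zeta> * cnj \<zeta> ^ Suc k))"
      by (rule circle_avg_cong) (simp add: mult_ac)
    also have "\<dots> = of_real a ^ Suc k * cnj (taylor_coeff R (Suc k))"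
      unfolding circle_avg_cmult circle_avg_cnj circle_avg_taylor[OF Rh F(2)] ..
    also have "taylor_coeff R (Suc k) = 0"
      unfolding R_def S_def using taylor_coeff_section_diff[OF F(1) _ F(3)] F(2) by simp
    finally show ?thesis by simp
  qed
  have "circle_avg (\<lambda>\<zeta>. \<zeta> * (F \<zeta> ^ k * cnj (F \<zeta>) * deriv F \<zeta>)) =
      circle_avg (\<lambda>\<zeta>. \<zeta> ^ Suc k * \<Phi> \<zeta> * cnj (S \<zeta>) - \<zeta> ^ Suc k * \<Phi> \<zeta> * cnj (R \<zeta>))"
    by (rule circle_avg_cong) (simp add: \<Phi>_def R_def Fu power_mult_distrib algebra_simps)
  also have "\<dots> = of_real a ^ Suc k * cnj (taylor_coeff F (Suc k)) - circle_avg (\<lambda>\<zeta>. \<zeta> ^ Suc k * \<Phi> \<zeta> * cnj (R \<zeta>))"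
    by (subst circle_avg_diff) (auto intro!: continuous_intros continuous_on_cnj cs simp: 1[simplified])
  also have "circle_avg (\<lambda>\<zeta>. \<zeta> ^ Suc k * \<Phi> \<zeta> * cnj (R \<zeta>)) =
      circle_avg (\<lambda>\<zeta>. \<zeta> ^ Suc k * \<Phi> \<zeta> * cnj (R \<zeta>) - \<zeta> ^ Suc k * of_real a ^ Suc k * cnj (R \<zeta>))"
    by (subst circle_avg_diff) (auto intro!: continuous_intros continuous_on_cnj cs simp: 2[simplified])
  finally have "norm (circle_avg (\<lambda>\<zeta>. \<zeta> * (F \<zeta> ^ k * cnj (F \<zeta>) * deriv F \<zeta>)) - of_real a ^ Suc k * cnj (taylor_coeff F (Suc k))) =
      norm (circle_avg (\<lambda>\<zeta>. \<zeta> ^ Suc k * \<Phi> \<zeta> * cnj (R \<zeta>) - \<zeta> ^ Suc k * of_real a ^ Suc k * cnj (R \<zeta>)))"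
    by simp
  also have "\<dots> \<le> a ^ (k + 2) * (((1 + e 1) ^ Suc k - 1) * e (Suc k))"
  proof (rule norm_circle_avg_le)
    show "continuous_on (sphere 0 1) (\<lambda>\<zeta>. \<zeta> ^ Suc k * \<Phi> \<zeta> * cnj (R \<zeta>) - \<zeta> ^ Suc k * of_real a ^ Suc k * cnj (R \<zeta>))"
      by (intro continuous_intros continuous_on_cnj cs)
    fix \<zeta> :: complex assume n: "norm \<zeta> = 1"
    then have \<zeta>0: "\<zeta> \<noteq> 0" by auto
    have c1: "taylor_coeff F 1 = of_real a" using a by (simp add: taylor_coeff_def)
    have sec1: "taylor_section F 1 = (\<lambda>w. of_real a * w)" using c1 by (simp add: taylor_section_def fun_eq_iff)
    have "norm (of_real a * \<zeta> - F \<zeta>) \<le> taylor_tail F 1 0"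
      using section_diff_le_tail[OF F s0, of \<zeta> 1] n sec1 by simp
    also have "\<dots> \<le> a * e 1" using tail01[of 1] a by (simp add: e_def)
    finally have "norm (of_real a * \<zeta> - F \<zeta>) \<le> a * e 1" .
    moreover have "norm (u \<zeta> - of_real a) = norm (of_real a * \<zeta> - F \<zeta>)"
    proof -
      have "of_real a * \<zeta> - F \<zeta> = - (\<zeta> * (u \<zeta> - of_real a))" by (simp add: Fu algebra_simps)
      then show ?thesis using n by (simp add: norm_mult)
    qed
    ultimately have ub: "norm (u \<zeta> - of_real a) \<le> a * e 1" by simp
    have "deriv (\<lambda>w. of_real a * w) \<zeta> = of_real a" by (intro DERIV_imp_deriv) (auto intro!: derivative_eq_intros)
    then have "norm (of_real a - deriv F \<zeta>) \<le> taylor_tail F 1 1"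
      using section_diff_le_tail[OF F s, of \<zeta> 1] n sec1 by simp
    then have vb: "norm (deriv F \<zeta> - of_real a) \<le> a * e 1" using a by (simp add: e_def norm_minus_commute)
    have \<Phi>b: "norm (\<Phi> \<zeta> - of_real a ^ Suc k) \<le> a ^ Suc k * ((1 + e 1) ^ Suc k - 1)"
      unfolding \<Phi>_def by (rule norm_power_mult_diff_le[OF _ e0 ub vb]) (use a in simp)
    have "norm (R \<zeta>) \<le> taylor_tail F (Suc k) 0"
      using section_diff_le_tail[OF F s0, of \<zeta> "Suc k"] n by (simp add: R_def S_def)
    also have "\<dots> \<le> a * e (Suc k)" using tail01[of "Suc k"] a by (simp add: e_def)
    finally have Rb: "norm (R \<zeta>) \<le> a * e (Suc k)" .
    have "norm (\<zeta> ^ Suc k * \<Phi> \<zeta> * cnj (R \<zeta>) - \<zeta> ^ Suc k * of_real a ^ Suc k * cnj (R \<zeta>)) = norm (\<Phi> \<zeta> - of_real a ^ Suc k) * norm (R \<zeta>)"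
    proof -
      have "\<zeta> ^ Suc k * \<Phi> \<zeta> * cnj (R \<zeta>) - \<zeta> ^ Suc k * of_real a ^ Suc k * cnj (R \<zeta>) = \<zeta> ^ Suc k * ((\<Phi> \<zeta> - of_real a ^ Suc k) * cnj (R \<zeta>))"
        by (simp only: algebra_simps)
      then show ?thesis by (simp only: norm_mult norm_power n power_one mult_1 complex_mod_cnj)
    qed
    also have "\<dots> \<le> (a ^ Suc k * ((1 + e 1) ^ Suc k - 1)) * (a * e (Suc k))"
      using \<Phi>b Rb order_trans[OF norm_ge_zero \<Phi>b] by (intro mult_mono) auto
    also have "\<dots> = a ^ (k + 2) * (((1 + e 1) ^ Suc k - 1) * e (Suc k))"
      by (simp add: algebra_simps)
    finally show "norm (\<zeta> ^ Suc k * \<Phi> \<zeta> * cnj (R \<zeta>) - \<zeta> ^ Suc k * of_real a ^ Suc k * cnj (R \<zeta>)) \<le> a ^ (k + 2) * (((1 + e 1) ^ Suc k - 1) * e (Suc k))" .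
  qed
  finally show ?thesis .
qed

subsection \<open>Asymptotics of the coefficients\<close>

lemma summable_power_over_two_power: "summable (\<lambda>k. real k ^ j / 2 ^ k)"
proof (rule root_test_convergence[where x = "1/2"])
  have "(\<lambda>n. root n (real n) ^ j / 2) \<longlonglongrightarrow> 1 ^ j / 2"
    by (intro tendsto_intros LIMSEQ_root) auto
  moreover have "\<forall>\<^sub>F n in sequentially. root n (real n) ^ j / 2 = root n (norm (real n ^ j / 2 ^ n))"
    using eventually_gt_at_top[of 0]
  proof eventually_elim
    case (elim n)
    have "root n (norm (real n ^ j / 2 ^ n)) = root n (real n ^ j) / root n (2 ^ n)"
      by (simp add: real_root_divide norm_divide norm_power)
    also have "\<dots> = root n (real n) ^ j / 2" using elim by (simp add: real_root_power real_root_power_cancel)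
    finally show ?case ..
  qed
  ultimately show "(\<lambda>n. root n (norm (real n ^ j / 2 ^ n))) \<longlonglongrightarrow> 1/2"
    using Lim_transform_eventually by fastforce
qed simp

context rational_solution
begin

text \<open>The condition |\<eta>_j| r \<le> w keeps each denominator factor at least 1 - w on the
  disk of radius r, while every numerator factor is at most 1 + r.\<close>

lemma coefficient_estimate:
  assumes t: "0 \<le> t" and r: "0 < r" and w: "w < 1" "\<And>j. j \<in> {1..l} \<Longrightarrow> norm (\<eta> j t) * r \<le> w"
  shows "real (Suc k) * norm (taylor_coeff (f t) (Suc k)) \<le> a t * (1 + r) ^ m / (1 - w) ^ sum \<nu> {1..l} / r ^ k"
    and "r = 1 \<Longrightarrow> norm \<zeta> = 1 \<Longrightarrow> norm (deriv (f t) \<zeta>) \<le> a t * (1 + r) ^ m / (1 - w) ^ sum \<nu> {1..l}"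
proof -
  define G where "G = (\<lambda>\<zeta>. of_real (a t) * poly (A t) \<zeta> / poly (B t) \<zeta>)"
  have Ble: "1 - w \<le> norm (1 - \<eta> j t * x)" if "j \<in> {1..l}" "norm x \<le> r" for j x
  proof -
    have "norm (\<eta> j t * x) \<le> norm (\<eta> j t) * r" unfolding norm_mult using that by (intro mult_left_mono) auto
    also have "\<dots> \<le> w" using w that by blast
    finally show ?thesis using norm_triangle_ineq2[of 1 "\<eta> j t * x"] by simp
  qed
  have Bnz: "poly (B t) x \<noteq> 0" if "norm x \<le> r" for x
  proof (rule poly_lin_prod_nonzero)
    fix j assume "j \<in> {1..l}"
    from Ble[OF this that] w show "1 - \<eta> j t * x \<noteq> 0" by auto
  qed simp
  have Gb: "norm (G x) \<le> a t * (1 + r) ^ m / (1 - w) ^ sum \<nu> {1..l}" if x: "norm x = r" for x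
  proof -
    have "norm (1 - \<theta> k t * x) \<le> 1 + r" if "k \<in> {1..m}" for k
    proof -
      have "norm (\<theta> k t * x) \<le> 1 * r" unfolding norm_mult x using norm_theta[OF t that] r by (intro mult_right_mono) auto
      then show ?thesis using norm_triangle_ineq4[of 1 "\<theta> k t * x"] by simp
    qed
    then have "norm (poly (A t) x) \<le> (\<Prod>k\<in>{1..m}. 1 + r)"
      unfolding poly_lin_prod prod_norm[symmetric] by (intro prod_mono) auto
    then have A1: "norm (poly (A t) x) \<le> (1 + r) ^ m" by simp
    have "(\<Prod>j\<in>{1..l}. (1 - w) ^ \<nu> j) \<le> norm (poly (B t) x)"
      unfolding poly_lin_prod prod_norm[symmetric] using w Ble x
      by (intro prod_mono) (auto simp: norm_power intro!: power_mono)
    then have B1: "(1 - w) ^ sum \<nu> {1..l} \<le> norm (poly (B t) x)" by (simp add: power_sum)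
    have "norm (G x) = a t * norm (poly (A t) x) / norm (poly (B t) x)"
      unfolding G_def norm_divide norm_mult using a_pos[OF t] by simp
    also have "\<dots> \<le> a t * (1 + r) ^ m / (1 - w) ^ sum \<nu> {1..l}"
      using A1 B1 w a_pos[OF t] r by (intro frac_le mult_left_mono mult_nonneg_nonneg) auto
    finally show ?thesis .
  qed
  have Gh: "G holomorphic_on cball 0 r" unfolding G_def using Bnz by (intro holomorphic_intros) auto
  have eq: "deriv (f t) x = G x" if "norm x \<le> 1" for x
    using form[OF t that] B_nonzero[OF t that] by (simp add: G_def field_simps)
  obtain \<rho> where "1 < \<rho>" "f t holomorphic_on ball 0 \<rho>" using f_holomorphic[OF t] by metis
  then have "deriv (f t) holomorphic_on ball 0 \<rho>" by (intro holomorphic_deriv) auto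
  then have "deriv (f t) holomorphic_on ball 0 (min 1 r)"
    by (rule holomorphic_on_subset) (use \<open>1 < \<rho>\<close> in auto)
  \<comment> \<open>\<open>f'\<close> and the rational function \<open>G\<close> are compared near 0
    only, which determines the coefficients; the large disk is used for \<open>G\<close> alone,
    since \<open>f t\<close> is prescribed only near the closed unit disk.\<close>
  then have "taylor_coeff (deriv (f t)) k = taylor_coeff G k"
    by (intro taylor_coeff_cong[of "ball 0 (min 1 r)"]) (use r eq in auto)
  then have "real (Suc k) * norm (taylor_coeff (f t) (Suc k)) = norm (taylor_coeff G k)"
    unfolding taylor_coeff_deriv by (metis norm_mult norm_of_nat)
  also have "\<dots> \<le> a t * (1 + r) ^ m / (1 - w) ^ sum \<nu> {1..l} / r ^ k"
    by (rule norm_taylor_coeff_le[OF _ _ r Gb])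
      (use Gh in \<open>auto intro: holomorphic_on_subset holomorphic_on_imp_continuous_on\<close>)
  finally show "real (Suc k) * norm (taylor_coeff (f t) (Suc k)) \<le> a t * (1 + r) ^ m / (1 - w) ^ sum \<nu> {1..l} / r ^ k" .
  show "norm (deriv (f t) \<zeta>) \<le> a t * (1 + r) ^ m / (1 - w) ^ sum \<nu> {1..l}" if "r = 1" "norm \<zeta> = 1"
    using Gb[of \<zeta>] eq[of \<zeta>] that by simp
qed

end

locale global_rational_solution = rational_solution +
  assumes Q_at_top: "filterlim (\<lambda>t. integral {0..t} q) at_top at_top"
begin

text \<open>The escape estimate keeps all |\<eta>_j| \<le> w < 1 for all times, so radius 1 in the
  coefficient estimate gives a constant independent of time.\<close>

lemma derivative_bound:
  obtains K where "0 < K" "\<And>t \<zeta>. 0 \<le> t \<Longrightarrow> norm \<zeta> \<le> 1 \<Longrightarrow> norm (deriv (f t) \<zeta>) \<le> K * a t"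
    "\<And>t \<zeta>. 0 \<le> t \<Longrightarrow> norm \<zeta> \<le> 1 \<Longrightarrow> norm (f t \<zeta>) \<le> K * a t"
    "\<And>t k. 0 \<le> t \<Longrightarrow> real (Suc k) * norm (taylor_coeff (f t) (Suc k)) \<le> K * a t"
proof -
  obtain \<kappa> w where \<kappa>: "0 < \<kappa>" "0 < w" "w < 1"
    and esc: "\<forall>t\<ge>0. \<forall>j\<in>{1..l}. norm (\<eta> j t) * a t powr \<kappa> \<le> w * a 0 powr \<kappa>"
    using pole_escape by blast
  have \<eta>w: "norm (\<eta> j t) * 1 \<le> w" if "0 \<le> t" "j \<in> {1..l}" for t j
  proof -
    have "norm (\<eta> j t) * a 0 powr \<kappa> \<le> norm (\<eta> j t) * a t powr \<kappa>"
      using a_mono[of 0 t] a_pos[of 0] that \<kappa> by (intro mult_left_mono powr_mono2) auto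
    also have "\<dots> \<le> w * a 0 powr \<kappa>" using esc that by blast
    finally show ?thesis using a_pos[of 0] by (simp add: mult_le_cancel_right)
  qed
  define K where "K = (1 + 1) ^ m / (1 - w) ^ sum \<nu> {1..l}"
  have K: "K > 0" using \<kappa> by (simp add: K_def)
  have d1: "norm (deriv (f t) \<zeta>) \<le> K * a t" if t: "0 \<le> t" and n: "norm \<zeta> = 1" for t \<zeta>
    using coefficient_estimate(2)[OF t zero_less_one \<kappa>(3) \<eta>w[OF t], of \<zeta>] n by (simp add: K_def mult.commute)
  have d: "norm (deriv (f t) \<zeta>) \<le> K * a t" if t: "0 \<le> t" and n: "norm \<zeta> \<le> 1" for t \<zeta>
  proof -
    obtain \<rho> where \<rho>: "1 < \<rho>" "f t holomorphic_on ball 0 \<rho>" using f_holomorphic[OF t] by metis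
    then have "deriv (f t) holomorphic_on ball 0 \<rho>" by (intro holomorphic_deriv) auto
    then have h: "deriv (f t) holomorphic_on cball 0 1" by (rule holomorphic_on_subset) (use \<rho> in auto)
    show ?thesis
    proof (rule maximum_modulus_frontier[of "deriv (f t)" "cball 0 1"])
      show "deriv (f t) holomorphic_on interior (cball 0 1)" by (rule holomorphic_on_subset[OF h]) auto
      show "continuous_on (closure (cball 0 1)) (deriv (f t))"
        using holomorphic_on_imp_continuous_on[OF h] by simp
    qed (use d1[OF t] n in auto)
  qed
  have "norm (f t \<zeta>) \<le> K * a t" if t: "0 \<le> t" and n: "norm \<zeta> \<le> 1" for t \<zeta>
  proof -
    obtain \<rho> where \<rho>: "1 < \<rho>" "f t holomorphic_on ball 0 \<rho>" using f_holomorphic[OF t] by metis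
    have "norm (f t \<zeta> - f t 0) \<le> K * a t * norm (\<zeta> - 0)"
    proof (rule field_differentiable_bound[of "cball 0 1" "f t" "deriv (f t)"])
      fix z :: complex assume z: "z \<in> cball 0 1"
      show "(f t has_field_derivative deriv (f t) z) (at z within cball 0 1)"
        by (rule has_field_derivative_at_within[OF holomorphic_derivI[OF \<rho>(2) open_ball]]) (use \<rho> z in auto)
      show "norm (deriv (f t) z) \<le> K * a t" using d[OF t] z by simp
    qed (use n in auto)
    also have "\<dots> \<le> K * a t * 1" using n K a_pos[OF t] by (intro mult_left_mono) auto
    finally show ?thesis using f_zero[OF t] by simp
  qed
  moreover have "real (Suc k) * norm (taylor_coeff (f t) (Suc k)) \<le> K * a t" if t: "0 \<le> t" for t k
    using coefficient_estimate(1)[OF t zero_less_one \<kappa>(3) \<eta>w[OF t], of k] by (simp add: K_def mult.commute)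
  ultimately show thesis using that K d by blast
qed

text \<open>\<open>moment 0\<close> is at most (K a)^2 in modulus but grows like 2 Q(t), hence
  \<open>a\<close> cannot stay bounded.\<close>

lemma a_at_top: "filterlim a at_top at_top"
  unfolding filterlim_at_top
proof
  fix Z :: real
  obtain K where K: "0 < K" "\<And>t \<zeta>. 0 \<le> t \<Longrightarrow> norm \<zeta> \<le> 1 \<Longrightarrow> norm (deriv (f t) \<zeta>) \<le> K * a t"
    "\<And>t \<zeta>. 0 \<le> t \<Longrightarrow> norm \<zeta> \<le> 1 \<Longrightarrow> norm (f t \<zeta>) \<le> K * a t"
    using derivative_bound by metis
  have "\<forall>\<^sub>F t in at_top. integral {0..t} q \<ge> (K * \<bar>Z\<bar>)\<^sup>2 + norm (moment 0 0) + 1"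
    using Q_at_top unfolding filterlim_at_top by blast
  then show "\<forall>\<^sub>F t in at_top. Z \<le> a t"
    using eventually_ge_at_top[of 0]
  proof eventually_elim
    case (elim t)
    obtain \<rho> where \<rho>: "1 < \<rho>" "f t holomorphic_on ball 0 \<rho>" using f_holomorphic[OF elim(2)] by metis
    have dh: "deriv (f t) holomorphic_on ball 0 \<rho>" using \<rho> by (intro holomorphic_deriv) auto
    have cont: "continuous_on (sphere 0 1) h" if "h holomorphic_on ball 0 \<rho>" for h
      by (rule holomorphic_on_imp_continuous_on[OF holomorphic_on_subset[OF that]]) (use \<rho> in auto)
    have "norm (moment 0 t) \<le> K * a t * (K * a t)"
      unfolding moment_def
    proof (rule norm_circle_avg_le)
      show "continuous_on (sphere 0 1) (\<lambda>\<zeta>. \<zeta> * (f t \<zeta> ^ 0 * cnj (f t \<zeta>) * deriv (f t) \<zeta>))"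
        by (intro continuous_intros continuous_on_cnj cont \<rho> dh)
      fix \<zeta> :: complex assume n: "norm \<zeta> = 1"
      show "norm (\<zeta> * (f t \<zeta> ^ 0 * cnj (f t \<zeta>) * deriv (f t) \<zeta>)) \<le> K * a t * (K * a t)"
        using K(2,3)[OF elim(2), of \<zeta>] n K(1) a_pos[OF elim(2)] by (auto simp: norm_mult intro!: mult_mono)
    qed
    moreover have "integral {0..t} q \<le> norm (moment 0 t) + norm (moment 0 0)"
    proof -
      have "2 * integral {0..t} q = norm (2 * complex_of_real (integral {0..t} q))"
        using elim(1) by (simp add: norm_mult order_trans[OF _ elim(1)])
      also have "\<dots> = norm (moment 0 t - moment 0 0)" using area_eq[OF elim(2)] by simp
      also have "\<dots> \<le> norm (moment 0 t) + norm (moment 0 0)" by (rule norm_triangle_ineq4)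
      finally show ?thesis using elim(1) by (smt (verit) norm_ge_zero zero_le_power2)
    qed
    ultimately have "(K * \<bar>Z\<bar>)\<^sup>2 < (K * a t)\<^sup>2" using elim(1) by (simp add: power2_eq_square)
    then have "K * \<bar>Z\<bar> < K * a t" by (rule power2_less_imp_less) (use K a_pos[OF elim(2)] in simp)
    then show "Z \<le> a t" using K(1) by simp
  qed
qed

lemma a_powr_at_top:
  assumes "0 < p"
  shows "filterlim (\<lambda>t. a t powr p) at_top at_top"
proof -
  have "filterlim (\<lambda>t. exp (p * ln (a t))) at_top at_top"
    by (intro filterlim_compose[OF exp_at_top] filterlim_tendsto_pos_mult_at_top[OF tendsto_const assms]
        filterlim_compose[OF ln_at_top a_at_top])
  moreover have "\<forall>\<^sub>F t in at_top. exp (p * ln (a t)) = a t powr p"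
    using eventually_ge_at_top[of 0] by eventually_elim (use a_pos in \<open>force simp: powr_def\<close>)
  ultimately show ?thesis by (rule filterlim_cong[OF refl refl, THEN iffD1, rotated])
qed

lemma tail_decay:
  obtains \<kappa> where "0 < \<kappa>" "\<And>j. \<forall>\<^sub>F t in at_top. taylor_summable (f t) j"
    "\<And>N j. \<exists>C. \<forall>\<^sub>F t in at_top. taylor_tail (f t) N j \<le> C * a t powr (1 + \<kappa> * (real m + 1 - real N))"
proof -
  obtain \<kappa> w where \<kappa>: "0 < \<kappa>" "0 < w" "w < 1"
    and esc: "\<forall>t\<ge>0. \<forall>j\<in>{1..l}. norm (\<eta> j t) * a t powr \<kappa> \<le> w * a 0 powr \<kappa>"
    using pole_escape by blast
  \<comment> \<open>This choice gives |\<eta>_j| r \<le> 1/2 for the radius r = c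
    a^\<kappa>.\<close>
  define c where "c = 1 / (2 * (w * a 0 powr \<kappa>))"
  have c: "c > 0" using \<kappa> a_pos[of 0] by (simp add: c_def)
  define r where "r = (\<lambda>t. c * a t powr \<kappa>)"
  define L :: real where "L = 2 ^ m / (1/2) ^ sum \<nu> {1..l}"
  have L: "L > 0" by (simp add: L_def)
  have rlim: "filterlim r at_top at_top"
    unfolding r_def by (rule filterlim_tendsto_pos_mult_at_top[OF tendsto_const c a_powr_at_top[OF \<kappa>(1)]])
  have ev: "\<forall>\<^sub>F t in at_top. 0 \<le> t \<and> 2 \<le> r t"
    using eventually_ge_at_top[of 0] rlim unfolding filterlim_at_top by (simp add: eventually_conj)
  have est: "real k ^ j * norm (taylor_coeff (f t) k) \<le> L * a t * r t ^ (m + 1) * 2 ^ N / r t ^ N * (real k ^ j / 2 ^ k)"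
    if t: "0 \<le> t" "2 \<le> r t" and k: "N < k" for t k j N
  proof -
    obtain k' where k': "k = Suc k'" using k by (cases k) auto
    have "norm (\<eta> j t) * r t \<le> 1/2" if "j \<in> {1..l}" for j
    proof -
      have "c * (norm (\<eta> j t) * a t powr \<kappa>) \<le> c * (w * a 0 powr \<kappa>)"
        using esc t that c by (intro mult_left_mono) auto
      also have "\<dots> = 1/2" using \<kappa> a_pos[of 0] by (simp add: c_def)
      finally show ?thesis by (simp add: r_def mult_ac)
    qed
    from coefficient_estimate(1)[OF t(1) _ _ this, of k'] t(2)
    have "real k * norm (taylor_coeff (f t) k) \<le> a t * (1 + r t) ^ m / (1 - 1/2) ^ sum \<nu> {1..l} / r t ^ k'"
      unfolding k' by simp
    also have "\<dots> \<le> a t * (2 * r t) ^ m / (1 - 1/2) ^ sum \<nu> {1..l} / r t ^ k'"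
      using t a_pos[OF t(1)] by (intro divide_right_mono mult_left_mono power_mono) auto
    also have "\<dots> = L * a t * r t ^ (m + 1) / r t ^ k"
      using t by (simp add: L_def k' power_mult_distrib field_simps)
    \<comment> \<open>Only r^N is spent on decay in time. The remaining k - N factors r, each at
      least 2, provide a geometric series in k that absorbs any weight k^j.\<close>
    also have "\<dots> \<le> L * a t * r t ^ (m + 1) / (r t ^ N * (2 ^ k / 2 ^ N))"
    proof -
      have "(2::real) ^ k / 2 ^ N = 2 ^ (k - N)" using k by (simp add: power_diff)
      also have "\<dots> \<le> r t ^ (k - N)" using t by (intro power_mono) auto
      finally have "r t ^ N * (2 ^ k / 2 ^ N) \<le> r t ^ N * r t ^ (k - N)" using t by (intro mult_left_mono) auto
      also have "\<dots> = r t ^ k" using k by (simp add: power_add[symmetric])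
      finally show ?thesis using t L a_pos[OF t(1)] by (intro divide_left_mono mult_nonneg_nonneg mult_pos_pos) auto
    qed
    also have "\<dots> = L * a t * r t ^ (m + 1) * 2 ^ N / r t ^ N / 2 ^ k" using t by (simp add: field_simps)
    finally have 1: "real k * norm (taylor_coeff (f t) k) \<le> L * a t * r t ^ (m + 1) * 2 ^ N / r t ^ N / 2 ^ k" .
    have "norm (taylor_coeff (f t) k) \<le> real k * norm (taylor_coeff (f t) k)"
      using k mult_right_mono[of 1 "real k" "norm (taylor_coeff (f t) k)"] by simp
    then have "real k ^ j * norm (taylor_coeff (f t) k) \<le> real k ^ j * (L * a t * r t ^ (m + 1) * 2 ^ N / r t ^ N / 2 ^ k)"
      using 1 by (intro mult_left_mono) auto
    then show ?thesis by (simp add: mult_ac)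
  qed
  have sm: "taylor_summable (f t) j" if t: "0 \<le> t" "2 \<le> r t" for t j
    unfolding taylor_summable_def
  proof (rule summable_comparison_test'[of _ 1])
    show "summable (\<lambda>k. L * a t * r t ^ (m + 1) * 2 ^ 0 / r t ^ 0 * (real k ^ j / 2 ^ k))"
      by (intro summable_mult summable_power_over_two_power)
    fix k :: nat assume "1 \<le> k"
    then show "norm (real k ^ j * norm (taylor_coeff (f t) k)) \<le> L * a t * r t ^ (m + 1) * 2 ^ 0 / r t ^ 0 * (real k ^ j / 2 ^ k)"
      using est[OF t, of 0 k j] by simp
  qed
  have "\<forall>\<^sub>F t in at_top. taylor_tail (f t) N j \<le>
      (L * 2 ^ N * c ^ (m + 1) / c ^ N * (\<Sum>k. real k ^ j / 2 ^ k)) * a t powr (1 + \<kappa> * (real m + 1 - real N))" for N j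
    using ev
  proof eventually_elim
    case (elim t)
    let ?C = "L * a t * r t ^ (m + 1) * 2 ^ N / r t ^ N"
    have at: "0 < a t" using a_pos elim by blast
    have C0: "0 \<le> ?C" using L at elim by simp
    have "taylor_tail (f t) N j \<le> (\<Sum>k. ?C * (real k ^ j / 2 ^ k))"
      unfolding taylor_tail_def
    proof (rule suminf_le)
      show "(if N < k then real k ^ j * norm (taylor_coeff (f t) k) else 0) \<le> ?C * (real k ^ j / 2 ^ k)" for k
      proof (cases "N < k")
        case True
        then show ?thesis using est[of t N k j] elim by (simp only: if_True)
      next
        case False
        have "0 \<le> ?C * (real k ^ j / 2 ^ k)" by (rule mult_nonneg_nonneg[OF C0]) simp
        then show ?thesis using False by (simp only: if_False)
      qed
      show "summable (\<lambda>k. if N < k then real k ^ j * norm (taylor_coeff (f t) k) else 0)"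
        by (rule taylor_tail_summable) (use elim sm in blast)
      show "summable (\<lambda>k. ?C * (real k ^ j / 2 ^ k))"
        by (intro summable_mult summable_power_over_two_power)
    qed
    also have "\<dots> = ?C * (\<Sum>k. real k ^ j / 2 ^ k)"
      by (rule suminf_mult[OF summable_power_over_two_power])
    also have "?C = L * 2 ^ N * c ^ (m + 1) / c ^ N * a t powr (1 + \<kappa> * (real m + 1 - real N))"
    proof -
      have p: "(a t powr \<kappa>) ^ i = a t powr (\<kappa> * real i)" for i
        using at by (simp add: powr_powr[symmetric] powr_realpow)
      have "a t powr (1 + \<kappa> * (real m + 1 - real N)) = a t powr (1 + \<kappa> * real (m + 1) - \<kappa> * real N)"
        by (simp add: algebra_simps)
      also have "\<dots> = a t * a t powr (\<kappa> * real (m + 1)) / a t powr (\<kappa> * real N)"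
        using at by (simp only: powr_add powr_diff powr_one)
      finally show ?thesis
        unfolding r_def power_mult_distrib p by (simp add: mult_ac)
    qed
    finally show ?case by (simp add: mult_ac)
  qed
  moreover have "\<forall>\<^sub>F t in at_top. taylor_summable (f t) j" for j
    using ev by eventually_elim (use sm in blast)
  ultimately show thesis using that[OF \<kappa>(1)] by blast
qed

section \<open>Tails relative to the leading coefficient, and descent along the moments\<close>

definition rel_tail :: "nat \<Rightarrow> real \<Rightarrow> real" where "rel_tail N t = taylor_tail (f t) N 1 / a t"

lemma regular_times: "\<forall>\<^sub>F t in at_top. 0 \<le> t \<and> 1 \<le> a t \<and> taylor_summable (f t) 1"
proof -
  have "\<forall>\<^sub>F t in at_top. taylor_summable (f t) 1" using tail_decay by blast
  moreover have "\<forall>\<^sub>F t in at_top. 1 \<le> a t" using a_at_top unfolding filterlim_at_top by blast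
  ultimately show ?thesis using eventually_ge_at_top[of 0] by eventually_elim auto
qed

lemma rel_tail_nonneg: "0 \<le> t \<Longrightarrow> taylor_summable (f t) 1 \<Longrightarrow> 0 \<le> rel_tail N t"
  unfolding rel_tail_def using taylor_tail_nonneg a_pos by (simp add: less_imp_le)

lemma rel_tail_Suc:
  assumes "taylor_summable (f t) 1"
  shows "rel_tail N t = real (Suc N) * norm (taylor_coeff (f t) (Suc N)) / a t + rel_tail (Suc N) t"
  unfolding rel_tail_def using taylor_tail_Suc[OF assms, of N] by (simp add: add_divide_distrib)

lemma moment_estimate:
  assumes t: "0 \<le> t" and s: "taylor_summable (f t) 1"
  shows "norm (moment k t - of_real (a t) ^ Suc k * cnj (taylor_coeff (f t) (Suc k)))
    \<le> a t ^ (k + 2) * (((1 + rel_tail 1 t) ^ Suc k - 1) * rel_tail (Suc k) t)"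
proof -
  obtain \<rho> where \<rho>: "1 < \<rho>" "f t holomorphic_on ball 0 \<rho>" using f_holomorphic[OF t] by metis
  show ?thesis unfolding moment_def rel_tail_def
    by (rule moment_coefficient_estimate[OF \<rho>(2,1) f_zero[OF t] deriv_f_0[OF t] a_pos[OF t] s])
qed

lemma rel_tail_decay: "\<exists>K C. \<forall>\<^sub>F t in at_top. rel_tail (K + N) t \<le> C * a t powr (- p)"
proof -
  obtain \<kappa> where \<kappa>: "0 < \<kappa>" and
    d: "\<And>N. \<exists>C. \<forall>\<^sub>F t in at_top. taylor_tail (f t) N 1 \<le> C * a t powr (1 + \<kappa> * (real m + 1 - real N))"
    using tail_decay by metis
  \<comment> \<open>Then \<kappa> (K - m - 1) \<ge> p, the decay exponent that remains after
    dividing the tail by \<open>a\<close>.\<close>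
  obtain K where K: "real K \<ge> p / \<kappa> + real m + 1" using real_arch_simple by blast
  obtain C where C: "\<forall>\<^sub>F t in at_top. taylor_tail (f t) (K + N) 1 \<le> C * a t powr (1 + \<kappa> * (real m + 1 - real (K + N)))"
    using d by blast
  have "\<forall>\<^sub>F t in at_top. rel_tail (K + N) t \<le> \<bar>C\<bar> * a t powr (- p)"
    using C regular_times
  proof eventually_elim
    case (elim t)
    have a1: "1 \<le> a t" and a0: "0 < a t" using elim by auto
    have "rel_tail (K + N) t \<le> C * a t powr (1 + \<kappa> * (real m + 1 - real (K + N))) / a t"
      unfolding rel_tail_def using elim a0 by (intro divide_right_mono) auto
    also have "\<dots> = C * a t powr (\<kappa> * (real m + 1 - real (K + N)))"
      using a0 by (simp add: powr_add)
    also have "\<dots> \<le> \<bar>C\<bar> * a t powr (- p)"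
    proof (intro mult_mono powr_mono a1)
      have "p / \<kappa> \<le> real (K + N) - (real m + 1)" using K by simp
      then have "p \<le> (real (K + N) - (real m + 1)) * \<kappa>" by (simp only: pos_divide_le_eq[OF \<kappa>])
      then show "\<kappa> * (real m + 1 - real (K + N)) \<le> - p" by (simp add: algebra_simps)
    qed auto
    finally show ?case .
  qed
  then show ?thesis by blast
qed

text \<open>Finitely many terms, each bounded through \<open>f'\<close> on the circle, are added to
  a far tail that decays. This bounds the factors (1 + e_1)^(n+1) in the descent before e_1 -> 0 is
  known.\<close>

lemma rel_tail_bounded: "\<exists>C\<ge>0. \<forall>\<^sub>F t in at_top. rel_tail N t \<le> C"
proof -
  obtain L where L: "0 < L" "\<And>t k. 0 \<le> t \<Longrightarrow> real (Suc k) * norm (taylor_coeff (f t) (Suc k)) \<le> L * a t"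
    using derivative_bound by metis
  obtain K C where C: "\<forall>\<^sub>F t in at_top. rel_tail (K + N) t \<le> C * a t powr (- 0)" using rel_tail_decay by blast
  have "N \<le> K + N" by simp
  then show ?thesis
  proof (induction rule: inc_induct)
    case base
    have "\<forall>\<^sub>F t in at_top. rel_tail (K + N) t \<le> \<bar>C\<bar>"
      using C regular_times by eventually_elim auto
    then show ?case using abs_ge_zero by blast
  next
    case (step n)
    then obtain D where D: "D \<ge> 0" "\<forall>\<^sub>F t in at_top. rel_tail (Suc n) t \<le> D" by blast
    have "\<forall>\<^sub>F t in at_top. rel_tail n t \<le> L + D"
      using D(2) regular_times
    proof eventually_elim
      case (elim t)
      have "real (Suc n) * norm (taylor_coeff (f t) (Suc n)) / a t \<le> L"
        using L(2)[of t n] elim by (simp add: divide_le_eq del: of_nat_Suc)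
      then show ?case using rel_tail_Suc[of t n] elim by simp
    qed
    then show ?case using L D by (intro exI[of _ "L + D"]) auto
  qed
qed

text \<open>Descending in the index, the linear term of the moment formula is controlled by the moment and by the
  tails already estimated.\<close>

lemma rel_tail_descent:
  assumes N: "1 \<le> N" "N \<le> K" and base: "\<exists>C. \<forall>\<^sub>F t in at_top. rel_tail K t \<le> C * a t powr (- p)"
    and M: "\<And>n. N \<le> n \<Longrightarrow> n < K \<Longrightarrow> moment n 0 = 0 \<or> p \<le> real n + 2"
  shows "\<exists>C. \<forall>\<^sub>F t in at_top. rel_tail N t \<le> C * a t powr (- p)"
  using N(2) base M
proof (induction rule: inc_induct)
  case base
  then show ?case by blast
next
  case (step n)
  then obtain C where C: "\<forall>\<^sub>F t in at_top. rel_tail (Suc n) t \<le> C * a t powr (- p)" by (metis Suc_leD)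
  obtain E where E: "E \<ge> 0" "\<forall>\<^sub>F t in at_top. rel_tail 1 t \<le> E" using rel_tail_bounded by blast
  let ?D = "real (Suc n) * (norm (moment n 0) + (1 + E) ^ Suc n * \<bar>C\<bar>) + \<bar>C\<bar>"
  have "\<forall>\<^sub>F t in at_top. rel_tail n t \<le> ?D * a t powr (- p)"
    using C E(2) regular_times
  proof eventually_elim
    case (elim t)
    have t: "0 \<le> t" "1 \<le> a t" "taylor_summable (f t) 1" and a0: "0 < a t" using elim by auto
    let ?c = "norm (taylor_coeff (f t) (Suc n))" and ?g = "a t powr (- p)"
    have eS: "rel_tail (Suc n) t \<le> \<bar>C\<bar> * ?g" using elim(1) by (smt (verit) mult_right_mono powr_ge_zero abs_ge_self)
    \<comment> \<open>The moment formula is solved for the coefficient. After division by a^(n+2) it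
      bounds |a_(n+1)| / a by |M_n| a^(-n-2) plus a bounded multiple of the next tail.\<close>
    have "norm (of_real (a t) ^ Suc n * cnj (taylor_coeff (f t) (Suc n))) \<le>
        norm (moment n t) + a t ^ (n + 2) * (((1 + rel_tail 1 t) ^ Suc n - 1) * rel_tail (Suc n) t)"
      using moment_estimate[OF t(1,3), of n] norm_triangle_ineq3 by (smt (verit) norm_minus_commute)
    moreover have "norm (of_real (a t) ^ Suc n * cnj (taylor_coeff (f t) (Suc n))) = a t ^ Suc n * ?c"
      using a0 by (simp add: norm_mult norm_power)
    moreover have "moment n t = moment n 0" using moment_const[of n t 0] step.hyps N t by simp
    ultimately have 1: "a t ^ Suc n * ?c \<le> norm (moment n 0) + a t ^ (n + 2) * (((1 + rel_tail 1 t) ^ Suc n - 1) * rel_tail (Suc n) t)"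
      by simp
    \<comment> \<open>A nonzero moment contributes a^(-n-2), which is within the rate exactly when p
      \<le> n + 2; a vanishing one is harmless for every p.\<close>
    have 2: "norm (moment n 0) \<le> norm (moment n 0) * (a t ^ (n + 2) * ?g)"
    proof (cases "moment n 0 = 0")
      case False
      then have "p \<le> real n + 2" using step.prems(2)[of n] step.hyps by auto
      then have "1 \<le> a t powr (real (n + 2) - p)" using t by (intro ge_one_powr_ge_zero) auto
      also have "\<dots> = a t ^ (n + 2) * ?g"
        using a0 by (simp only: powr_diff powr_minus powr_realpow divide_inverse)
      finally have "1 \<le> a t ^ (n + 2) * ?g" .
      then show ?thesis using mult_left_mono[of 1 "a t ^ (n + 2) * ?g" "norm (moment n 0)"] by simp
    qed simp
    have "((1 + rel_tail 1 t) ^ Suc n - 1) * rel_tail (Suc n) t \<le> (1 + E) ^ Suc n * (\<bar>C\<bar> * ?g)"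
    proof (intro mult_mono eS)
      have "(1 + rel_tail 1 t) ^ Suc n \<le> (1 + E) ^ Suc n" using elim(2) rel_tail_nonneg[OF t(1,3), of 1] by (intro power_mono) auto
      then show "(1 + rel_tail 1 t) ^ Suc n - 1 \<le> (1 + E) ^ Suc n" by linarith
    qed (use E rel_tail_nonneg[OF t(1,3)] in auto)
    then have "a t ^ (n + 2) * (((1 + rel_tail 1 t) ^ Suc n - 1) * rel_tail (Suc n) t) \<le> a t ^ (n + 2) * ((1 + E) ^ Suc n * (\<bar>C\<bar> * ?g))"
      using a0 by (intro mult_left_mono) auto
    then have "a t ^ Suc n * ?c \<le> a t ^ (n + 2) * ((norm (moment n 0) + (1 + E) ^ Suc n * \<bar>C\<bar>) * ?g)"
      using 1 2 by (simp add: algebra_simps)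
    also have "\<dots> = a t ^ Suc n * (a t * ((norm (moment n 0) + (1 + E) ^ Suc n * \<bar>C\<bar>) * ?g))"
      by (simp add: algebra_simps)
    finally have "?c \<le> a t * ((norm (moment n 0) + (1 + E) ^ Suc n * \<bar>C\<bar>) * ?g)"
      by (rule mult_left_le_imp_le) (use a0 in simp)
    then have "?c / a t \<le> (norm (moment n 0) + (1 + E) ^ Suc n * \<bar>C\<bar>) * ?g"
      using a0 by (simp add: divide_le_eq mult.commute)
    then have "real (Suc n) * (?c / a t) \<le> real (Suc n) * ((norm (moment n 0) + (1 + E) ^ Suc n * \<bar>C\<bar>) * ?g)"
      by (intro mult_left_mono) auto
    then show ?case
      using rel_tail_Suc[OF t(3), of n] eS by (simp add: algebra_simps del: of_nat_Suc)
  qed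
  then show ?case by blast
qed

text \<open>With p = N + 2 every moment of index n \<ge> N is admissible in the descent, whether or
  not it vanishes.\<close>

lemma rel_tail_rate:
  assumes "1 \<le> N"
  shows "\<exists>C. \<forall>\<^sub>F t in at_top. rel_tail N t \<le> C * a t powr (- (real N + 2))"
proof -
  obtain K C where "\<forall>\<^sub>F t in at_top. rel_tail (K + N) t \<le> C * a t powr (- (real N + 2))" using rel_tail_decay by blast
  then show ?thesis by (intro rel_tail_descent[OF assms, of "K + N"]) auto
qed

lemma powr_neg_tendsto: "0 < p \<Longrightarrow> ((\<lambda>t. a t powr (- p)) \<longlongrightarrow> 0) at_top"
  using filterlim_compose[OF tendsto_neg_powr[OF _ filterlim_ident] a_at_top, of "-p"] by simp

lemma rel_tail_tendsto_0:
  assumes "1 \<le> N"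
  shows "(rel_tail N \<longlongrightarrow> 0) at_top"
proof -
  obtain C where C: "\<forall>\<^sub>F t in at_top. rel_tail N t \<le> C * a t powr (- (real N + 2))" using rel_tail_rate[OF assms] by blast
  have "((\<lambda>t. C * a t powr (- (real N + 2))) \<longlongrightarrow> C * 0) at_top"
    by (intro tendsto_mult tendsto_const powr_neg_tendsto) simp
  then have l: "((\<lambda>t. C * a t powr (- (real N + 2))) \<longlongrightarrow> 0) at_top" by simp
  have "\<forall>\<^sub>F t in at_top. 0 \<le> rel_tail N t" using regular_times by eventually_elim (use rel_tail_nonneg in blast)
  from tendsto_sandwich[OF this C tendsto_const l] show ?thesis .
qed

lemma growth_factor_tendsto_0: "((\<lambda>t. (1 + rel_tail 1 t) ^ k - 1) \<longlongrightarrow> 0) at_top"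
proof -
  have "((\<lambda>t. (1 + rel_tail 1 t) ^ k - 1) \<longlongrightarrow> (1 + 0) ^ k - 1) at_top"
    by (intro tendsto_intros rel_tail_tendsto_0) simp
  then show ?thesis by simp
qed

text \<open>The assumed rate alone yields boundedness; the factor (1 + e_1)^(k+1) - 1, which tends
  to 0, upgrades it to convergence.\<close>

lemma moment_error_tendsto_0:
  assumes p: "\<exists>C. \<forall>\<^sub>F t in at_top. rel_tail (Suc k) t \<le> C * a t powr (- p)"
  shows "((\<lambda>t. a t powr p * (((1 + rel_tail 1 t) ^ Suc k - 1) * rel_tail (Suc k) t)) \<longlongrightarrow> 0) at_top"
proof -
  obtain C where C: "\<forall>\<^sub>F t in at_top. rel_tail (Suc k) t \<le> C * a t powr (- p)" using p by blast
  have l: "((\<lambda>t. ((1 + rel_tail 1 t) ^ Suc k - 1) * C) \<longlongrightarrow> 0) at_top"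
    using tendsto_mult[OF growth_factor_tendsto_0[of "Suc k"] tendsto_const[of C]] by simp
  have "\<forall>\<^sub>F t in at_top. 0 \<le> a t powr p * (((1 + rel_tail 1 t) ^ Suc k - 1) * rel_tail (Suc k) t) \<and>
      a t powr p * (((1 + rel_tail 1 t) ^ Suc k - 1) * rel_tail (Suc k) t) \<le> ((1 + rel_tail 1 t) ^ Suc k - 1) * C"
    using C regular_times
  proof eventually_elim
    case (elim t)
    have n: "0 \<le> rel_tail N t" for N using rel_tail_nonneg elim by blast
    have g: "0 \<le> (1 + rel_tail 1 t) ^ Suc k - 1" using n[of 1] one_le_power[of "1 + rel_tail 1 t" "Suc k"] by simp
    have "a t powr p * (((1 + rel_tail 1 t) ^ Suc k - 1) * rel_tail (Suc k) t) \<le> a t powr p * (((1 + rel_tail 1 t) ^ Suc k - 1) * (C * a t powr (- p)))"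
      using g elim by (intro mult_left_mono) auto
    also have "\<dots> = (a t powr p * a t powr (- p)) * (((1 + rel_tail 1 t) ^ Suc k - 1) * C)" by (simp add: mult_ac)
    also have "a t powr p * a t powr (- p) = 1" using elim by (simp add: powr_add[symmetric])
    finally show ?case using g n by simp
  qed
  then show ?thesis
    by (intro tendsto_sandwich[OF _ _ tendsto_const l]) (auto elim: eventually_mono)
qed

text \<open>The error of the moment formula is a^(k+2) times a vanishing factor times the relative
  tail beyond k + 1, and that tail is even O(a^(-k-3)).\<close>

lemma coefficient_limit:
  assumes "1 \<le> k"
  shows "((\<lambda>t. taylor_coeff (f t) (Suc k) * of_real (a t) ^ Suc k) \<longlongrightarrow> cnj (moment k 0)) at_top"
proof -
  obtain C where C: "\<forall>\<^sub>F t in at_top. rel_tail (Suc k) t \<le> C * a t powr (- (real (Suc k) + 2))" using rel_tail_rate[of "Suc k"] by auto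
  have "\<forall>\<^sub>F t in at_top. rel_tail (Suc k) t \<le> \<bar>C\<bar> * a t powr (- (real (k + 2)))"
    using C regular_times
  proof eventually_elim
    case (elim t)
    have "C * a t powr (- (real (Suc k) + 2)) \<le> \<bar>C\<bar> * a t powr (- (real (k + 2)))"
      using elim by (intro mult_mono powr_mono) auto
    then show ?case using elim by linarith
  qed
  then have lim: "((\<lambda>t. a t powr (real (k + 2)) * (((1 + rel_tail 1 t) ^ Suc k - 1) * rel_tail (Suc k) t)) \<longlongrightarrow> 0) at_top"
    by (intro moment_error_tendsto_0) blast
  have "\<forall>\<^sub>F t in at_top. norm (taylor_coeff (f t) (Suc k) * of_real (a t) ^ Suc k - cnj (moment k 0)) \<le>
      a t powr (real (k + 2)) * (((1 + rel_tail 1 t) ^ Suc k - 1) * rel_tail (Suc k) t)"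
    using regular_times
  proof eventually_elim
    case (elim t)
    have "norm (taylor_coeff (f t) (Suc k) * of_real (a t) ^ Suc k - cnj (moment k 0)) =
        norm (cnj (of_real (a t) ^ Suc k * cnj (taylor_coeff (f t) (Suc k)) - moment k t))"
      using moment_const[OF assms, of t 0] elim by (simp add: mult.commute)
    also have "\<dots> = norm (moment k t - of_real (a t) ^ Suc k * cnj (taylor_coeff (f t) (Suc k)))"
      by (simp only: complex_mod_cnj norm_minus_commute)
    also have "\<dots> \<le> a t ^ (k + 2) * (((1 + rel_tail 1 t) ^ Suc k - 1) * rel_tail (Suc k) t)"
      using moment_estimate elim by blast
    also have "a t ^ (k + 2) = a t powr (real (k + 2))"
      using elim by (intro powr_realpow[symmetric]) auto
    finally show ?case .
  qed
  from Lim_null_comparison[OF this lim] show ?thesis by (simp add: LIM_zero_cancel)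
qed

text \<open>The tail beyond r has rate r + 2. As the moments between s and r - 1 vanish, the descent
  down to index s keeps this rate, and since M_(s-1) = 0 as well, the coefficient a_s consists of
  the error term alone.\<close>

lemma coefficient_vanishing:
  assumes M: "\<And>k. 1 \<le> k \<Longrightarrow> k < r \<Longrightarrow> moment k 0 = 0" and s: "s \<in> {2..r}"
  shows "((\<lambda>t. taylor_coeff (f t) s * of_real (a t) ^ (r + 1)) \<longlongrightarrow> 0) at_top"
proof -
  obtain k where k: "s = Suc k" "1 \<le> k" using s by (cases s) auto
  have "\<exists>C. \<forall>\<^sub>F t in at_top. rel_tail r t \<le> C * a t powr (- real (r + 2))"
    using rel_tail_rate[of r] s by (auto simp: add.commute)
  then have "\<exists>C. \<forall>\<^sub>F t in at_top. rel_tail (Suc k) t \<le> C * a t powr (- real (r + 2))"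
    by (rule rel_tail_descent[rotated 2]) (use M s k in auto)
  then have lim: "((\<lambda>t. a t powr real (r + 2) * (((1 + rel_tail 1 t) ^ Suc k - 1) * rel_tail (Suc k) t)) \<longlongrightarrow> 0) at_top"
    by (rule moment_error_tendsto_0)
  have "\<forall>\<^sub>F t in at_top. norm (taylor_coeff (f t) s * of_real (a t) ^ (r + 1)) \<le>
      a t powr real (r + 2) * (((1 + rel_tail 1 t) ^ Suc k - 1) * rel_tail (Suc k) t)"
    using regular_times
  proof eventually_elim
    case (elim t)
    have a0: "0 < a t" using elim by auto
    have "moment k t = 0" using moment_const[of k t 0] M[of k] k s elim by auto
    then have "a t ^ Suc k * norm (taylor_coeff (f t) s) \<le> a t ^ (k + 2) * (((1 + rel_tail 1 t) ^ Suc k - 1) * rel_tail (Suc k) t)"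
      using moment_estimate[of t k] elim a0 by (simp add: k norm_mult norm_power)
    also have "\<dots> = a t ^ Suc k * (a t * (((1 + rel_tail 1 t) ^ Suc k - 1) * rel_tail (Suc k) t))" by (simp add: mult_ac)
    finally have "norm (taylor_coeff (f t) s) \<le> a t * (((1 + rel_tail 1 t) ^ Suc k - 1) * rel_tail (Suc k) t)"
      by (rule mult_left_le_imp_le) (use a0 in simp)
    then have "norm (taylor_coeff (f t) s) * a t ^ (r + 1) \<le> a t * (((1 + rel_tail 1 t) ^ Suc k - 1) * rel_tail (Suc k) t) * a t ^ (r + 1)"
      using a0 by (intro mult_right_mono) auto
    also have "\<dots> = a t ^ (r + 2) * (((1 + rel_tail 1 t) ^ Suc k - 1) * rel_tail (Suc k) t)" by (simp add: mult_ac)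
    also have "a t ^ (r + 2) = a t powr real (r + 2)" using a0 by (rule powr_realpow[symmetric])
    finally show ?case using a0 by (simp add: norm_mult norm_power)
  qed
  from Lim_null_comparison[OF this lim] show ?thesis .
qed

text \<open>With s_N = \<kappa> (N - m - 1) - 1 a single sequence serves all j, because the number
  of derivatives affects the constants of the tail and not its exponent.\<close>

lemma section_error_decay:
  obtains s :: "nat \<Rightarrow> real" where "filterlim s at_top sequentially"
    "\<And>N j. (\<lambda>t. section_error (f t) N j) \<in> O[at_top](\<lambda>t. a t powr (- s N))"
proof -
  obtain \<kappa> where \<kappa>: "0 < \<kappa>" and sm: "\<And>j. \<forall>\<^sub>F t in at_top. taylor_summable (f t) j" and
    d: "\<And>N j. \<exists>C. \<forall>\<^sub>F t in at_top. taylor_tail (f t) N j \<le> C * a t powr (1 + \<kappa> * (real m + 1 - real N))"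
    using tail_decay by metis
  define s where "s = (\<lambda>N. (- \<kappa> * (real m + 1) - 1) + \<kappa> * real N)"
  have "filterlim s at_top sequentially"
    unfolding s_def
    by (intro filterlim_tendsto_add_at_top[OF tendsto_const]
        filterlim_tendsto_pos_mult_at_top[OF tendsto_const \<kappa> filterlim_real_sequentially])
  moreover have "(\<lambda>t. section_error (f t) N j) \<in> O[at_top](\<lambda>t. a t powr (- s N))" for N j
  proof -
    obtain C where C: "\<forall>\<^sub>F t in at_top. taylor_tail (f t) N j \<le> C * a t powr (1 + \<kappa> * (real m + 1 - real N))"
      using d by blast
    have "\<forall>\<^sub>F t in at_top. norm (section_error (f t) N j) \<le> C * norm (a t powr (- s N))"
      using C sm[of j] eventually_ge_at_top[of 0]
    proof eventually_elim
      case (elim t)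
      obtain \<rho> where \<rho>: "1 < \<rho>" "f t holomorphic_on ball 0 \<rho>" using f_holomorphic[OF elim(3)] by metis
      have eq: "1 + \<kappa> * (real m + 1 - real N) = - s N" by (simp add: s_def algebra_simps)
      show ?case
        using section_error_le_tail[OF \<rho>(2,1) f_zero[OF elim(3)] elim(2), of N] elim(1) unfolding eq by simp
    qed
    then show ?thesis by (rule bigoI)
  qed
  ultimately show thesis using that by blast
qed

text \<open>After multiplication by a^(r+1) the coefficients of index 2 to r tend to 0, whereas the
  next one tends to the conjugate of M_r. A bound with a constant \<open>L\<close> independent of
  time is thus impossible.\<close>

lemma no_linear_recurrence:
  assumes r: "1 \<le> r" and M: "\<And>k. 1 \<le> k \<Longrightarrow> k < r \<Longrightarrow> moment k 0 = 0" and Mr: "moment r 0 \<noteq> 0"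
    and rec: "\<And>t. 0 \<le> t \<Longrightarrow> norm (taylor_coeff (f t) (Suc r)) \<le> L * (\<Sum>s=2..r. norm (taylor_coeff (f t) s))"
  shows False
proof -
  have "((\<lambda>t. L * (\<Sum>s=2..r. norm (taylor_coeff (f t) s * of_real (a t) ^ (r + 1)))) \<longlongrightarrow> L * (\<Sum>s=2..r. norm (0::complex))) at_top"
    by (intro tendsto_intros coefficient_vanishing M) auto
  then have l: "((\<lambda>t. L * (\<Sum>s=2..r. norm (taylor_coeff (f t) s * of_real (a t) ^ (r + 1)))) \<longlongrightarrow> 0) at_top" by simp
  have "\<forall>\<^sub>F t in at_top. norm (taylor_coeff (f t) (Suc r) * of_real (a t) ^ Suc r) \<le>
      L * (\<Sum>s=2..r. norm (taylor_coeff (f t) s * of_real (a t) ^ (r + 1)))"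
    using eventually_ge_at_top[of 0]
  proof eventually_elim
    case (elim t)
    have "norm (taylor_coeff (f t) (Suc r)) * \<bar>a t\<bar> ^ (r + 1) \<le> L * (\<Sum>s=2..r. norm (taylor_coeff (f t) s)) * \<bar>a t\<bar> ^ (r + 1)"
      by (intro mult_right_mono rec elim) auto
    then show ?case by (simp add: norm_mult norm_power sum_distrib_right mult.assoc)
  qed
  from Lim_null_comparison[OF this l]
  have "((\<lambda>t. taylor_coeff (f t) (Suc r) * of_real (a t) ^ Suc r) \<longlongrightarrow> 0) at_top" .
  moreover have "((\<lambda>t. taylor_coeff (f t) (Suc r) * of_real (a t) ^ Suc r) \<longlongrightarrow> cnj (moment r 0)) at_top"
    by (rule coefficient_limit[OF r])
  ultimately have "cnj (moment r 0) = 0" using tendsto_unique trivial_limit_at_top_linorder by blast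
  then show False using Mr by simp
qed

end

subsection \<open>Recurrences for the coefficients of rational functions\<close>

text \<open>Beyond the degree of the numerator the coefficients of the product vanish, and the
  denominator has constant term 1, so the k-th coefficient is a combination of its \<open>D\<close>
  predecessors. The factor 2^D does not depend on the poles, so the bound is uniform in
  time.\<close>

lemma taylor_recurrence_bound:
  assumes h: "h holomorphic_on ball 0 1" and J: "finite J" and \<eta>: "\<And>j. j \<in> J \<Longrightarrow> norm (\<eta> j) \<le> 1"
    and P: "degree P < k" and eq: "\<And>w. w \<in> ball 0 1 \<Longrightarrow> poly (lin_prod \<eta> \<nu> J) w * h w = poly P w"
    and D: "sum \<nu> J = D"
  shows "norm (taylor_coeff h k) \<le> 2 ^ D * (\<Sum>i\<in>{k - D..<k}. norm (taylor_coeff h i))"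
proof -
  let ?B = "lin_prod \<eta> \<nu> J"
  have "(\<Sum>i=0..k. coeff ?B i * taylor_coeff h (k - i)) = taylor_coeff (\<lambda>w. poly ?B w * h w) k"
    by (rule taylor_coeff_mult_poly[symmetric, OF h]) simp
  also have "\<dots> = taylor_coeff (poly P) k"
    by (rule taylor_coeff_cong[of "ball 0 1"]) (use eq h in \<open>auto intro!: holomorphic_intros\<close>)
  also have "\<dots> = 0" using P by (simp add: taylor_coeff_poly coeff_eq_0)
  finally have "(\<Sum>i=0..k. coeff ?B (k - i) * taylor_coeff h i) = 0"
    by (subst (asm) sum.atLeastAtMost_rev) simp
  moreover have "{0..k} = insert k {0..<k}" by auto
  moreover have "coeff ?B 0 = 1" by (simp flip: poly_0_coeff_0)
  ultimately have "taylor_coeff h k = - (\<Sum>i=0..<k. coeff ?B (k - i) * taylor_coeff h i)"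
    by (simp add: eq_neg_iff_add_eq_0)
  also have "(\<Sum>i=0..<k. coeff ?B (k - i) * taylor_coeff h i) = (\<Sum>i\<in>{k - D..<k}. coeff ?B (k - i) * taylor_coeff h i)"
  proof (rule sum.mono_neutral_right)
    show "\<forall>i\<in>{0..<k} - {k - D..<k}. coeff ?B (k - i) * taylor_coeff h i = 0"
    proof
      fix i assume "i \<in> {0..<k} - {k - D..<k}"
      then have "degree ?B < k - i" using degree_lin_prod_le[OF J, of \<eta> \<nu>] D by auto
      then show "coeff ?B (k - i) * taylor_coeff h i = 0" by (simp add: coeff_eq_0)
    qed
  qed auto
  finally have "norm (taylor_coeff h k) \<le> (\<Sum>i\<in>{k - D..<k}. norm (coeff ?B (k - i) * taylor_coeff h i))"
    by (simp add: norm_sum)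
  also have "\<dots> \<le> (\<Sum>i\<in>{k - D..<k}. 2 ^ D * norm (taylor_coeff h i))"
    unfolding norm_mult D[symmetric] by (intro sum_mono mult_right_mono norm_coeff_lin_prod_le J \<eta>) auto
  finally show ?thesis by (simp add: sum_distrib_left)
qed

text \<open>Missing zeros (at the exceptional time) are encoded by \<open>\<theta> k = 0\<close>, that is, zeros at infinity.\<close>

lemma zero_pole_normal_form:
  assumes g: "zero_pole_form d l \<nu> z g" and d: "d \<le> m"
  shows "\<exists>\<theta>. (\<forall>k\<in>{1..m}. norm (\<theta> k) < 1 \<and> (\<forall>j\<in>{1..l}. \<theta> k \<noteq> 1 / z j)) \<and>
    (\<forall>\<zeta>. norm \<zeta> \<le> 1 \<longrightarrow> g \<zeta> * poly (lin_prod (\<lambda>j. 1 / z j) \<nu> {1..l}) \<zeta> =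
      g 0 * poly (lin_prod \<theta> (\<lambda>_. 1) {1..m}) \<zeta>)"
proof -
  obtain b \<omega> where z: "\<forall>j\<in>{1..l}. 1 < norm (z j)" and \<omega>: "\<forall>k\<in>{1..d}. 1 < norm (\<omega> k) \<and> \<omega> k \<notin> z ` {1..l}"
    and eq: "\<forall>\<zeta>\<in>cball 0 1. g \<zeta> = b * (\<Prod>k=1..d. \<zeta> - \<omega> k) / (\<Prod>j=1..l. (\<zeta> - z j) ^ \<nu> j)"
    using g unfolding zero_pole_form_def by blast
  define \<theta> where "\<theta> = (\<lambda>k. if k \<le> d then 1 / \<omega> k else 0)"
  have nz: "z j \<noteq> 0" if "j \<in> {1..l}" for j
  proof
    assume "z j = 0" then show False using z that by force
  qed
  have n\<omega>: "\<omega> k \<noteq> 0" if "k \<in> {1..d}" for k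
  proof
    assume "\<omega> k = 0" then show False using \<omega> that by force
  qed
  have "norm (\<theta> k) < 1 \<and> (\<forall>j\<in>{1..l}. \<theta> k \<noteq> 1 / z j)" if k: "k \<in> {1..m}" for k
  proof (cases "k \<le> d")
    case True
    then have kd: "k \<in> {1..d}" using k by simp
    have "1 / \<omega> k \<noteq> 1 / z j" if j: "j \<in> {1..l}" for j
    proof
      assume "1 / \<omega> k = 1 / z j"
      then have "\<omega> k = z j" by simp
      then show False using \<omega> kd j by blast
    qed
    moreover have "1 < norm (\<omega> k)" using \<omega> kd by blast
    then have "norm (1 / \<omega> k) < 1" by (auto simp: norm_divide divide_less_eq)
    ultimately show ?thesis using True by (simp add: \<theta>_def)
  next
    case False
    then show ?thesis using nz by (auto simp: \<theta>_def)
  qed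
  moreover have "g \<zeta> * poly (lin_prod (\<lambda>j. 1 / z j) \<nu> {1..l}) \<zeta> = g 0 * poly (lin_prod \<theta> (\<lambda>_. 1) {1..m}) \<zeta>"
    if \<zeta>: "norm \<zeta> \<le> 1" for \<zeta>
  proof -
    have A: "poly (lin_prod \<theta> (\<lambda>_. 1) {1..m}) x = (\<Prod>k=1..d. 1 - x / \<omega> k)" for x
    proof -
      have "poly (lin_prod \<theta> (\<lambda>_. 1) {1..m}) x = (\<Prod>k\<in>{1..m}. 1 - \<theta> k * x)"
        by (simp add: poly_lin_prod)
      also have "\<dots> = (\<Prod>k\<in>{1..d}. 1 - \<theta> k * x)"
        by (rule prod.mono_neutral_right) (use d in \<open>auto simp: \<theta>_def\<close>)
      also have "\<dots> = (\<Prod>k=1..d. 1 - x / \<omega> k)" by (intro prod.cong) (auto simp: \<theta>_def)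
      finally show ?thesis .
    qed
    have N: "(\<Prod>k=1..d. x - \<omega> k) = (\<Prod>k=1..d. - \<omega> k) * (\<Prod>k=1..d. 1 - x / \<omega> k)" for x
      unfolding prod.distrib[symmetric] using n\<omega> by (intro prod.cong) (auto simp: field_simps)
    have P: "(\<Prod>j=1..l. (x - z j) ^ \<nu> j) = (\<Prod>j=1..l. (- z j) ^ \<nu> j) * poly (lin_prod (\<lambda>j. 1 / z j) \<nu> {1..l}) x" for x
      unfolding poly_lin_prod prod.distrib[symmetric]
    proof (intro prod.cong refl)
      fix j assume "j \<in> {1..l}"
      then have "x - z j = - z j * (1 - 1 / z j * x)" using nz by (simp add: field_simps)
      then show "(x - z j) ^ \<nu> j = (- z j) ^ \<nu> j * (1 - 1 / z j * x) ^ \<nu> j" by (simp only: power_mult_distrib)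
    qed
    define Z where "Z = (\<Prod>j=1..l. (- z j) ^ \<nu> j)"
    have Z: "Z \<noteq> 0" using nz by (auto simp: Z_def)
    have B: "poly (lin_prod (\<lambda>j. 1 / z j) \<nu> {1..l}) \<zeta> \<noteq> 0"
    proof (rule poly_lin_prod_nonzero)
      fix j assume j: "j \<in> {1..l}"
      have "z j \<noteq> \<zeta>" using z j \<zeta> by force
      then show "1 - 1 / z j * \<zeta> \<noteq> 0" using nz[OF j] by (simp add: field_simps)
    qed simp
    have "g 0 = b * (\<Prod>k=1..d. - \<omega> k) / Z"
      using eq N[of 0] P[of 0] by (simp add: Z_def)
    moreover have "g \<zeta> = b * (\<Prod>k=1..d. \<zeta> - \<omega> k) / (\<Prod>j=1..l. (\<zeta> - z j) ^ \<nu> j)"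
      using eq \<zeta> by simp
    then have "g \<zeta> = b * ((\<Prod>k=1..d. - \<omega> k) * (\<Prod>k=1..d. 1 - \<zeta> / \<omega> k)) / (Z * poly (lin_prod (\<lambda>j. 1 / z j) \<nu> {1..l}) \<zeta>)"
      unfolding N[of \<zeta>] P[of \<zeta>] Z_def .
    ultimately show ?thesis unfolding A using B by simp
  qed
  ultimately show ?thesis by blast
qed

section \<open>Bounds on the order of the first nonvanishing moment\<close>

context global_rational_solution
begin

text \<open>If r > m, the recurrence for \<open>f'\<close> applies at index r and expresses a_(r+1)
  by the n preceding coefficients, contradicting the different sizes of these coefficients.\<close>

lemma vanishing_order_le:
  assumes r: "2 \<le> r" and M: "\<And>k. 1 \<le> k \<Longrightarrow> k < r \<Longrightarrow> moment k 0 = 0" "moment r 0 \<noteq> 0"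
    and n: "sum \<nu> {1..l} \<le> m"
  shows "r \<le> m"
proof (rule ccontr)
  assume "\<not> r \<le> m"
  then have mr: "m < r" by simp
  let ?n = "sum \<nu> {1..l}"
  show False
  proof (rule no_linear_recurrence[of r "2 ^ ?n * real r"])
    fix t :: real assume t: "0 \<le> t"
    obtain \<rho> where \<rho>: "1 < \<rho>" "f t holomorphic_on ball 0 \<rho>" using f_holomorphic[OF t] by metis
    have "deriv (f t) holomorphic_on ball 0 \<rho>" using \<rho> by (intro holomorphic_deriv) auto
    then have h: "deriv (f t) holomorphic_on ball 0 1" by (rule holomorphic_on_subset) (use \<rho> in auto)
    have "norm (taylor_coeff (f t) (Suc r)) \<le> real (Suc r) * norm (taylor_coeff (f t) (Suc r))"
      using mult_right_mono[of 1 "real (Suc r)" "norm (taylor_coeff (f t) (Suc r))"] by simp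
    also have "\<dots> = norm (taylor_coeff (deriv (f t)) r)"
      unfolding taylor_coeff_deriv by (simp only: norm_mult norm_of_nat)
    also have "\<dots> \<le> 2 ^ ?n * (\<Sum>i\<in>{r - ?n..<r}. norm (taylor_coeff (deriv (f t)) i))"
    proof (rule taylor_recurrence_bound[OF h])
      show "degree (smult (of_real (a t)) (A t)) < r"
        using degree_A[of t] degree_smult_le[of "of_real (a t)" "A t"] mr by linarith
      show "poly (B t) w * deriv (f t) w = poly (smult (of_real (a t)) (A t)) w" if "w \<in> ball 0 1" for w
        using form[OF t, of w] that by (simp add: mult.commute)
    qed (use norm_eta[OF t] in \<open>auto intro: less_imp_le\<close>)
    also have "(\<Sum>i\<in>{r - ?n..<r}. norm (taylor_coeff (deriv (f t)) i)) \<le> real r * (\<Sum>s=2..r. norm (taylor_coeff (f t) s))"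
    proof -
      have "(\<Sum>i\<in>{r - ?n..<r}. norm (taylor_coeff (deriv (f t)) i)) \<le> (\<Sum>i\<in>{r - ?n..<r}. real r * norm (taylor_coeff (f t) (Suc i)))"
        unfolding taylor_coeff_deriv norm_mult norm_of_nat by (intro sum_mono mult_right_mono) auto
      also have "\<dots> = (\<Sum>s\<in>{Suc (r - ?n)..<Suc r}. real r * norm (taylor_coeff (f t) s))"
        by (rule sum.shift_bounds_Suc_ivl[symmetric])
      \<comment> \<open>Because n \<le> m < r, the window of the recurrence starts at index 2 or
        later; a_1, which tends to infinity, must not occur in it.\<close>
      also have "\<dots> \<le> (\<Sum>s=2..r. real r * norm (taylor_coeff (f t) s))"
        by (rule sum_mono2) (use mr n in auto)
      finally show ?thesis by (simp add: sum_distrib_left)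
    qed
    finally show "norm (taylor_coeff (f t) (Suc r)) \<le> 2 ^ ?n * real r * (\<Sum>s=2..r. norm (taylor_coeff (f t) s))"
      by (simp add: mult.assoc)
  qed (use r M in auto)
qed

text \<open>Without logarithms the recurrence can be applied to \<open>f\<close> itself, whose
  denominator has each multiplicity lowered by one. The index r + 1 exceeds the numerator degree as
  soon as r > d.\<close>

lemma vanishing_order_le_rational:
  assumes r: "2 \<le> r" and M: "\<And>k. 1 \<le> k \<Longrightarrow> k < r \<Longrightarrow> moment k 0 = 0" "moment r 0 \<noteq> 0"
    and D: "(\<Sum>j=1..l. \<nu> j - 1) \<le> d"
    and P: "\<And>t. 0 \<le> t \<Longrightarrow> \<exists>P. degree P \<le> d + 1 \<and>
      (\<forall>w\<in>ball 0 1. poly (lin_prod (\<lambda>j. \<eta> j t) (\<lambda>j. \<nu> j - 1) {1..l}) w * f t w = poly P w)"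
  shows "r \<le> d"
proof (rule ccontr)
  assume "\<not> r \<le> d"
  then have dr: "d < r" by simp
  let ?n = "\<Sum>j=1..l. \<nu> j - 1"
  show False
  proof (rule no_linear_recurrence[of r "2 ^ ?n"])
    fix t :: real assume t: "0 \<le> t"
    obtain \<rho> where \<rho>: "1 < \<rho>" "f t holomorphic_on ball 0 \<rho>" using f_holomorphic[OF t] by metis
    have h: "f t holomorphic_on ball 0 1" by (rule holomorphic_on_subset[OF \<rho>(2)]) (use \<rho> in auto)
    obtain P where P: "degree P \<le> d + 1"
      "\<And>w. w \<in> ball 0 1 \<Longrightarrow> poly (lin_prod (\<lambda>j. \<eta> j t) (\<lambda>j. \<nu> j - 1) {1..l}) w * f t w = poly P w"
      using assms(5)[OF t] by blast
    have "norm (taylor_coeff (f t) (Suc r)) \<le> 2 ^ ?n * (\<Sum>i\<in>{Suc r - ?n..<Suc r}. norm (taylor_coeff (f t) i))"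
      by (rule taylor_recurrence_bound[OF h _ _ _ P(2)]) (use norm_eta[OF t] P(1) dr in \<open>auto intro: less_imp_le\<close>)
    \<comment> \<open>From \<open>?n\<close> \<le> d < r it follows that the window begins at r + 1
      - \<open>?n\<close> \<ge> 2, so again a_1 is left out.\<close>
    also have "\<dots> \<le> 2 ^ ?n * (\<Sum>s=2..r. norm (taylor_coeff (f t) s))"
      by (intro mult_left_mono sum_mono2) (use D dr in auto)
    finally show "norm (taylor_coeff (f t) (Suc r)) \<le> 2 ^ ?n * (\<Sum>s=2..r. norm (taylor_coeff (f t) s))" .
  qed (use r M in auto)
qed

end

theorem theorem6p2:
  fixes f :: "real \<Rightarrow> complex \<Rightarrow> complex"
    and q :: "real \<Rightarrow> real"
    and m n l :: nat
    and \<nu> :: "nat \<Rightarrow> nat"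
    and e :: "nat \<Rightarrow> complex"
    and z b c :: "nat \<Rightarrow> real \<Rightarrow> complex"
    and \<tau> :: real
  assumes "continuous_on {0..} q"
    and "\<forall>t\<ge>0. q t > 0"
    and "filterlim (\<lambda>t. integral {0..t} q) at_top at_top"
    and "locally_univalent_solution q f"
    and "\<forall>j\<in>{1..l}. \<nu> j \<ge> 1"
    and "n = (\<Sum>j=1..l. \<nu> j)"
    and "n \<le> m"
    and "deriv_form_preserved m n l \<nu> z f"
    and "log_rational_form m n l \<nu> e z b c f"
    and "\<tau> \<ge> 0"
  shows
    "((\<exists>s :: nat \<Rightarrow> real. filterlim s at_top sequentially \<and>
        (\<forall>N\<ge>1. \<forall>j\<in>{0, 1}.
          (\<lambda>t. section_error (f t) N j)
            \<in> O[at_top](\<lambda>t. Re (taylor_coeff (f t) 1) powr (- s N)))) \<and>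
      (\<forall>j. \<exists>s :: nat \<Rightarrow> real. filterlim s at_top sequentially \<and>
        (\<forall>N\<ge>1.
          (\<lambda>t. section_error (f t) N j)
            \<in> O[at_top](\<lambda>t. Re (taylor_coeff (f t) 1) powr (- s N)))))
     \<and>
     (\<forall>k\<ge>2. ((\<lambda>t. taylor_coeff (f t) k * taylor_coeff (f t) 1 ^ k)
        \<longlongrightarrow> cnj (harmonic_moment (f \<tau>) (k - 1))) at_top)
     \<and>
     (\<forall>r\<ge>2. (\<forall>k\<in>{1..<r}. harmonic_moment (f \<tau>) k = 0) \<and> harmonic_moment (f \<tau>) r \<noteq> 0 \<longrightarrow>
        (\<forall>s\<in>{2..r}. ((\<lambda>t. taylor_coeff (f t) s * taylor_coeff (f t) 1 ^ (r + 1))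
          \<longlongrightarrow> 0) at_top) \<and>
        r \<le> m \<and>
        ((\<forall>j\<in>{1..l}. e j = 0) \<longrightarrow> r \<le> m - l))"
proof -
  note sol = assms(4) and deg = assms(6,7) and pres = assms(8) and logr = assms(9)
  interpret pg_solution q f
    using assms(1,2) sol by unfold_locales auto
  \<comment> \<open>At the exceptional time the numerator has fewer than n = m zeros, so d \<le> m
    holds at all times.\<close>
  obtain d where d: "\<And>t. 0 \<le> t \<Longrightarrow> zero_pole_form (d t) l \<nu> (\<lambda>j. z j t) (deriv (f t))"
    and dm: "\<And>t. 0 \<le> t \<Longrightarrow> d t \<le> m"
    using pres deg(2) unfolding deriv_form_preserved_def by (metis less_imp_le order_refl order_trans)
  have "\<exists>\<theta>. (\<forall>k\<in>{1..m}. norm (\<theta> k) < 1 \<and> (\<forall>j\<in>{1..l}. \<theta> k \<noteq> 1 / z j t)) \<and>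
    (\<forall>\<zeta>. norm \<zeta> \<le> 1 \<longrightarrow> deriv (f t) \<zeta> * poly (lin_prod (\<lambda>j. 1 / z j t) \<nu> {1..l}) \<zeta> =
      deriv (f t) 0 * poly (lin_prod \<theta> (\<lambda>_. 1) {1..m}) \<zeta>)" if "0 \<le> t" for t
    using zero_pole_normal_form[OF d[OF that] dm[OF that]] .
  \<comment> \<open>The zeros are chosen at each time separately, with no relation between the
    choices.\<close>
  then obtain \<theta>' where \<theta>': "\<And>t. 0 \<le> t \<Longrightarrow> (\<forall>k\<in>{1..m}. norm (\<theta>' t k) < 1 \<and> (\<forall>j\<in>{1..l}. \<theta>' t k \<noteq> 1 / z j t)) \<and>
    (\<forall>\<zeta>. norm \<zeta> \<le> 1 \<longrightarrow> deriv (f t) \<zeta> * poly (lin_prod (\<lambda>j. 1 / z j t) \<nu> {1..l}) \<zeta> =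
      deriv (f t) 0 * poly (lin_prod (\<theta>' t) (\<lambda>_. 1) {1..m}) \<zeta>)"
    by metis
  have zz: "inj_on (\<lambda>j. z j t) {1..l}" "\<And>j. j \<in> {1..l} \<Longrightarrow> 1 < norm (z j t)" if "0 \<le> t" for t
    using d[OF that] by (auto simp: zero_pole_form_def)
  interpret global_rational_solution q f m l \<nu> "\<lambda>k t. \<theta>' t k" "\<lambda>j t. 1 / z j t"
  proof unfold_locales
    fix t :: real assume t: "0 \<le> t"
    show "inj_on (\<lambda>j. 1 / z j t) {1..l}"
    proof (rule inj_onI)
      fix i j assume ij: "i \<in> {1..l}" "j \<in> {1..l}" and "1 / z i t = 1 / z j t"
      then have "z i t = z j t" by simp
      then show "i = j" by (rule inj_onD[OF zz(1)[OF t] _ ij])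
    qed
    show "1 / z j t \<noteq> 0" "norm (1 / z j t) < 1" if "j \<in> {1..l}" for j
      using zz(2)[OF t that] by (auto simp: norm_divide divide_less_eq)
    show "norm (\<theta>' t k) < 1" if "k \<in> {1..m}" for k using \<theta>'[OF t] that by blast
    show "\<theta>' t k \<noteq> 1 / z j t" if "k \<in> {1..m}" "j \<in> {1..l}" for k j using \<theta>'[OF t] that by blast
    show "deriv (f t) \<zeta> * poly (lin_prod (\<lambda>j. 1 / z j t) \<nu> {1..l}) \<zeta> =
      of_real (a t) * poly (lin_prod (\<theta>' t) (\<lambda>_. 1) {1..m}) \<zeta>" if "norm \<zeta> \<le> 1" for \<zeta>
      using \<theta>'[OF t] that deriv_f_0[OF t] by auto
  qed (use assms(3,5) in auto)
  have a1: "Re (taylor_coeff (f t) 1) = a t" for t by (simp add: taylor_coeff_def a_def)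
  have a1': "taylor_coeff (f t) 1 = of_real (a t)" if "0 \<le> t" for t
    using deriv_f_0[OF that] by (simp add: taylor_coeff_def)
  have mom: "harmonic_moment (f \<tau>) k = moment k 0" if "1 \<le> k" for k
    using harmonic_moment_eq moment_const[OF that assms(10)] by simp
  have lim_cong: "((\<lambda>t. taylor_coeff (f t) k * taylor_coeff (f t) 1 ^ i) \<longlongrightarrow> L) at_top"
    if "((\<lambda>t. taylor_coeff (f t) k * of_real (a t) ^ i) \<longlongrightarrow> L) at_top" for k i L
    by (rule Lim_transform_eventually[OF that])
      (use eventually_ge_at_top[of 0] in \<open>eventually_elim, simp only: a1'\<close>)
  obtain s where s: "filterlim s at_top sequentially"
    "\<And>N j. (\<lambda>t. section_error (f t) N j) \<in> O[at_top](\<lambda>t. a t powr (- s N))"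
    using section_error_decay by blast
  have ii: "((\<lambda>t. taylor_coeff (f t) k * taylor_coeff (f t) 1 ^ k)
        \<longlongrightarrow> cnj (harmonic_moment (f \<tau>) (k - 1))) at_top" if k: "2 \<le> k" for k
  proof -
    obtain k' where k': "k = Suc k'" "1 \<le> k'" using k by (cases k) auto
    show ?thesis using lim_cong[OF coefficient_limit[OF k'(2)]] mom[OF k'(2)] k'(1) by simp
  qed
  have iii: "(\<forall>s\<in>{2..r}. ((\<lambda>t. taylor_coeff (f t) s * taylor_coeff (f t) 1 ^ (r + 1)) \<longlongrightarrow> 0) at_top) \<and>
      r \<le> m \<and> ((\<forall>j\<in>{1..l}. e j = 0) \<longrightarrow> r \<le> m - l)"
    if r: "2 \<le> r" and M: "(\<forall>k\<in>{1..<r}. harmonic_moment (f \<tau>) k = 0) \<and> harmonic_moment (f \<tau>) r \<noteq> 0" for r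
  proof (intro conjI impI ballI)
    have M0: "moment k 0 = 0" if "1 \<le> k" "k < r" for k using M mom[OF that(1)] that by auto
    have Mr: "moment r 0 \<noteq> 0" using M mom[of r] r by auto
    show "((\<lambda>t. taylor_coeff (f t) s * taylor_coeff (f t) 1 ^ (r + 1)) \<longlongrightarrow> 0) at_top" if "s \<in> {2..r}" for s
      by (rule lim_cong[OF coefficient_vanishing[OF M0 that]])
    show "r \<le> m" by (rule vanishing_order_le[OF r M0 Mr]) (use deg in auto)
    have "l \<le> n"
    proof -
      have "(\<Sum>j=1..l. 1) \<le> (\<Sum>j=1..l. \<nu> j)" using assms(5) by (intro sum_mono) auto
      then show ?thesis using deg(1) by simp
    qed
    \<comment> \<open>Integration lowers the order of each of the l distinct poles by one; truncated
      subtraction is exact because every multiplicity is at least 1.\<close>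
    moreover have D: "(\<Sum>j=1..l. \<nu> j - 1) = n - l"
      using sum_subtractf_nat[of "{1..l}" "\<lambda>_. 1" \<nu>] assms(5) deg(1) by simp
    ultimately have nl: "n - l \<le> m - l" using deg(2) by simp
    assume e0: "\<forall>j\<in>{1..l}. e j = 0"
    \<comment> \<open>With all residues zero only the rational part of \<open>f\<close> is left; its
      numerator has degree at most m - l + 1, which is the d + 1 of the recurrence argument.\<close>
    show "r \<le> m - l"
    proof (rule vanishing_order_le_rational[OF r M0 Mr])
      show "(\<Sum>j=1..l. \<nu> j - 1) \<le> m - l" using D nl by simp
      fix t :: real assume t: "0 \<le> t"
      let ?C = "lin_prod (\<lambda>j. 1 / z j t) (\<lambda>j. \<nu> j - 1) {1..l}"
      let ?P = "\<Sum>j=1..m-l+1. monom (b j t) j"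
      have "degree ?P \<le> m - l + 1"
        by (intro degree_sum_le) (auto intro: order_trans[OF degree_monom_le])
      moreover have "poly ?C w * f t w = poly ?P w" if w: "w \<in> ball 0 1" for w
      proof -
        have C: "(\<Sum>j=0..n-l. c j t * w ^ j) = poly ?C w"
          using logr t unfolding log_rational_form_def poly_lin_prod by simp
        have "poly ?C w \<noteq> 0"
        proof (rule poly_lin_prod_nonzero)
          fix j assume j: "j \<in> {1..l}"
          have "z j t \<noteq> w" using zz(2)[OF t j] w by auto
          moreover have "z j t \<noteq> 0" using zz(2)[OF t j] by auto
          ultimately show "1 - 1 / z j t * w \<noteq> 0" by (simp add: field_simps)
        qed simp
        moreover have "f t w = (\<Sum>j=1..l. e j * Ln (1 - w / z j t)) +
                 (\<Sum>j=1..m-l+1. b j t * w ^ j) / (\<Sum>j=0..n-l. c j t * w ^ j)"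
          using logr t w unfolding log_rational_form_def by simp
        then have "f t w = (\<Sum>j=1..m-l+1. b j t * w ^ j) / poly ?C w"
          using e0 C by simp
        moreover have "poly ?P w = (\<Sum>j=1..m-l+1. b j t * w ^ j)" by (simp only: poly_sum poly_monom)
        ultimately show ?thesis by simp
      qed
      ultimately show "\<exists>P. degree P \<le> m - l + 1 \<and> (\<forall>w\<in>ball 0 1. poly ?C w * f t w = poly P w)" by blast
    qed
  qed
  show ?thesis
    unfolding a1 using s ii iii by blast
qed

end
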